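(* Let $(A,F)$ be an abelian variety of quaternion type of dimension $2n$, let $K$ be a quadratic subfield of $F$ and assume that $A$ is isogenous to $B^2$ with $B$ of Weil type for the field $K$ and $\mathrm{End}(B)\otimes\mathbf Q\cong K$. Then the subspace $W_F\subset H^{2n}(A,\mathbf Q)$ is spanned by intersections of divisor classes (i.e. by products of $n$ classes in $H^2(A,\mathbf Q)\cap H^{1,1}(A)$).
   Context: Abelian varieties are over $\mathbf C$. A definite quaternion algebra $F$ over $\mathbf Q$ is a skew field with center $\mathbf Q$, of dimension $4$ over $\mathbf Q$, with $F\otimes_{\mathbf Q}\mathbf R$ isomorphic to Hamilton's quaternions; $x\mapsto\bar x$ is its canonical involution. A polarized abelian variety $(A,E)$ is of quaternion type with algebra $F$ if $F\subset\mathrm{End}(A)\otimes\mathbf Q$ is a definite quaternion algebra such that $H_1(A,\mathbf Q)$ is an $F$-vector space and $x^*E=x\bar xE$ for $x\in F$. For an imaginary quadratic field $K$ with complex embeddings $\sigma,\bar\sigma$, a polarized abelian variety $(B,E_B)$ of even dimension $2m$ is of Weil type with field $K$ if $K\subset\mathrm{End}(B)\otimes\mathbf Q$, $H_1(B,\mathbf Q)$ is a $K$-vector space, every $x\in K$ has eigenvalues $\sigma(x)$ and $\bar\sigma(x)$ on $T_0B$, each with multiplicity $m$, and $x^*E_B=x\bar xE_B$. For $A$ of quaternion type of dimension $2n$ and a quadratic subfield $K\subset F$ (automatically imaginary), let $V_\rho\subset H^1(A,\mathbf C)$ ($\rho\in\{\sigma,\bar\sigma\}$) be the $2n$-dimensional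 eigenspace on which $x\in K$ acts as $\rho(x)$. The space of Weil classes $W_K\subset H^{2n}(A,\mathbf Q)$ is the two-dimensional subspace with $W_K\otimes_{\mathbf Q}\mathbf C=\wedge^{2n}V_\sigma\oplus\wedge^{2n}V_{\bar\sigma}$. $W_F\subset H^{2n}(A,\mathbf Q)$ is the subspace spanned by the translates $x\cdot W_K$, $x\in F$, where $x$ acts on $H^{2n}(A,\mathbf Q)=\wedge^{2n}H^1(A,\mathbf Q)$ through $\wedge^{2n}$ of its action on $H^1$; it does not depend on the choice of $K$. *)

theory Defs
  imports
    "HOL-Analysis.Analysis"
    "HOL-Combinatorics.Permutations"
    "HOL-Library.Function_Algebras"
    "HOL-Algebra.Subrings"
    "HOL-Algebra.QuotRing"
begin

section \<open>Complex tori and polarizations\<close>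

text \<open>
  A complex torus of dimension \<open>CARD('g)\<close> is \<open>\<complex>\<^sup>g / L\<close>, where \<open>\<complex>\<^sup>g\<close> (the type \<open>complex^'g\<close>) is its
  tangent space at \<open>0\<close> and the lattice \<open>L\<close> is its first integral homology group. The torus is
  represented by \<open>L\<close>.
\<close>

definition torus_lattice :: "(complex^'g::finite) set \<Rightarrow> bool" where
  "torus_lattice L \<longleftrightarrow>
     (\<exists>B. independent B \<and> span B = UNIV \<and>
          L = {\<Sum>b\<in>B. real_of_int (c b) *\<^sub>R b | c. True})"

text \<open>\<open>polarization L E\<close>: \<open>E\<close> is the (real extension of the) imaginary part of a positive definite
  Hermitian form, integral on \<open>L\<close>. An abelian variety is a torus that has a polarization.\<close>

definition polarization ::
    "(complex^'g::finite) set \<Rightarrow> (complex^'g \<Rightarrow> complex^'g \<Rightarrow> real) \<Rightarrow> bool" where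
  "polarization L E \<longleftrightarrow>
     bilinear E \<and> (\<forall>v. E v v = 0) \<and>
     (\<forall>u\<in>L. \<forall>v\<in>L. E u v \<in> \<int>) \<and>
     (\<forall>u v. E (\<i> *s u) (\<i> *s v) = E u v) \<and>
     (\<forall>v. v \<noteq> 0 \<longrightarrow> E (\<i> *s v) v > 0)"

definition polarized_abelian_variety ::
    "(complex^'g::finite) set \<Rightarrow> (complex^'g \<Rightarrow> complex^'g \<Rightarrow> real) \<Rightarrow> bool" where
  "polarized_abelian_variety L E \<longleftrightarrow> torus_lattice L \<and> polarization L E"

text \<open>Homomorphisms of tori are given by their differential at \<open>0\<close>, a complex matrix mapping the
  one lattice into the other. An isogeny is surjective with finite kernel.\<close>

definition torus_hom ::
    "(complex^'g::finite) set \<Rightarrow> (complex^'h::finite) set \<Rightarrow> complex^'g^'h \<Rightarrow> bool" where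
  "torus_hom L L' M \<longleftrightarrow> (\<forall>v\<in>L. M *v v \<in> L')"

definition isogeny ::
    "(complex^'g::finite) set \<Rightarrow> (complex^'h::finite) set \<Rightarrow> complex^'g^'h \<Rightarrow> bool" where
  "isogeny L L' M \<longleftrightarrow>
     torus_hom L L' M \<and>
     (\<forall>w. \<exists>v. M *v v - w \<in> L') \<and>
     finite ({v. M *v v \<in> L'} // {(u, v). u - v \<in> L})"

definition isogenous :: "(complex^'g::finite) set \<Rightarrow> (complex^'h::finite) set \<Rightarrow> bool" where
  "isogenous L L' \<longleftrightarrow> (\<exists>M. isogeny L L' M)"

definition square_torus :: "(complex^'h::finite) set \<Rightarrow> (complex^('h + 'h)) set" where
  "square_torus L = {v. (\<chi> i. v $ Inl i) \<in> L \<and> (\<chi> i. v $ Inr i) \<in> L}"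


section \<open>Endomorphism algebras and their subalgebras\<close>

definition qscaleR :: "rat \<Rightarrow> complex^'g^'g \<Rightarrow> complex^'g^'g::finite" where
  "qscaleR q M = real_of_rat q *\<^sub>R M"

interpretation qmat: vector_space "qscaleR :: rat \<Rightarrow> complex^'g^'g \<Rightarrow> complex^'g^'g::finite"
  by unfold_locales
    (simp_all add: qscaleR_def scaleR_add_right scaleR_add_left of_rat_add of_rat_mult)

text \<open>\<open>endo_alg L\<close> is \<open>End(A) \<otimes> \<rat>\<close>: every element of it is an endomorphism divided by a positive
  integer.\<close>

definition endo_alg :: "(complex^'g::finite) set \<Rightarrow> (complex^'g^'g) ring" where
  "endo_alg L =
     \<lparr>carrier = {M. \<exists>k::nat. k > 0 \<and> torus_hom L L (real k *\<^sub>R M)},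
      mult = (**), one = mat 1, zero = 0, add = (+)\<rparr>"

abbreviation subalg :: "(complex^'g::finite) set \<Rightarrow> (complex^'g^'g) set \<Rightarrow> (complex^'g^'g) ring"
  where "subalg L S \<equiv> (endo_alg L)\<lparr>carrier := S\<rparr>"

definition rat_mat :: "rat \<Rightarrow> complex^'g^'g::finite" where
  "rat_mat q = mat (of_rat q)"

text \<open>The fields are unital subrings of \<open>End(A) \<otimes> \<rat>\<close>, so the first rational homology
  \<open>L \<otimes> \<rat>\<close> is a vector space over them.\<close>

definition quadratic_field :: "(complex^'g::finite) set \<Rightarrow> (complex^'g^'g) set \<Rightarrow> bool" where
  "quadratic_field L K \<longleftrightarrow> subfield K (endo_alg L) \<and> qmat.dim K = 2"

definition complex_ring :: "complex ring" where
  "complex_ring = \<lparr>carrier = UNIV, mult = (*), one = 1, zero = 0, add = (+)\<rparr>"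

definition complex_embedding ::
    "(complex^'g::finite) set \<Rightarrow> (complex^'g^'g) set \<Rightarrow> (complex^'g^'g \<Rightarrow> complex) \<Rightarrow> bool" where
  "complex_embedding L K \<sigma> \<longleftrightarrow> \<sigma> \<in> ring_hom (subalg L K) complex_ring"

definition imaginary_quadratic_field ::
    "(complex^'g::finite) set \<Rightarrow> (complex^'g^'g) set \<Rightarrow> bool" where
  "imaginary_quadratic_field L K \<longleftrightarrow>
     quadratic_field L K \<and> (\<nexists>\<sigma>. complex_embedding L K \<sigma> \<and> \<sigma> ` K \<subseteq> \<real>)"

text \<open>Hamilton's quaternions \<open>a + b i + c j + d k\<close> as quadruples \<open>(a, b, c, d)\<close>.\<close>

type_synonym hamilton = "real \<times> real \<times> real \<times> real"

fun hamilton_mult :: "hamilton \<Rightarrow> hamilton \<Rightarrow> hamilton" where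
  "hamilton_mult (a, b, c, d) (a', b', c', d') =
     (a * a' - b * b' - c * c' - d * d',
      a * b' + b * a' + c * d' - d * c',
      a * c' - b * d' + c * a' + d * b',
      a * d' + b * c' - c * b' + d * a')"

text \<open>\<open>F \<otimes> \<real>\<close> is isomorphic to Hamilton's quaternions. By the universal property, homomorphisms of
  \<open>\<real>\<close>-algebras on \<open>F \<otimes> \<real>\<close> are the real-linear extensions of homomorphisms \<open>j\<close> of \<open>\<rat>\<close>-algebras on
  \<open>F\<close>. As \<open>b \<otimes> 1\<close>, for \<open>b\<close> in a \<open>\<rat>\<close>-basis of \<open>F\<close>, form an \<open>\<real>\<close>-basis of \<open>F \<otimes> \<real>\<close>, the extension is
  bijective iff \<open>j\<close> maps a \<open>\<rat>\<close>-basis bijectively to an \<open>\<real>\<close>-basis.\<close>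

definition hamilton_over_reals :: "(complex^'g^'g::finite) set \<Rightarrow> bool" where
  "hamilton_over_reals F \<longleftrightarrow>
     (\<exists>j :: complex^'g^'g \<Rightarrow> hamilton.
        j (mat 1) = (1, 0, 0, 0) \<and>
        (\<forall>x\<in>F. \<forall>y\<in>F. j (x + y) = j x + j y \<and> j (x ** y) = hamilton_mult (j x) (j y)) \<and>
        (\<exists>B\<subseteq>F. qmat.independent B \<and> qmat.span B = F \<and>
                inj_on j B \<and> independent (j ` B) \<and> span (j ` B) = UNIV))"

definition definite_quaternion_algebra ::
    "(complex^'g::finite) set \<Rightarrow> (complex^'g^'g) set \<Rightarrow> bool" where
  "definite_quaternion_algebra L F \<longleftrightarrow>
     subring F (endo_alg L) \<and>
     (\<forall>x\<in>F. x \<noteq> 0 \<longrightarrow> (\<exists>y\<in>F. x ** y = mat 1 \<and> y ** x = mat 1)) \<and>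
     {z\<in>F. \<forall>x\<in>F. z ** x = x ** z} = range rat_mat \<and>
     qmat.dim F = 4 \<and>
     hamilton_over_reals F"

text \<open>
  Both a quaternion algebra and a quadratic field \<open>F\<close> are the sum of \<open>\<rat>\<close> and the subspace of pure
  elements: those that are zero or a non-rational square root of a rational number. The canonical
  involution is \<open>a + z \<mapsto> a - z\<close> for rational \<open>a\<close> and pure \<open>z\<close>. On an imaginary quadratic field it is
  complex conjugation.
\<close>

definition pure_element :: "(complex^'g^'g::finite) set \<Rightarrow> complex^'g^'g \<Rightarrow> bool" where
  "pure_element F z \<longleftrightarrow>
     z \<in> F \<and> (z = 0 \<or> z \<notin> range rat_mat \<and> z ** z \<in> range rat_mat)"

definition canonical_conj :: "(complex^'g^'g::finite) set \<Rightarrow> complex^'g^'g \<Rightarrow> complex^'g^'g" where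
  "canonical_conj F x =
     (THE y. \<exists>a z. pure_element F z \<and> x = rat_mat a + z \<and> y = rat_mat a - z)"

text \<open>\<open>x\<^sup>* E = x x\<bar> E\<close> for all \<open>x \<in> F\<close>, where \<open>x\<bar>\<close> is the conjugate of \<open>x\<close> and \<open>x x\<bar>\<close> is a rational
  number.\<close>

definition norm_compatible ::
    "(complex^'g^'g::finite) set \<Rightarrow> (complex^'g \<Rightarrow> complex^'g \<Rightarrow> real) \<Rightarrow> bool" where
  "norm_compatible F E \<longleftrightarrow>
     (\<forall>x\<in>F. \<exists>q. x ** canonical_conj F x = rat_mat q \<and>
                 (\<forall>u v. E (x *v u) (x *v v) = real_of_rat q * E u v))"

definition quaternion_type ::
    "(complex^'g::finite) set \<Rightarrow> (complex^'g \<Rightarrow> complex^'g \<Rightarrow> real) \<Rightarrow> (complex^'g^'g) set \<Rightarrow> bool"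
  where
  "quaternion_type L E F \<longleftrightarrow>
     polarized_abelian_variety L E \<and> definite_quaternion_algebra L F \<and> norm_compatible F E"

text \<open>The eigenvalues and their multiplicities are expressed by the characteristic polynomial
  of \<open>x\<close> on the tangent space.\<close>

definition weil_type ::
    "(complex^'h::finite) set \<Rightarrow> (complex^'h \<Rightarrow> complex^'h \<Rightarrow> real) \<Rightarrow> (complex^'h^'h) set \<Rightarrow> bool"
  where
  "weil_type L E K \<longleftrightarrow>
     polarized_abelian_variety L E \<and> imaginary_quadratic_field L K \<and>
     (\<exists>m \<sigma>. CARD('h) = 2 * m \<and> complex_embedding L K \<sigma> \<and>
        (\<forall>x\<in>K. \<forall>t. det (mat t - x) = (t - \<sigma> x) ^ m * (t - cnj (\<sigma> x)) ^ m)) \<and>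
     norm_compatible K E"


section \<open>Cohomology\<close>

text \<open>
  The \<open>k\<close>-th complex cohomology of \<open>A\<close> is the \<open>k\<close>-th exterior power of the first one, i.e.\ the space of
  alternating \<open>\<real>\<close>-multilinear \<open>k\<close>-forms with values in \<open>\<complex>\<close> on \<open>\<complex>\<^sup>g = L \<otimes> \<real>\<close>. A \<open>k\<close>-form is a function of
  a sequence of vectors which depends on its first \<open>k\<close> members only. The forms with
  rational values on \<open>L\<close> make up the rational cohomology.
\<close>

type_synonym 'v form = "(nat \<Rightarrow> 'v) \<Rightarrow> complex"

definition cscale :: "complex \<Rightarrow> 'v form \<Rightarrow> 'v form" where
  "cscale c f = (\<lambda>v. c * f v)"

definition qscale :: "rat \<Rightarrow> 'v form \<Rightarrow> 'v form" where
  "qscale q f = (\<lambda>v. of_rat q * f v)"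

interpretation cform: vector_space "cscale :: complex \<Rightarrow> 'v form \<Rightarrow> 'v form"
  by unfold_locales (auto simp: cscale_def algebra_simps)

interpretation qform: vector_space "qscale :: rat \<Rightarrow> 'v form \<Rightarrow> 'v form"
  by unfold_locales (auto simp: qscale_def algebra_simps of_rat_add of_rat_mult)

definition H_complex :: "nat \<Rightarrow> (complex^'g::finite) form set" where
  "H_complex k =
     {\<alpha>. (\<forall>v w. (\<forall>i<k. v i = w i) \<longrightarrow> \<alpha> v = \<alpha> w) \<and>
         (\<forall>i<k. \<forall>v. linear (\<lambda>u. \<alpha> (v(i := u)))) \<and>
         (\<forall>v i j. i < j \<and> j < k \<and> v i = v j \<longrightarrow> \<alpha> v = 0)}"

definition H_rat :: "(complex^'g::finite) set \<Rightarrow> nat \<Rightarrow> (complex^'g) form set" where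
  "H_rat L k = {\<alpha>\<in>H_complex k. \<forall>v. (\<forall>i<k. v i \<in> L) \<longrightarrow> \<alpha> v \<in> \<rat>}"

definition pullback :: "complex^'g^'g \<Rightarrow> (complex^'g::finite) form \<Rightarrow> (complex^'g) form" where
  "pullback x \<alpha> = (\<lambda>v. \<alpha> (\<lambda>i. x *v v i))"

text \<open>The cup (wedge) product of the \<open>d\<close>-forms \<open>\<alpha> 0, \<dots>, \<alpha> (n - 1)\<close>, normalized so that the product of
  \<open>1\<close>-forms is the determinant \<open>det (\<alpha>\<^sub>i (v\<^sub>j))\<close>.\<close>

definition cup :: "nat \<Rightarrow> nat \<Rightarrow> (nat \<Rightarrow> 'v form) \<Rightarrow> 'v form" where
  "cup d n \<alpha> =
     (\<lambda>v. (\<Sum>\<pi> | \<pi> permutes {..<d * n}.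
             of_int (sign \<pi>) * (\<Prod>i<n. \<alpha> i (\<lambda>j. v (\<pi> (d * i + j))))) / of_nat (fact d) ^ n)"

definition H_10 :: "(complex^'g::finite) form set" where
  "H_10 = {\<phi>\<in>H_complex 1. \<forall>v. \<phi> (\<lambda>i. \<i> *s v i) = \<i> * \<phi> v}"

definition H_01 :: "(complex^'g::finite) form set" where
  "H_01 = {\<phi>\<in>H_complex 1. \<forall>v. \<phi> (\<lambda>i. \<i> *s v i) = - \<i> * \<phi> v}"

definition H_11 :: "(complex^'g::finite) form set" where
  "H_11 = cform.span {cup 1 2 \<phi> | \<phi>. \<phi> 0 \<in> H_10 \<and> \<phi> 1 \<in> H_01}"

definition divisor_classes :: "(complex^'g::finite) set \<Rightarrow> (complex^'g) form set" where
  "divisor_classes L = H_rat L 2 \<inter> H_11"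

definition divisor_products :: "(complex^'g::finite) set \<Rightarrow> nat \<Rightarrow> (complex^'g) form set" where
  "divisor_products L n = {cup 2 n D | D. \<forall>i<n. D i \<in> divisor_classes L}"


section \<open>Weil classes\<close>

text \<open>The eigenspace of \<open>K\<close> in the first complex cohomology for a complex embedding \<open>\<rho>\<close>, its
  \<open>k\<close>-th exterior power, and the spaces of Weil classes, on an abelian variety of dimension \<open>2 * n\<close>.\<close>

definition eigenspace ::
    "(complex^'g^'g::finite) set \<Rightarrow> (complex^'g^'g \<Rightarrow> complex) \<Rightarrow> (complex^'g) form set" where
  "eigenspace K \<rho> = {\<phi>\<in>H_complex 1. \<forall>x\<in>K. pullback x \<phi> = cscale (\<rho> x) \<phi>}"

definition exterior_power :: "nat \<Rightarrow> 'v form set \<Rightarrow> 'v form set" where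
  "exterior_power k V = cform.span {cup 1 k \<phi> | \<phi>. \<forall>i<k. \<phi> i \<in> V}"

text \<open>Since \<open>W\<close> consists of rational classes, \<open>W \<otimes> \<complex>\<close> is its complex span.\<close>

definition weil_classes ::
    "(complex^'g::finite) set \<Rightarrow> (complex^'g^'g) set \<Rightarrow> (complex^'g^'g \<Rightarrow> complex) \<Rightarrow> nat
      \<Rightarrow> (complex^'g) form set" where
  "weil_classes L K \<sigma> n =
     (THE W. qform.subspace W \<and> W \<subseteq> H_rat L (2 * n) \<and> qform.dim W = 2 \<and>
        cform.span W =
          {\<alpha> + \<beta> | \<alpha> \<beta>. \<alpha> \<in> exterior_power (2 * n) (eigenspace K \<sigma>) \<and>
                       \<beta> \<in> exterior_power (2 * n) (eigenspace K (\<lambda>x. cnj (\<sigma> x)))})"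

definition quaternion_weil_classes ::
    "(complex^'g::finite) set \<Rightarrow> (complex^'g^'g) set \<Rightarrow> (complex^'g^'g) set
      \<Rightarrow> (complex^'g^'g \<Rightarrow> complex) \<Rightarrow> nat \<Rightarrow> (complex^'g) form set" where
  "quaternion_weil_classes L F K \<sigma> n =
     qform.span (\<Union>x\<in>F. pullback x ` weil_classes L K \<sigma> n)"

end

theory Submission
  imports Defs
begin

text \<open>
  The real homology of \<open>A\<close> is \<open>\<complex>\<^sup>g\<close> with the alternating form \<open>E\<close>. The point is that \<open>A\<close> has enough
  divisor classes to produce the line \<open>\<Lambda>\<^sup>2\<^sup>n V\<^sub>\<sigma>\<close> as the \<open>n\<close>-th power of a single complex combination of
  two of them.

  Polarizing \<open>x\<^sup>* E = x x\<bar> E\<close> shows that the \<open>E\<close>-adjoint of \<open>x \<in> F\<close> is \<open>t - x\<close> for a rational \<open>t\<close>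
  (\<open>norm_compatible_trace\<close>). Hence a generator \<open>\<kappa>\<close> of \<open>K\<close> with rational square, and every commutator
  \<open>z = \<kappa> x - x \<kappa>\<close>, is skew for \<open>E\<close>, and \<open>z \<kappa> = - \<kappa> z\<close>. The hypothesis on \<open>B\<close> supplies one more
  endomorphism: the centre of \<open>End(A) \<otimes> \<rat>\<close>, which is the algebra of \<open>2 \<times> 2\<close> matrices over
  \<open>End(B) \<otimes> \<rat>\<close>, contains an invertible \<open>d\<close> that is skew for \<open>E\<close> (\<open>central_skew_endomorphism\<close>). As
  \<open>d z\<close> and \<open>d z \<kappa>\<close> are products of commuting or anticommuting skew elements, both are self-adjoint,
  so that \<open>E (d z u) v\<close> and \<open>E (d z \<kappa> u) v\<close> are divisor classes.

  Let \<open>s = \<sigma> \<kappa>\<close>. The form \<open>\<phi> u v = E (d z \<kappa> u) v + s * E (d z u) v\<close> satisfies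
  \<open>\<phi> (\<kappa> u) v = s * \<phi> u v\<close>, which means that it lies in \<open>\<Lambda>\<^sup>2 V\<^sub>\<sigma>\<close>, and it is nondegenerate. So it is
  a symplectic form on the space of dimension \<open>2 n\<close> dual to \<open>V\<^sub>\<sigma>\<close>, and its \<open>n\<close>-th power is a nonzero
  element of the line \<open>\<Lambda>\<^sup>2\<^sup>n V\<^sub>\<sigma>\<close> (\<open>eigenforms_top\<close>, \<open>exterior_power_eigenforms\<close>). With \<open>s\<^sup>2\<close> an integer,
  expanding this power gives \<open>P + s Q\<close> with rational combinations \<open>P\<close>, \<open>Q\<close> of products of divisor
  classes (\<open>cup_pencil\<close>); the conjugate embedding gives \<open>P - s Q\<close>. Therefore \<open>P\<close> and \<open>Q\<close> span the
  space of Weil classes over \<open>\<complex>\<close>, and by descent over \<open>\<rat>\<close> (\<open>weil_classes_eq\<close>). Finally, products of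
  divisor classes are stable under pullback by \<open>F\<close>, which takes care of the translates.
\<close>


section \<open>Alternating forms and cup products\<close>

lemma H_complexI:
  assumes "\<And>v w. (\<And>i. i < k \<Longrightarrow> v i = w i) \<Longrightarrow> \<alpha> v = \<alpha> w"
    and "\<And>i v. i < k \<Longrightarrow> linear (\<lambda>u. \<alpha> (v(i := u)))"
    and "\<And>v i j. i < j \<Longrightarrow> j < k \<Longrightarrow> v i = v j \<Longrightarrow> \<alpha> v = 0"
  shows "\<alpha> \<in> H_complex k"
  using assms unfolding H_complex_def by blast

lemma H_complex_cong:
  "\<alpha> \<in> H_complex k \<Longrightarrow> (\<And>i. i < k \<Longrightarrow> v i = w i) \<Longrightarrow> \<alpha> v = \<alpha> w"
  unfolding H_complex_def by blast

lemma H_complex_linear: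
  "\<alpha> \<in> H_complex k \<Longrightarrow> i < k \<Longrightarrow> linear (\<lambda>u. \<alpha> (v(i := u)))"
  unfolding H_complex_def by blast

lemma H_complex_alternating:
  assumes "\<alpha> \<in> H_complex k" "i < k" "j < k" "i \<noteq> j" "v i = v j"
  shows "\<alpha> v = 0"
  using assms unfolding H_complex_def
  by (cases i j rule: linorder_cases) (auto; metis)+

lemma H_ratD: "\<alpha> \<in> H_rat L k \<Longrightarrow> \<alpha> \<in> H_complex k"
  and H_rat_values: "\<alpha> \<in> H_rat L k \<Longrightarrow> (\<And>i. i < k \<Longrightarrow> v i \<in> L) \<Longrightarrow> \<alpha> v \<in> \<rat>"
  unfolding H_rat_def by auto

lemma subspace_H_complex: "cform.subspace (H_complex k :: (complex^'g::finite) form set)"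
proof (rule cform.subspaceI)
  show "0 \<in> H_complex k"
    by (rule H_complexI) (auto simp: zero_fun_def linear_zero)
next
  fix \<alpha> \<beta> :: "(complex^'g) form"
  assume a: "\<alpha> \<in> H_complex k" and b: "\<beta> \<in> H_complex k"
  show "\<alpha> + \<beta> \<in> H_complex k"
  proof (rule H_complexI)
    fix v w :: "nat \<Rightarrow> complex^'g" assume "\<And>i. i < k \<Longrightarrow> v i = w i"
    then show "(\<alpha> + \<beta>) v = (\<alpha> + \<beta>) w"
      using H_complex_cong[OF a, of v w] H_complex_cong[OF b, of v w] by simp
  next
    fix i v assume "i < k"
    then show "linear (\<lambda>u. (\<alpha> + \<beta>) (v(i := u)))"
      using linear_compose_add[OF H_complex_linear[OF a] H_complex_linear[OF b]] by simp
  next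
    fix v :: "nat \<Rightarrow> complex^'g" and i j assume "i < j" "j < k" "v i = v j"
    then show "(\<alpha> + \<beta>) v = 0"
      using H_complex_alternating[OF a, of i j v] H_complex_alternating[OF b, of i j v] by simp
  qed
next
  fix c and \<alpha> :: "(complex^'g) form"
  assume a: "\<alpha> \<in> H_complex k"
  show "cscale c \<alpha> \<in> H_complex k"
  proof (rule H_complexI)
    fix v w :: "nat \<Rightarrow> complex^'g" assume "\<And>i. i < k \<Longrightarrow> v i = w i"
    then show "cscale c \<alpha> v = cscale c \<alpha> w"
      using H_complex_cong[OF a, of v w] by (simp add: cscale_def)
  next
    fix i v assume "i < k"
    then have "linear (\<lambda>u. \<alpha> (v(i := u)))"
      by (rule H_complex_linear[OF a])
    then show "linear (\<lambda>u. cscale c \<alpha> (v(i := u)))"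
      unfolding cscale_def
      by (simp add: linear_iff algebra_simps)
  next
    fix v :: "nat \<Rightarrow> complex^'g" and i j assume "i < j" "j < k" "v i = v j"
    then show "cscale c \<alpha> v = 0"
      using H_complex_alternating[OF a, of i j v] by (simp add: cscale_def)
  qed
qed

lemma qscale_eq_cscale: "qscale q = cscale (of_rat q)"
  by (rule ext) (simp add: qscale_def cscale_def)

lemma subspace_H_rat:
  fixes L :: "(complex^'g::finite) set"
  shows "qform.subspace (H_rat L k)"
proof (rule qform.subspaceI)
  show "0 \<in> H_rat L k"
    using cform.subspace_0[OF subspace_H_complex] by (auto simp: H_rat_def)
next
  fix \<alpha> \<beta> :: "(complex^'g) form" assume "\<alpha> \<in> H_rat L k" "\<beta> \<in> H_rat L k"
  then show "\<alpha> + \<beta> \<in> H_rat L k"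
    using cform.subspace_add[OF subspace_H_complex, of \<alpha> k \<beta>] by (auto simp: H_rat_def)
next
  fix q and \<alpha> :: "(complex^'g) form" assume "\<alpha> \<in> H_rat L k"
  then show "qscale q \<alpha> \<in> H_rat L k"
    using cform.subspace_scale[OF subspace_H_complex, of \<alpha> k "of_rat q"]
    by (auto simp: H_rat_def qscale_eq_cscale cscale_def)
qed

lemma slot_bound:
  fixes d n m :: nat assumes "m < d * n" shows "m div d < n" "m mod d < d"
proof -
  have "0 < d" using assms by (cases d) auto
  then show "m mod d < d" by simp
  show "m div d < n" using assms \<open>0 < d\<close> by (simp add: less_mult_imp_div_less mult.commute)
qed

lemma slot_less:
  fixes d n i j :: nat assumes "i < n" "j < d" shows "d * i + j < d * n"
proof -
  have "d * i + j < d * i + d" using assms by simp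
  also have "\<dots> = d * Suc i" by simp
  also have "\<dots> \<le> d * n" using assms by (intro mult_le_mono) auto
  finally show ?thesis .
qed

text \<open>
  Each argument of a cup product enters exactly one factor of each summand, in a single slot. This
  reduces multilinearity of a cup product, and its behaviour under an endomorphism in one argument, to
  the same property of the factors. Entries of the argument sequences from position \<open>d\<close> on may repeat
  the argument that is varied, but a \<open>d\<close>-form does not see them.
\<close>

lemma cup_summand_slot:
  fixes \<alpha> :: "nat \<Rightarrow> (complex^'g::finite) form"
  assumes \<alpha>: "\<And>i. i < n \<Longrightarrow> \<alpha> i \<in> H_complex d"
    and \<pi>: "\<pi> permutes {..<d * n}" and m: "m < d * n"
  obtains C i j y where "i < n" "j < d"
    "\<And>u. (\<Prod>i<n. \<alpha> i (\<lambda>j. (v(m := u)) (\<pi> (d * i + j)))) = C * \<alpha> i (y(j := u))"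
proof -
  have "m \<in> \<pi> ` {..<d * n}"
    using m by (simp add: permutes_image[OF \<pi>])
  then obtain p where p: "p < d * n" "\<pi> p = m" by auto
  define i0 where "i0 = p div d"
  define j0 where "j0 = p mod d"
  have i0: "i0 < n" and j0: "j0 < d" and pe: "p = d * i0 + j0"
    using slot_bound[OF p(1)] by (auto simp: i0_def j0_def)
  define y where "y = (\<lambda>j. v (\<pi> (d * i0 + j)))"
  define C where "C = (\<Prod>i\<in>{..<n} - {i0}. \<alpha> i (\<lambda>j. v (\<pi> (d * i + j))))"
  have "(\<Prod>i<n. \<alpha> i (\<lambda>j. (v(m := u)) (\<pi> (d * i + j)))) = C * \<alpha> i0 (y(j0 := u))" for u
  proof -
    have hit: "\<pi> (d * i + j) = m \<longleftrightarrow> i = i0 \<and> j = j0" if "j < d" for i j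
    proof -
      have "\<pi> (d * i + j) = m \<longleftrightarrow> d * i + j = d * i0 + j0"
        using p(2) pe permutes_inj[OF \<pi>] by (metis injD)
      also have "\<dots> \<longleftrightarrow> i = i0 \<and> j = j0"
      proof
        assume e: "d * i + j = d * i0 + j0"
        have "(d * i + j) div d = i" "(d * i + j) mod d = j"
          "(d * i0 + j0) div d = i0" "(d * i0 + j0) mod d = j0"
          using that j0 by auto
        then show "i = i0 \<and> j = j0" using e by metis
      qed auto
      finally show ?thesis .
    qed
    have "\<alpha> i0 (\<lambda>j. (v(m := u)) (\<pi> (d * i0 + j))) = \<alpha> i0 (y(j0 := u))"
      by (rule H_complex_cong[OF \<alpha>[OF i0]]) (auto simp: hit y_def)
    moreover have "\<alpha> i (\<lambda>j. (v(m := u)) (\<pi> (d * i + j))) = \<alpha> i (\<lambda>j. v (\<pi> (d * i + j)))"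
      if "i \<in> {..<n} - {i0}" for i
      by (rule H_complex_cong[OF \<alpha>]) (use that in \<open>auto simp: hit\<close>)
    ultimately show ?thesis
      using i0 by (subst prod.remove[of _ i0]) (auto simp: C_def mult.commute)
  qed
  with i0 j0 show thesis by (rule that)
qed

lemma cup_in_H_complex:
  fixes \<alpha> :: "nat \<Rightarrow> (complex^'g::finite) form"
  assumes \<alpha>: "\<And>i. i < n \<Longrightarrow> \<alpha> i \<in> H_complex d"
  shows "cup d n \<alpha> \<in> H_complex (d * n)"
proof (rule H_complexI)
  fix v w :: "nat \<Rightarrow> complex^'g" assume vw: "\<And>i. i < d * n \<Longrightarrow> v i = w i"
  have "\<alpha> i (\<lambda>j. v (\<pi> (d * i + j))) = \<alpha> i (\<lambda>j. w (\<pi> (d * i + j)))"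
    if "\<pi> permutes {..<d * n}" "i < n" for \<pi> i
  proof (rule H_complex_cong[OF \<alpha>[OF that(2)]])
    fix j assume "j < d"
    then show "v (\<pi> (d * i + j)) = w (\<pi> (d * i + j))"
      using permutes_in_image[OF that(1)] slot_less[OF that(2)] by (intro vw) auto
  qed
  then show "cup d n \<alpha> v = cup d n \<alpha> w"
    unfolding cup_def by (auto intro!: sum.cong prod.cong arg_cong2[where f = "(*)"]
      arg_cong2[where f = "(/)"])
next
  fix m v assume m: "m < d * n"
  have "linear (\<lambda>u. \<Prod>i<n. \<alpha> i (\<lambda>j. (v(m := u)) (\<pi> (d * i + j))))"
    if \<pi>: "\<pi> permutes {..<d * n}" for \<pi>
  proof -
    obtain C i j y where ij: "i < n" "j < d"
      and e: "\<And>u. (\<Prod>i<n. \<alpha> i (\<lambda>j. (v(m := u)) (\<pi> (d * i + j)))) = C * \<alpha> i (y(j := u))"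
      by (rule cup_summand_slot[OF \<alpha> \<pi> m, where v = v]) auto
    have "linear (\<lambda>u. \<alpha> i (y(j := u)))"
      by (rule H_complex_linear[OF \<alpha>[OF ij(1)] ij(2)])
    then show ?thesis
      unfolding e by (simp add: linear_iff algebra_simps)
  qed
  then have "linear (\<lambda>u. of_int (sign \<pi>) * (\<Prod>i<n. \<alpha> i (\<lambda>j. (v(m := u)) (\<pi> (d * i + j)))))"
    if "\<pi> permutes {..<d * n}" for \<pi>
    using that by (simp add: linear_iff algebra_simps)
  then have "linear (\<lambda>u. \<Sum>\<pi> | \<pi> permutes {..<d * n}.
      of_int (sign \<pi>) * (\<Prod>i<n. \<alpha> i (\<lambda>j. (v(m := u)) (\<pi> (d * i + j)))))"
    by (intro linear_compose_sum) auto
  then show "linear (\<lambda>u. cup d n \<alpha> (v(m := u)))"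
    unfolding cup_def by (simp add: linear_iff add_divide_distrib scaleR_conv_of_real del: fun_upd_apply)
next
  fix v :: "nat \<Rightarrow> complex^'g" and a b :: nat
  assume ab: "a < b" "b < d * n" and v: "v a = v b"
  \<comment> \<open>If two arguments agree, exchanging their positions pairs off summands of opposite sign.\<close>
  let ?S = "{\<pi>. \<pi> permutes {..<d * n}}"
  define f where "f = (\<lambda>\<pi>. of_int (sign \<pi>) * (\<Prod>i<n. \<alpha> i (\<lambda>j. v (\<pi> (d * i + j)))))"
  have t: "Transposition.transpose a b permutes {..<d * n}"
    using ab by (intro permutes_swap_id) auto
  have vt: "v (Transposition.transpose a b k) = v k" for k
    using v by (auto simp: Transposition.transpose_def)
  have "sum f ?S = (\<Sum>\<pi>\<in>?S. f (Transposition.transpose a b \<circ> \<pi>))"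
    using setum_permutations_compose_left[OF t] by simp
  also have "\<dots> = (\<Sum>\<pi>\<in>?S. - f \<pi>)"
  proof (rule sum.cong)
    fix \<pi> assume "\<pi> \<in> ?S"
    then have "permutation \<pi>"
      using permutation_permutes by blast
    then have "sign (Transposition.transpose a b \<circ> \<pi>) = - sign \<pi>"
      using ab by (simp add: sign_compose permutation_swap_id sign_swap_id)
    then show "f (Transposition.transpose a b \<circ> \<pi>) = - f \<pi>"
      unfolding f_def by (simp add: vt)
  qed simp
  also have "\<dots> = - sum f ?S" by (simp add: sum_negf)
  finally have "sum f ?S = 0" by simp
  then show "cup d n \<alpha> v = 0"
    unfolding cup_def f_def by simp
qed

lemma cup_in_H_rat:
  fixes L :: "(complex^'g::finite) set"
  assumes \<alpha>: "\<And>i. i < n \<Longrightarrow> \<alpha> i \<in> H_rat L d"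
  shows "cup d n \<alpha> \<in> H_rat L (d * n)"
proof -
  have "cup d n \<alpha> v \<in> \<rat>" if v: "\<And>i. i < d * n \<Longrightarrow> v i \<in> L" for v :: "nat \<Rightarrow> complex^'g"
  proof -
    have "\<alpha> i (\<lambda>j. v (\<pi> (d * i + j))) \<in> \<rat>" if "\<pi> permutes {..<d * n}" "i < n" for \<pi> i
      using permutes_in_image[OF that(1)] slot_less[OF that(2)]
      by (intro H_rat_values[OF \<alpha>] that v) auto
    then show ?thesis
      unfolding cup_def
      by (intro Rats_divide Rats_sum Rats_mult Rats_prod Rats_power Rats_of_nat Rats_of_int) auto
  qed
  then show ?thesis
    using cup_in_H_complex[of n \<alpha> d] H_ratD[OF \<alpha>] by (auto simp: H_rat_def)
qed

text \<open>
  If \<open>x\<^sup>2\<close> is a negative number with square root \<open>s\<close>, this is the \<open>k\<close>-th exterior power of the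
  \<open>s\<close>-eigenspace of \<open>x\<close> on \<open>1\<close>-forms, described by its values instead of by generators.
\<close>

definition eigenforms :: "complex^'g^'g \<Rightarrow> complex \<Rightarrow> nat \<Rightarrow> (complex^'g::finite) form set" where
  "eigenforms x s k =
     {\<alpha>\<in>H_complex k. \<forall>i<k. \<forall>v u. \<alpha> (v(i := x *v u)) = s * \<alpha> (v(i := u))}"

lemma eigenforms_H_complex: "\<alpha> \<in> eigenforms x s k \<Longrightarrow> \<alpha> \<in> H_complex k"
  by (simp add: eigenforms_def)

lemma subspace_eigenforms: "cform.subspace (eigenforms x s k)"
  using cform.subspace_0[OF subspace_H_complex, of k] cform.subspace_add[OF subspace_H_complex, of _ k]
    cform.subspace_scale[OF subspace_H_complex, of _ k]
  by (intro cform.subspaceI) (auto simp: eigenforms_def cscale_def algebra_simps)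

lemma cup_in_eigenforms:
  assumes \<alpha>: "\<And>i. i < n \<Longrightarrow> \<alpha> i \<in> eigenforms x s d"
  shows "cup d n \<alpha> \<in> eigenforms x s (d * n)"
proof -
  have \<alpha>': "\<And>i. i < n \<Longrightarrow> \<alpha> i \<in> H_complex d" using \<alpha> by (auto simp: eigenforms_def)
  have "cup d n \<alpha> (v(m := x *v u)) = s * cup d n \<alpha> (v(m := u))" if m: "m < d * n" for m v u
  proof -
    have "(\<Prod>i<n. \<alpha> i (\<lambda>j. (v(m := x *v u)) (\<pi> (d * i + j)))) =
        s * (\<Prod>i<n. \<alpha> i (\<lambda>j. (v(m := u)) (\<pi> (d * i + j))))"
      if \<pi>: "\<pi> permutes {..<d * n}" for \<pi>
    proof -
      obtain C i j y where ij: "i < n" "j < d"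
        and e: "\<And>u. (\<Prod>i<n. \<alpha> i (\<lambda>j. (v(m := u)) (\<pi> (d * i + j)))) = C * \<alpha> i (y(j := u))"
        by (rule cup_summand_slot[OF \<alpha>' \<pi> m, where v = v]) auto
      show ?thesis unfolding e using \<alpha>[OF ij(1)] ij(2) by (simp add: eigenforms_def)
    qed
    then show ?thesis
      unfolding cup_def by (simp add: sum_distrib_left mult.left_commute)
  qed
  then show ?thesis
    using cup_in_H_complex[of n \<alpha> d] \<alpha>' by (auto simp: eigenforms_def)
qed

lemma H_complex_swap:
  assumes \<alpha>: "\<alpha> \<in> H_complex k" and ab: "a < k" "b < k" "a \<noteq> b"
  shows "\<alpha> (v \<circ> Transposition.transpose a b) = - \<alpha> v"
proof -
  define g where "g = (\<lambda>x y. \<alpha> (v(a := x, b := y)))"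
  have la: "linear (\<lambda>x. g x y)" for y
    using H_complex_linear[OF \<alpha> ab(1), of "v(b := y)"] ab(3) by (simp add: g_def fun_upd_twist)
  have lb: "linear (\<lambda>y. g x y)" for x
    using H_complex_linear[OF \<alpha> ab(2), of "v(a := x)"] by (simp add: g_def)
  have g0: "g x x = 0" for x
    unfolding g_def by (rule H_complex_alternating[OF \<alpha> ab]) (use ab in auto)
  have "g (v a + v b) (v a + v b) = g (v b) (v a) + g (v a) (v b)"
    unfolding linear_add[OF la] linear_add[OF lb] by (simp add: g0)
  with g0[of "v a + v b"] have "g (v b) (v a) + g (v a) (v b) = 0" by metis
  then have "g (v b) (v a) = - g (v a) (v b)" by (simp only: eq_neg_iff_add_eq_0)
  moreover have "v(a := v b, b := v a) = v \<circ> Transposition.transpose a b"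
    using ab by (auto simp: Transposition.transpose_def fun_eq_iff)
  ultimately show ?thesis by (simp add: g_def)
qed

lemma H_complex_permute:
  assumes \<alpha>: "\<alpha> \<in> H_complex k" and p: "p permutes {..<k}"
  shows "\<alpha> (v \<circ> p) = of_int (sign p) * \<alpha> v"
proof -
  have "\<forall>v. \<alpha> (v \<circ> p) = of_int (sign p) * \<alpha> v"
    using p finite_lessThan
  proof (induction rule: permutes_induct)
    case id
    then show ?case by (simp add: comp_def)
  next
    case (swap a b p)
    have ab: "a < k" "b < k" "a \<noteq> b" using swap by auto
    have "permutation p" using swap permutation_permutes by blast
    then have "sign (Transposition.transpose a b \<circ> p) = - sign p"
      using ab by (simp add: sign_compose permutation_swap_id sign_swap_id)
    moreover have "\<alpha> ((v \<circ> Transposition.transpose a b) \<circ> p)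
        = of_int (sign p) * \<alpha> (v \<circ> Transposition.transpose a b)" for v
      using swap by blast
    ultimately have "\<alpha> (v \<circ> (Transposition.transpose a b \<circ> p))
        = of_int (sign (Transposition.transpose a b \<circ> p)) * \<alpha> v" for v
      using H_complex_swap[OF \<alpha> ab, of v] by (simp add: comp_assoc)
    then show ?case by blast
  qed
  then show ?thesis by blast
qed


section \<open>Powers of a symplectic form on a symplectic basis\<close>

text \<open>
  A symplectic basis is listed as \<open>e\<^sub>0, f\<^sub>0, e\<^sub>1, f\<^sub>1, \<dots>\<close>, so that the two members of a hyperbolic pair have
  the indices \<open>2 i\<close> and \<open>2 i + 1\<close>. The Gram matrix of such a basis is \<open>hyperbolic\<close>.
\<close>

definition partner :: "nat \<Rightarrow> nat" where
  "partner k = (if even k then k + 1 else k - 1)"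

definition parity_sign :: "nat \<Rightarrow> complex" where
  "parity_sign k = (if even k then 1 else - 1)"

definition hyperbolic :: "nat \<Rightarrow> nat \<Rightarrow> complex" where
  "hyperbolic a b = (if b = partner a then parity_sign a else 0)"

lemma partner_partner [simp]: "partner (partner k) = k"
  and partner_even [simp]: "partner (2 * i) = 2 * i + 1"
  and partner_less: "partner k < 2 * n \<longleftrightarrow> k < 2 * n"
  and parity_sign_square [simp]: "parity_sign k * parity_sign k = 1"
  by (auto simp: partner_def parity_sign_def elim!: evenE oddE)

lemma parity_sign_partner [simp]: "parity_sign (partner k) = - parity_sign k"
  by (auto simp: partner_def parity_sign_def)

text \<open>
  The permutation that moves the pairs \<open>{2 i, 2 i + 1}\<close> as \<open>\<rho>\<close> does and preserves the order within
  each pair. If \<open>\<rho>\<close> is a permutation of a finite set, it is even, because it acts in the same way on even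
  and on odd numbers.
\<close>

definition doubled :: "(nat \<Rightarrow> nat) \<Rightarrow> nat \<Rightarrow> nat" where
  "doubled \<rho> k = 2 * \<rho> (k div 2) + k mod 2"

lemma doubled_transpose:
  "doubled (Transposition.transpose a b \<circ> \<rho>) =
     Transposition.transpose (2 * a) (2 * b) \<circ>
       (Transposition.transpose (2 * a + 1) (2 * b + 1) \<circ> doubled \<rho>)"
proof (rule ext)
  fix k
  have "Suc (2 * y) \<noteq> 2 * z" "2 * z \<noteq> Suc (2 * y)" for y z :: nat by presburger+
  then show "doubled (Transposition.transpose a b \<circ> \<rho>) k =
     (Transposition.transpose (2 * a) (2 * b) \<circ>
       (Transposition.transpose (2 * a + 1) (2 * b + 1) \<circ> doubled \<rho>)) k"
    by (cases "even k")
       (simp_all add: doubled_def Transposition.transpose_def odd_iff_mod_2_eq_one)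
qed

lemma sign_doubled:
  assumes "\<rho> permutes {..<n}"
  shows "permutation (doubled \<rho>) \<and> sign (doubled \<rho>) = 1"
  using assms finite_lessThan
proof (induction rule: permutes_induct)
  case id
  have "doubled id = id" by (auto simp: doubled_def)
  then show ?case by (simp only: permutation_id sign_id)
next
  case (swap a b p)
  let ?t = "Transposition.transpose (2 * a + 1) (2 * b + 1) \<circ> doubled p"
  have t: "permutation ?t" "sign ?t = - 1"
    using swap sign_compose[OF permutation_swap_id, of "doubled p"]
    by (auto intro!: permutation_compose permutation_swap_id simp: sign_swap_id)
  have "permutation (Transposition.transpose (2 * a) (2 * b) \<circ> ?t)"
    by (rule permutation_compose[OF permutation_swap_id t(1)])
  moreover have "sign (Transposition.transpose (2 * a) (2 * b) \<circ> ?t) = 1"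
    using sign_compose[OF permutation_swap_id t(1)] t(2) swap(3) by (simp add: sign_swap_id)
  ultimately show ?case
    by (metis doubled_transpose)
qed

text \<open>
  When the power of a symplectic form is evaluated at a symplectic basis, only permutations that map
  pairs to pairs contribute. Their contributions do not cancel: reversing the order of one pair changes
  both the sign of the permutation and one factor, so all pairs may be assumed to be in order, and
  then the permutation is of the form \<open>doubled \<rho>\<close>.
\<close>

lemma sign_pair_permutation:
  assumes "\<pi> permutes {..<2 * n}" and "\<And>i. i < n \<Longrightarrow> \<pi> (2 * i + 1) = partner (\<pi> (2 * i))"
  shows "of_int (sign \<pi>) * (\<Prod>i<n. parity_sign (\<pi> (2 * i))) = 1"
  using assms
proof (induction "card {i. i < n \<and> odd (\<pi> (2 * i))}" arbitrary: \<pi>)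
  case 0
  have ev: "even (\<pi> (2 * i))" if "i < n" for i
    using 0(1) that by auto
  define \<rho> where "\<rho> = (\<lambda>i. if i < n then \<pi> (2 * i) div 2 else i)"
  have \<pi>: "\<pi> = doubled \<rho>"
  proof (rule ext)
    fix k
    show "\<pi> k = doubled \<rho> k"
    proof (cases "k < 2 * n")
      case True
      then have h: "k div 2 < n" by auto
      show ?thesis
      proof (cases "even k")
        case True
        then show ?thesis using ev[OF h] h by (simp add: doubled_def \<rho>_def)
      next
        case False
        then have "k = 2 * (k div 2) + 1" by simp
        then have "\<pi> k = \<pi> (2 * (k div 2)) + 1"
          using 0(3)[OF h] ev[OF h] by (simp add: partner_def)
        then show ?thesis using False ev[OF h] h by (simp add: doubled_def \<rho>_def odd_iff_mod_2_eq_one)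
      qed
    next
      case False
      then have "\<pi> k = k" using 0(2) by (auto simp: permutes_def)
      moreover have "\<not> k div 2 < n" using False by auto
      ultimately show ?thesis by (simp add: doubled_def \<rho>_def)
    qed
  qed
  have "bij_betw \<rho> {..<n} {..<n}"
  proof (rule bij_betw_imageI)
    show inj: "inj_on \<rho> {..<n}"
    proof (rule inj_onI)
      fix i j assume ij: "i \<in> {..<n}" "j \<in> {..<n}" "\<rho> i = \<rho> j"
      have "\<pi> (2 * i) = 2 * \<rho> i" for i by (subst \<pi>) (simp add: doubled_def)
      with ij(3) have "\<pi> (2 * i) = \<pi> (2 * j)" by simp
      then show "i = j" using injD[OF permutes_inj[OF 0(2)], of "2 * i" "2 * j"] by simp
    qed
    have "\<rho> ` {..<n} \<subseteq> {..<n}"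
    proof (intro image_subsetI)
      fix i assume "i \<in> {..<n}"
      then have "\<pi> (2 * i) < 2 * n" "i < n" using permutes_in_image[OF 0(2), of "2 * i"] by auto
      then show "\<rho> i \<in> {..<n}" by (simp add: \<rho>_def)
    qed
    then show "\<rho> ` {..<n} = {..<n}"
      by (simp add: inj endo_inj_surj)
  qed
  then have "\<rho> permutes {..<n}"
    by (rule bij_imp_permutes) (simp add: \<rho>_def)
  then have "sign \<pi> = 1" using sign_doubled \<pi> by metis
  then show ?case using ev by (simp add: parity_sign_def)
next
  case (Suc m)
  have "{i. i < n \<and> odd (\<pi> (2 * i))} \<noteq> {}" using Suc(2) by (metis card.empty nat.distinct(1))
  then obtain i where i: "i < n" "odd (\<pi> (2 * i))" by auto
  define a where "a = \<pi> (2 * i)"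
  define t where "t = Transposition.transpose a (partner a)"
  have a: "a < 2 * n" using permutes_in_image[OF Suc(3), of "2 * i"] i by (auto simp: a_def)
  have ap: "a \<noteq> partner a" "odd a" "even (partner a)" using i odd_pos[OF i(2)] by (auto simp: partner_def a_def)
  have t_in: "t permutes {..<2 * n}"
    unfolding t_def using a partner_less[of a n] by (intro permutes_swap_id) auto
  have tp: "t (partner k) = partner (t k)" for k
    unfolding t_def Transposition.transpose_def by auto (metis partner_partner)+
  define \<pi>' where "\<pi>' = t \<circ> \<pi>"
  have other: "\<pi>' (2 * j) = \<pi> (2 * j)" if "j < n" "j \<noteq> i" for j
  proof -
    have "\<pi> (2 * j) \<noteq> a"
      using that injD[OF permutes_inj[OF Suc(3)], of "2 * j" "2 * i"] by (auto simp: a_def)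
    moreover have "\<pi> (2 * j) \<noteq> partner a"
    proof
      assume "\<pi> (2 * j) = partner a"
      also have "\<dots> = \<pi> (2 * i + 1)" using Suc(4)[OF i(1)] by (simp add: a_def)
      finally have "2 * j = 2 * i + 1" by (rule injD[OF permutes_inj[OF Suc(3)]])
      then show False by presburger
    qed
    ultimately show ?thesis by (simp add: \<pi>'_def t_def)
  qed
  have here: "\<pi>' (2 * i) = partner a" by (simp add: \<pi>'_def t_def a_def)
  have "{j. j < n \<and> odd (\<pi>' (2 * j))} = {j. j < n \<and> odd (\<pi> (2 * j))} - {i}"
    using other here ap by auto metis
  then have "m = card {j. j < n \<and> odd (\<pi>' (2 * j))}"
    using Suc(2) i by (simp add: card_Diff_singleton)
  moreover have "\<pi>' permutes {..<2 * n}"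
    unfolding \<pi>'_def by (rule permutes_compose[OF Suc(3) t_in])
  moreover have "\<pi>' (2 * j + 1) = partner (\<pi>' (2 * j))" if "j < n" for j
    using Suc(4)[OF that] tp by (simp add: \<pi>'_def)
  ultimately have IH: "of_int (sign \<pi>') * (\<Prod>j<n. parity_sign (\<pi>' (2 * j))) = 1"
    by (rule Suc(1))
  have "permutation \<pi>" using Suc(3) permutation_permutes by blast
  then have "sign \<pi>' = - sign \<pi>"
    unfolding \<pi>'_def t_def using ap by (simp add: sign_compose permutation_swap_id sign_swap_id)
  moreover have "(\<Prod>j<n. parity_sign (\<pi>' (2 * j))) = - (\<Prod>j<n. parity_sign (\<pi> (2 * j)))"
  proof -
    have "(\<Prod>j\<in>{..<n} - {i}. parity_sign (\<pi>' (2 * j))) = (\<Prod>j\<in>{..<n} - {i}. parity_sign (\<pi> (2 * j)))"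
      by (rule prod.cong) (auto simp: other)
    then show ?thesis
      using i(1) here by (simp add: prod.remove[of "{..<n}" i] a_def)
  qed
  ultimately show ?case using IH by simp
qed

lemma cup_power_hyperbolic_nonzero:
  fixes \<omega> :: "'v form"
  assumes \<omega>: "\<And>v. \<omega> v = \<phi> (v 0) (v 1)"
    and w: "\<And>a b. a < 2 * n \<Longrightarrow> b < 2 * n \<Longrightarrow> \<phi> (w a) (w b) = hyperbolic a b"
  shows "cup 2 n (\<lambda>_. \<omega>) w \<noteq> 0"
proof -
  let ?S = "{\<pi>. \<pi> permutes {..<2 * n}}"
  define good where "good = (\<lambda>\<pi>. \<forall>i<n. \<pi> (2 * i + 1) = partner (\<pi> (2 * i)))"
  have "of_int (sign \<pi>) * (\<Prod>i<n. \<omega> (\<lambda>j. w (\<pi> (2 * i + j)))) = (if good \<pi> then 1 else 0)"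
    if \<pi>: "\<pi> \<in> ?S" for \<pi>
  proof -
    have "\<omega> (\<lambda>j. w (\<pi> (2 * i + j))) = hyperbolic (\<pi> (2 * i)) (\<pi> (2 * i + 1))" if "i < n" for i
      using that \<pi> permutes_in_image[of \<pi> "{..<2 * n}"] unfolding \<omega> by (simp add: w)
    then have e: "(\<Prod>i<n. \<omega> (\<lambda>j. w (\<pi> (2 * i + j)))) =
        (\<Prod>i<n. hyperbolic (\<pi> (2 * i)) (\<pi> (2 * i + 1)))" by simp
    show ?thesis
    proof (cases "good \<pi>")
      case True
      then have "(\<Prod>i<n. hyperbolic (\<pi> (2 * i)) (\<pi> (2 * i + 1))) = (\<Prod>i<n. parity_sign (\<pi> (2 * i)))"
        by (simp add: hyperbolic_def good_def)
      then show ?thesis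
        unfolding e using sign_pair_permutation[of \<pi> n] \<pi> True by (auto simp: good_def)
    next
      case False
      then obtain i where "i < n" "hyperbolic (\<pi> (2 * i)) (\<pi> (2 * i + 1)) = 0"
        by (auto simp: good_def hyperbolic_def)
      then have "(\<Prod>i<n. hyperbolic (\<pi> (2 * i)) (\<pi> (2 * i + 1))) = 0" by auto
      then show ?thesis unfolding e using False by simp
    qed
  qed
  then have "(\<Sum>\<pi>\<in>?S. of_int (sign \<pi>) * (\<Prod>i<n. \<omega> (\<lambda>j. w (\<pi> (2 * i + j))))) =
      (\<Sum>\<pi>\<in>?S. if good \<pi> then 1 else 0)" by (rule sum.cong[OF refl])
  also have "\<dots> = of_nat (card {\<pi>\<in>?S. good \<pi>})"
    by (simp add: sum.If_cases finite_permutations Collect_conj_eq)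
  also have "\<dots> \<noteq> 0"
  proof -
    have "id \<in> {\<pi>\<in>?S. good \<pi>}" by (auto simp: permutes_id good_def)
    moreover have "finite {\<pi>\<in>?S. good \<pi>}" by (simp add: finite_permutations)
    ultimately have "card {\<pi>\<in>?S. good \<pi>} \<noteq> 0" by (metis card_0_eq empty_iff)
    then show ?thesis by simp
  qed
  finally show ?thesis by (simp add: cup_def)
qed


lemma eigenforms_1_iff:
  "\<alpha> \<in> eigenforms x s 1 \<longleftrightarrow>
     \<alpha> \<in> H_complex 1 \<and> pullback x \<alpha> = cscale s \<alpha>" for \<alpha> :: "(complex^'g::finite) form"
proof (cases "\<alpha> \<in> H_complex 1")
  case True
  have e: "\<alpha> v = \<alpha> (y(0 := v 0))" for v y
    by (rule H_complex_cong[OF True]) simp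
  show ?thesis
  proof
    assume "\<alpha> \<in> eigenforms x s 1"
    then have h: "\<alpha> (v(0 := x *v u)) = s * \<alpha> (v(0 := u))" for v u
      by (auto simp: eigenforms_def)
    have "\<alpha> (\<lambda>i. x *v v i) = s * \<alpha> v" for v
      using h[of v "v 0"] e[of "\<lambda>i. x *v v i" v] by simp
    then show "\<alpha> \<in> H_complex 1 \<and> pullback x \<alpha> = cscale s \<alpha>"
      using True by (auto simp: pullback_def cscale_def)
  next
    assume "\<alpha> \<in> H_complex 1 \<and> pullback x \<alpha> = cscale s \<alpha>"
    then have "\<alpha> (\<lambda>i. x *v v i) = s * \<alpha> v" for v
      by (auto simp: pullback_def cscale_def fun_eq_iff)
    from this[of "_(0 := _)"] have "\<alpha> (v(0 := x *v u)) = s * \<alpha> (v(0 := u))" for v u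
      using e[of "\<lambda>i. x *v (v(0 := u)) i" v] by (metis fun_upd_same)
    then show "\<alpha> \<in> eigenforms x s 1" using True by (auto simp: eigenforms_def)
  qed
qed (auto simp: eigenforms_def)


section \<open>Eigenforms of top degree\<close>

text \<open>
  A nondegenerate \<open>\<phi>\<close> with these properties forces \<open>x\<^sup>2 = s\<^sup>2\<close>, a negative number. Hence \<open>\<complex>\<^sup>g\<close>, of real
  dimension \<open>4 n\<close>, becomes a complex vector space of dimension \<open>2 n\<close> on which \<open>s\<close> acts as \<open>x\<close>. This
  complex structure differs in general from the original one. On it, \<open>\<phi>\<close> is a symplectic form.
\<close>

locale eigen_symplectic =
  fixes x :: "complex^'g^'g::finite" and s :: complex and n :: nat
    and \<phi> :: "complex^'g \<Rightarrow> complex^'g \<Rightarrow> complex"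
  assumes dim: "CARD('g) = 2 * n"
    and s: "Re s = 0" "Im s \<noteq> 0"
    and linear_left: "linear (\<lambda>u. \<phi> u v)"
    and alternating: "\<phi> u u = 0"
    and antisym: "\<phi> u v = - \<phi> v u"
    and eigen: "\<phi> (x *v u) v = s * \<phi> u v"
    and nondegenerate: "(\<And>v. \<phi> u v = 0) \<Longrightarrow> u = 0"
begin

text \<open>
  Scalar multiplication of the new complex structure: \<open>s\<close> acts as \<open>x\<close>.
\<close>

definition scal :: "complex \<Rightarrow> complex^'g \<Rightarrow> complex^'g" where
  "scal c u = Re c *\<^sub>R u + (Im c / Im s) *\<^sub>R (x *v u)"

lemma eigen_scal:
  assumes "linear f" and "f (x *v u) = s * f u"
  shows "f (scal c u) = c * f u"
proof -
  have "f (scal c u) = (of_real (Re c) + of_real (Im c / Im s) * s) * f u"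
    unfolding scal_def linear_add[OF assms(1)] linear_scale[OF assms(1)] assms(2)
    by (simp add: scaleR_conv_of_real algebra_simps)
  also have "of_real (Re c) + of_real (Im c / Im s) * s = c"
    using s by (simp add: complex_eq_iff)
  finally show ?thesis .
qed

lemma linear_scal: "linear (\<lambda>c. scal c u)"
  by (simp add: linear_iff scal_def algebra_simps add_divide_distrib)

lemma phi_scal_left: "\<phi> (scal c u) v = c * \<phi> u v"
  by (rule eigen_scal[OF linear_left]) (rule eigen)

lemma phi_scal_right: "\<phi> u (scal c v) = c * \<phi> u v"
  using phi_scal_left[of c v u] antisym[of u] by simp

lemma linear_right: "linear (\<lambda>v. \<phi> u v)"
  using linear_compose_neg[OF linear_left[of u]] antisym[of u] by simp

lemma phi_sum_scal: "\<phi> (\<Sum>a\<in>A. scal (c a) (w a)) v = (\<Sum>a\<in>A. c a * \<phi> (w a) v)"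
  by (simp add: linear_sum[OF linear_left] phi_scal_left)

definition hyperbolic_family :: "nat \<Rightarrow> (nat \<Rightarrow> complex^'g) \<Rightarrow> bool" where
  "hyperbolic_family m w \<longleftrightarrow> (\<forall>a<2 * m. \<forall>b<2 * m. \<phi> (w a) (w b) = hyperbolic a b)"

text \<open>
  The projection to the span of a hyperbolic family along its \<open>\<phi>\<close>-orthogonal complement.
\<close>

definition component :: "nat \<Rightarrow> (nat \<Rightarrow> complex^'g) \<Rightarrow> complex^'g \<Rightarrow> complex^'g" where
  "component m w v = (\<Sum>a<2 * m. scal (parity_sign a * \<phi> v (w (partner a))) (w a))"

lemma sum_hyperbolic:
  assumes "b < 2 * m"
  shows "(\<Sum>a<2 * m. c a * hyperbolic a b) = - c (partner b) * parity_sign b"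
proof -
  have "c a * hyperbolic a b = (if a = partner b then - c (partner b) * parity_sign b else 0)" for a
    by (auto simp: hyperbolic_def)
  then show ?thesis using assms partner_less[of b m] by simp
qed

lemma phi_component:
  assumes "hyperbolic_family m w" "b < 2 * m"
  shows "\<phi> (component m w v) (w b) = \<phi> v (w b)"
proof -
  have "\<phi> (component m w v) (w b)
      = (\<Sum>a<2 * m. (parity_sign a * \<phi> v (w (partner a))) * hyperbolic a b)"
    unfolding component_def phi_sum_scal
    by (rule sum.cong) (use assms in \<open>auto simp: hyperbolic_family_def\<close>)
  also have "\<dots> = \<phi> v (w b)"
    using parity_sign_square[of b]
    by (subst sum_hyperbolic[OF assms(2)]) (simp add: mult.commute mult.left_commute)
  finally show ?thesis .
qed

lemma phi_component_right:
  assumes "\<And>b. b < 2 * m \<Longrightarrow> \<phi> u (w b) = 0"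
  shows "\<phi> u (component m w v) = 0"
  unfolding component_def using assms
  by (simp add: linear_sum[OF linear_right] phi_scal_right)

text \<open>
  The symplectic Gram-Schmidt process. A family of \<open>m < n\<close> pairs spans a real subspace of dimension at
  most \<open>4 m < 4 n\<close>, so there is a nonzero vector \<open>u\<close> orthogonal to it; a vector that pairs nontrivially
  with \<open>u\<close> is projected to the orthogonal complement and rescaled.
\<close>

lemma exists_hyperbolic_family:
  assumes "m \<le> n" shows "\<exists>w. hyperbolic_family m w"
  using assms
proof (induction m)
  case 0
  then show ?case by (simp add: hyperbolic_family_def)
next
  case (Suc m)
  then obtain w where w: "hyperbolic_family m w" by auto
  define S where "S = w ` {..<2 * m} \<union> (\<lambda>a. x *v w a) ` {..<2 * m}"
  have "card S \<le> 2 * m + 2 * m"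
    unfolding S_def
    by (rule order_trans[OF card_Un_le]) (intro add_mono order_trans[OF card_image_le], auto)
  also have "\<dots> < DIM(complex^'g)" using Suc.prems dim by simp
  finally have "card S < DIM(complex^'g)" .
  moreover have "finite S" by (simp add: S_def)
  ultimately have "span S \<noteq> UNIV"
    by (metis dim_UNIV dim_le_card' dim_span leD)
  then obtain v where v: "v \<notin> span S" by auto
  define u where "u = v - component m w v"
  have "scal c (w a) \<in> span S" if "a < 2 * m" for c a
    unfolding scal_def using that by (intro span_add span_scale span_base) (auto simp: S_def)
  then have "component m w v \<in> span S" unfolding component_def by (intro span_sum) auto
  then have "u \<noteq> 0" using v by (auto simp: u_def)
  have uw: "\<phi> u (w b) = 0" if "b < 2 * m" for b
    using phi_component[OF w that] by (simp add: u_def linear_diff[OF linear_left])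
  obtain y where y: "\<phi> u y \<noteq> 0" using nondegenerate \<open>u \<noteq> 0\<close> by blast
  define z where "z = scal (1 / \<phi> u y) (y - component m w y)"
  have uz: "\<phi> u z = 1"
    using y uw by (simp add: z_def phi_scal_right linear_diff[OF linear_right] phi_component_right)
  have zw: "\<phi> z (w b) = 0" if "b < 2 * m" for b
    using phi_component[OF w that]
    by (simp add: z_def phi_scal_left linear_diff[OF linear_left])
  define w' where "w' = w(2 * m := u, 2 * m + 1 := z)"
  have "\<phi> (w' a) (w' b) = hyperbolic a b" if ab: "a < 2 * Suc m" "b < 2 * Suc m" for a b
  proof -
    have cases: "c < 2 * m \<or> c = 2 * m \<or> c = 2 * m + 1" if "c < 2 * Suc m" for c using that by auto
    have lo: "\<phi> (w a) (w b) = hyperbolic a b" if "a < 2 * m" "b < 2 * m"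
      using w that by (auto simp: hyperbolic_family_def)
    have wu: "\<phi> (w b) u = 0" "\<phi> (w b) z = 0" if "b < 2 * m" for b
      using antisym[of "w b" u] antisym[of "w b" z] uw zw that by auto
    have zu: "\<phi> z u = -1" using antisym[of z u] uz by simp
    have p: "partner c < 2 * m" if "c < 2 * m" for c using that partner_less by blast
    have q: "partner (Suc (2 * m)) = 2 * m" by (simp add: partner_def)
    show ?thesis
      using cases[OF ab(1)] cases[OF ab(2)] lo uw zw uz wu zu alternating p[of a]
      by (auto simp: w'_def hyperbolic_def q parity_sign_def)
  qed
  then show ?case unfolding hyperbolic_family_def by blast
qed

text \<open>
  The coefficients of a combination of the family can be read off by pairing with \<open>\<phi>\<close>. Hence forming
  combinations is an injective real-linear map on \<open>\<complex>\<^sup>2\<^sup>n\<close>, and it is onto because the dimensions agree.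
  The bijection \<open>idx\<close> only labels the coordinates of \<open>\<complex>\<^sup>g\<close> by numbers.
\<close>

lemma hyperbolic_family_spans:
  assumes w: "hyperbolic_family n w"
  obtains c where "v = (\<Sum>a<2 * n. scal (c a) (w a))"
proof -
  obtain idx :: "nat \<Rightarrow> 'g" where idx: "bij_betw idx {..<2 * n} UNIV"
    using finite_same_card_bij[of "{..<2 * n}" "UNIV :: 'g set"] dim by auto
  define G :: "complex^'g \<Rightarrow> complex^'g" where "G t = (\<Sum>a<2 * n. scal (t $ idx a) (w a))" for t
  have lin: "linear G"
    unfolding G_def
    by (intro linear_compose_sum ballI)
       (simp add: linear_iff linear_add[OF linear_scal] linear_scale[OF linear_scal])
  moreover have "inj G"
    unfolding linear_injective_0[OF lin]
  proof (intro allI impI)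
    fix t assume "G t = 0"
    have "t $ idx a = 0" if a: "a < 2 * n" for a
    proof -
      have b: "partner a < 2 * n" using a partner_less by blast
      have "0 = \<phi> (G t) (w (partner a))"
        using linear_0[OF linear_left] \<open>G t = 0\<close> by simp
      also have "\<dots> = (\<Sum>a'<2 * n. t $ idx a' * hyperbolic a' (partner a))"
        unfolding G_def phi_sum_scal
        by (rule sum.cong) (use w b in \<open>auto simp: hyperbolic_family_def\<close>)
      also have "\<dots> = t $ idx a * parity_sign a"
        by (subst sum_hyperbolic[OF b]) simp
      finally show ?thesis by (auto simp: parity_sign_def split: if_splits)
    qed
    moreover have "\<exists>a<2 * n. i = idx a" for i
      using idx unfolding bij_betw_def by (metis UNIV_I image_iff lessThan_iff)
    ultimately show "t = 0" by (metis vec_eq_iff zero_index)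
  qed
  ultimately have "surj G" by (rule linear_injective_imp_surjective) (rule refl)
  then obtain t where "v = G t" by auto
  then show thesis unfolding G_def by (rule that)
qed

text \<open>
  The eigenform property makes a form multilinear over the new complex numbers, hence determined by its
  values on members of the basis, and these are \<open>\<plusminus>\<alpha> w\<close> or \<open>0\<close> by alternation. The induction is on the
  number \<open>k\<close> of slots that may hold arbitrary vectors.
\<close>

lemma eigenform_eq_0:
  assumes w: "hyperbolic_family n w" and \<alpha>: "\<alpha> \<in> eigenforms x s (2 * n)" and "\<alpha> w = 0"
  shows "\<alpha> v = 0"
proof -
  note \<alpha>' = eigenforms_H_complex[OF \<alpha>]
  have "\<alpha> v = 0" if "k \<le> 2 * n" "\<And>i. k \<le> i \<Longrightarrow> i < 2 * n \<Longrightarrow> \<exists>a<2 * n. v i = w a" for k v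
    using that
  proof (induction k arbitrary: v)
    case 0
    then have "\<forall>i. \<exists>a. i < 2 * n \<longrightarrow> a < 2 * n \<and> v i = w a" by blast
    then obtain f where f: "\<And>i. i < 2 * n \<Longrightarrow> f i < 2 * n \<and> v i = w (f i)" by metis
    show ?case
    proof (cases "inj_on f {..<2 * n}")
      case True
      define p where "p = (\<lambda>i. if i < 2 * n then f i else i)"
      have "inj_on p {..<2 * n}" using True by (auto simp: p_def inj_on_def)
      moreover have "p ` {..<2 * n} \<subseteq> {..<2 * n}" using f by (auto simp: p_def)
      ultimately have "bij_betw p {..<2 * n} {..<2 * n}"
        by (simp add: bij_betw_def endo_inj_surj)
      then have "p permutes {..<2 * n}" by (rule bij_imp_permutes) (simp add: p_def)
      then have "\<alpha> (w \<circ> p) = 0" using H_complex_permute[OF \<alpha>'] \<open>\<alpha> w = 0\<close> by simp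
      moreover have "\<alpha> v = \<alpha> (w \<circ> p)"
        by (rule H_complex_cong[OF \<alpha>']) (use f in \<open>auto simp: p_def\<close>)
      ultimately show ?thesis by simp
    next
      case False
      then obtain i j where "i < 2 * n" "j < 2 * n" "i \<noteq> j" "f i = f j" by (auto simp: inj_on_def)
      then show ?thesis using f by (intro H_complex_alternating[OF \<alpha>', of i j]) auto
    qed
  next
    case (Suc k)
    then have k: "k < 2 * n" by simp
    obtain c where c: "v k = (\<Sum>a<2 * n. scal (c a) (w a))"
      by (rule hyperbolic_family_spans[OF w])
    have lin: "linear (\<lambda>u. \<alpha> (v(k := u)))" by (rule H_complex_linear[OF \<alpha>' k])
    have "\<alpha> v = \<alpha> (v(k := \<Sum>a<2 * n. scal (c a) (w a)))" by (simp flip: c)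
    also have "\<dots> = (\<Sum>a<2 * n. c a * \<alpha> (v(k := w a)))"
      using eigen_scal[OF lin] \<alpha> k by (simp add: linear_sum[OF lin] eigenforms_def)
    also have "\<dots> = 0"
    proof (rule sum.neutral, intro ballI)
      fix a assume "a \<in> {..<2 * n}"
      then have "\<alpha> (v(k := w a)) = 0"
        using Suc.prems by (intro Suc.IH) auto
      then show "c a * \<alpha> (v(k := w a)) = 0" by simp
    qed
    finally show ?case .
  qed
  from this[of "2 * n" v] show ?thesis by simp
qed

text \<open>
  The eigenforms of degree \<open>2 n\<close> form a line, because such a form is determined by its value at one
  basis.
\<close>

lemma eigenforms_top:
  assumes \<alpha>: "\<alpha> \<in> eigenforms x s (2 * n)"
    and \<Omega>: "\<Omega> \<in> eigenforms x s (2 * n)" "\<Omega> \<noteq> 0"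
  shows "\<exists>c. \<alpha> = cscale c \<Omega>"
proof -
  obtain w where w: "hyperbolic_family n w" using exists_hyperbolic_family by blast
  have "\<Omega> w \<noteq> 0" using eigenform_eq_0[OF w \<Omega>(1)] \<Omega>(2) by (auto simp: zero_fun_def)
  define c where "c = \<alpha> w / \<Omega> w"
  have "\<alpha> - cscale c \<Omega> \<in> eigenforms x s (2 * n)"
    using \<alpha> \<Omega> by (intro cform.subspace_diff cform.subspace_scale subspace_eigenforms)
  moreover have "(\<alpha> - cscale c \<Omega>) w = 0"
    using \<open>\<Omega> w \<noteq> 0\<close> by (simp add: cscale_def c_def)
  ultimately have "(\<alpha> - cscale c \<Omega>) v = 0" for v by (rule eigenform_eq_0[OF w])
  then have "\<alpha> = cscale c \<Omega>" by (auto simp: fun_eq_iff)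
  then show ?thesis ..
qed

abbreviation phi_form :: "(complex^'g) form" where
  "phi_form \<equiv> \<lambda>v. \<phi> (v 0) (v 1)"

lemma phi_form_eigenform: "phi_form \<in> eigenforms x s 2"
proof -
  have "phi_form \<in> H_complex 2"
  proof (rule H_complexI)
    fix i v assume "i < (2::nat)"
    then have "i = 0 \<or> i = 1" by auto
    then show "linear (\<lambda>u. phi_form (v(i := u)))"
      using linear_left linear_right by auto
  next
    fix v :: "nat \<Rightarrow> complex^'g" and i j :: nat assume "i < j" "j < 2" "v i = v j"
    then have "i = 0" "j = 1" by auto
    then show "phi_form v = 0" using \<open>v i = v j\<close> alternating by simp
  qed auto
  moreover have "\<phi> u (x *v v) = s * \<phi> u v" for u v
    using eigen[of v u] antisym[of u] by simp
  ultimately show ?thesis using eigen by (auto simp: eigenforms_def less_2_cases_iff)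
qed

lemma phi_form_power_eigenform: "cup 2 n (\<lambda>_. phi_form) \<in> eigenforms x s (2 * n)"
  by (rule cup_in_eigenforms) (rule phi_form_eigenform)

lemma phi_form_power_nonzero: "cup 2 n (\<lambda>_. phi_form) \<noteq> 0"
proof -
  obtain w where "hyperbolic_family n w" using exists_hyperbolic_family by blast
  then have "cup 2 n (\<lambda>_. phi_form) w \<noteq> 0"
    by (intro cup_power_hyperbolic_nonzero[where \<phi> = \<phi>]) (auto simp: hyperbolic_family_def)
  then show ?thesis by (auto simp: zero_fun_def)
qed

text \<open>
  Both sides are contained in the line of eigenforms of top degree, so it suffices that the exterior
  power is not zero: the product of the basis \<open>e\<close> dual to a hyperbolic family \<open>w\<close> has value \<open>1\<close> at \<open>w\<close>.
\<close>

lemma exterior_power_eigenforms: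
  "exterior_power (2 * n) (eigenforms x s 1) = range (\<lambda>c. cscale c (cup 2 n (\<lambda>_. phi_form)))"
    (is "_ = range (\<lambda>c. cscale c ?\<Omega>)")
proof -
  obtain w where w: "hyperbolic_family n w" using exists_hyperbolic_family by blast
  define e where "e a = (\<lambda>v :: nat \<Rightarrow> complex^'g. parity_sign a * \<phi> (v 0) (w (partner a)))" for a
  have e: "e a \<in> eigenforms x s 1" for a
  proof -
    have "e a \<in> H_complex 1"
      by (rule H_complexI)
         (auto simp: e_def linear_iff linear_add[OF linear_left] linear_scale[OF linear_left] algebra_simps)
    then show ?thesis by (auto simp: eigenforms_def e_def eigen)
  qed
  have ew: "e a v = (if a = b then 1 else 0)" if "v 0 = w b" "a < 2 * n" "b < 2 * n" for a b v
  proof -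
    have "partner a < 2 * n" using that partner_less by blast
    then have "e a v = parity_sign a * hyperbolic b (partner a)"
      using w that by (simp add: e_def hyperbolic_family_def)
    moreover have "partner a = partner b \<longleftrightarrow> a = b" by (metis partner_partner)
    ultimately show ?thesis by (auto simp: hyperbolic_def)
  qed
  have "cup 1 (2 * n) e w =
      (\<Sum>\<pi> | \<pi> permutes {..<2 * n}. of_int (sign \<pi>) * (\<Prod>i<2 * n. if i = \<pi> i then 1 else 0))"
  proof -
    have "e i (\<lambda>j. w (\<pi> (1 * i + j))) = (if i = \<pi> i then 1 else 0)"
      if "\<pi> permutes {..<2 * n}" "i < 2 * n" for \<pi> i
      using permutes_in_image[OF that(1), of i] that(2) by (intro ew) auto
    then show ?thesis unfolding cup_def by simp
  qed
  also have "\<dots> = (\<Sum>\<pi> | \<pi> permutes {..<2 * n}. if \<pi> = id then 1 else 0)"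
  proof (rule sum.cong)
    fix \<pi> assume \<pi>: "\<pi> \<in> {\<pi>. \<pi> permutes {..<2 * n}}"
    have "(\<Prod>i<2 * n. if i = \<pi> i then 1 else (0::complex)) = (if \<pi> = id then 1 else 0)"
    proof (cases "\<pi> = id")
      case False
      then obtain i where "\<pi> i \<noteq> i" by (auto simp: fun_eq_iff)
      moreover from this \<pi> have "i < 2 * n" by (auto simp: permutes_def)
      ultimately have "\<exists>i\<in>{..<2 * n}. (if i = \<pi> i then 1 else (0::complex)) = 0"
        by (intro bexI[of _ i]) auto
      then show ?thesis using False by simp
    qed simp
    then show "of_int (sign \<pi>) * (\<Prod>i<2 * n. if i = \<pi> i then 1 else 0)
        = (if \<pi> = id then 1 else (0::complex))" by simp
  qed simp
  also have "\<dots> = 1" by (simp add: finite_permutations permutes_id)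
  finally have "cup 1 (2 * n) e w \<noteq> 0" by simp
  then have e0: "cup 1 (2 * n) e \<noteq> 0" by (auto simp: zero_fun_def)
  let ?G = "{cup 1 (2 * n) \<phi> | \<phi>. \<forall>i<2 * n. \<phi> i \<in> eigenforms x s 1}"
  have G: "?G \<subseteq> eigenforms x s (2 * n)"
    using cup_in_eigenforms[of "2 * n" _ x s 1] by auto
  show ?thesis
    unfolding exterior_power_def
  proof
    have "cform.span ?G \<subseteq> eigenforms x s (2 * n)"
      by (rule cform.span_minimal[OF G subspace_eigenforms])
    then show "cform.span ?G \<subseteq> range (\<lambda>c. cscale c ?\<Omega>)"
      using eigenforms_top[OF _ phi_form_power_eigenform phi_form_power_nonzero] by blast
    have e_in: "cup 1 (2 * n) e \<in> ?G" using e by blast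
    obtain c where "?\<Omega> = cscale c (cup 1 (2 * n) e)"
      using eigenforms_top[OF phi_form_power_eigenform _ e0] e_in G by blast
    then have "?\<Omega> \<in> cform.span ?G" using e_in by (auto intro: cform.span_scale cform.span_base)
    then show "range (\<lambda>c. cscale c ?\<Omega>) \<subseteq> cform.span ?G"
      by (auto intro: cform.span_scale)
  qed
qed

end


section \<open>Lattices and rational homomorphisms\<close>

text \<open>
  A lattice basis has twice as many members as \<open>'g\<close> has. Indexing it by the type \<open>'g + 'g\<close> allows Gram
  matrices over \<open>\<rat>\<close> to be formed.
\<close>

lemma lattice_basis:
  fixes L :: "(complex^'g::finite) set"
  assumes "torus_lattice L"
  obtains b :: "'g + 'g \<Rightarrow> complex^'g"
  where "inj b" "independent (range b)" "span (range b) = UNIV"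
    "L = range (\<lambda>c. \<Sum>i\<in>UNIV. real_of_int (c i) *\<^sub>R b i)"
proof -
  obtain B where B: "independent B" "span B = UNIV"
    and L: "L = {\<Sum>b\<in>B. real_of_int (c b) *\<^sub>R b | c. True}"
    using assms by (auto simp: torus_lattice_def)
  have fin: "finite B" using B(1) by (rule finiteI_independent)
  have "card B = DIM(complex^'g)"
    using B by (metis dim_UNIV dim_span_eq_card_independent)
  then have "card (UNIV :: ('g + 'g) set) = card B" by simp
  then obtain b :: "'g + 'g \<Rightarrow> complex^'g" where b: "bij_betw b UNIV B"
    using fin finite_same_card_bij[of "UNIV :: ('g + 'g) set" B] by auto
  then have inj: "inj b" and range: "range b = B" by (auto simp: bij_betw_def)
  have "L = range (\<lambda>c. \<Sum>i\<in>UNIV. real_of_int (c i) *\<^sub>R b i)"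
  proof (intro equalityI subsetI)
    fix v assume "v \<in> L"
    then obtain c where "v = (\<Sum>b\<in>B. real_of_int (c b) *\<^sub>R b)" using L by auto
    also have "\<dots> = (\<Sum>i\<in>UNIV. real_of_int (c (b i)) *\<^sub>R b i)"
      by (rule sum.reindex_bij_betw[OF b, symmetric])
    finally show "v \<in> range (\<lambda>c. \<Sum>i\<in>UNIV. real_of_int (c i) *\<^sub>R b i)"
      by (rule range_eqI[where x = "\<lambda>i. c (b i)"])
  next
    fix v assume "v \<in> range (\<lambda>c. \<Sum>i\<in>UNIV. real_of_int (c i) *\<^sub>R b i)"
    then obtain c where "v = (\<Sum>i\<in>UNIV. real_of_int (c i) *\<^sub>R b i)" by blast
    also have "\<dots> = (\<Sum>i\<in>UNIV. real_of_int (c (the_inv b (b i))) *\<^sub>R b i)"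
      by (simp add: the_inv_f_f[OF inj])
    also have "\<dots> = (\<Sum>x\<in>B. real_of_int (c (the_inv b x)) *\<^sub>R x)"
      using sum.reindex_bij_betw[OF b, of "\<lambda>x. real_of_int (c (the_inv b x)) *\<^sub>R x"] .
    finally show "v \<in> L" unfolding L by (auto intro!: exI[of _ "\<lambda>x. c (the_inv b x)"])
  qed
  then show thesis using that inj B range by blast
qed

lemma lattice_basis_in:
  fixes b :: "'i::finite \<Rightarrow> 'v::real_vector"
  assumes "L = range (\<lambda>c. \<Sum>i\<in>UNIV. real_of_int (c i) *\<^sub>R b i)"
  shows "b j \<in> L"
proof -
  have "(\<Sum>i\<in>UNIV. real_of_int (if i = j then 1 else 0) *\<^sub>R b i) = (\<Sum>i\<in>UNIV. if i = j then b i else 0)"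
    by (rule sum.cong) auto
  then have "b j = (\<Sum>i\<in>UNIV. real_of_int (if i = j then 1 else 0) *\<^sub>R b i)" by simp
  then show ?thesis unfolding assms by (rule range_eqI[where x = "\<lambda>i. if i = j then 1 else 0"])
qed

lemma lattice_generators:
  fixes L :: "(complex^'g::finite) set"
  assumes "torus_lattice L"
  obtains b :: "'g + 'g \<Rightarrow> complex^'g"
  where "span (range b) = UNIV" "L = range (\<lambda>c. \<Sum>i\<in>UNIV. real_of_int (c i) *\<^sub>R b i)"
  by (rule lattice_basis[OF assms]) (rule that)

lemma lattice_add:
  fixes L :: "(complex^'g::finite) set"
  assumes "torus_lattice L" "u \<in> L" "v \<in> L" shows "u + v \<in> L"
proof -
  obtain b :: "'g + 'g \<Rightarrow> complex^'g" where L: "L = range (\<lambda>c. \<Sum>i\<in>UNIV. real_of_int (c i) *\<^sub>R b i)"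
    by (rule lattice_generators[OF assms(1)])
  obtain c d where "u = (\<Sum>i\<in>UNIV. real_of_int (c i) *\<^sub>R b i)" "v = (\<Sum>i\<in>UNIV. real_of_int (d i) *\<^sub>R b i)"
    using assms(2,3) unfolding L by blast
  then have "u + v = (\<Sum>i\<in>UNIV. real_of_int (c i + d i) *\<^sub>R b i)"
    by (simp add: sum.distrib scaleR_add_left)
  then show ?thesis unfolding L by (rule range_eqI[where x = "\<lambda>i. c i + d i"])
qed

lemma lattice_scale_int:
  fixes L :: "(complex^'g::finite) set"
  assumes "torus_lattice L" "u \<in> L" shows "real_of_int k *\<^sub>R u \<in> L"
proof -
  obtain b :: "'g + 'g \<Rightarrow> complex^'g" where L: "L = range (\<lambda>c. \<Sum>i\<in>UNIV. real_of_int (c i) *\<^sub>R b i)"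
    by (rule lattice_generators[OF assms(1)])
  obtain c where "u = (\<Sum>i\<in>UNIV. real_of_int (c i) *\<^sub>R b i)"
    using assms(2) unfolding L by blast
  then have "real_of_int k *\<^sub>R u = (\<Sum>i\<in>UNIV. real_of_int (k * c i) *\<^sub>R b i)"
    by (simp add: scaleR_sum_right)
  then show ?thesis unfolding L by (rule range_eqI[where x = "\<lambda>i. k * c i"])
qed

lemma lattice_scale_nat: "torus_lattice L \<Longrightarrow> u \<in> L \<Longrightarrow> real k *\<^sub>R u \<in> L"
  using lattice_scale_int[of L u "int k"] by simp

lemma lattice_zero:
  fixes L :: "(complex^'g::finite) set"
  assumes "torus_lattice L" shows "0 \<in> L"
proof -
  obtain b :: "'g + 'g \<Rightarrow> complex^'g" where L: "L = range (\<lambda>c. \<Sum>i\<in>UNIV. real_of_int (c i) *\<^sub>R b i)"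
    by (rule lattice_generators[OF assms])
  show ?thesis using lattice_scale_int[OF assms lattice_basis_in[OF L], of 0] by simp
qed

lemma lattice_sum:
  assumes "torus_lattice L" "\<And>i. i \<in> I \<Longrightarrow> u i \<in> L" shows "sum u I \<in> L"
  using assms(2)
  by (induction I rule: infinite_finite_induct) (auto intro: lattice_add[OF assms(1)] lattice_zero[OF assms(1)])

lemma span_lattice:
  fixes L :: "(complex^'g::finite) set"
  assumes "torus_lattice L" shows "span L = UNIV"
proof -
  obtain b :: "'g + 'g \<Rightarrow> complex^'g" where b: "span (range b) = UNIV"
    and L: "L = range (\<lambda>c. \<Sum>i\<in>UNIV. real_of_int (c i) *\<^sub>R b i)"
    by (rule lattice_generators[OF assms])
  have "range b \<subseteq> L" using lattice_basis_in[OF L] by blast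
  then show ?thesis using span_mono b by blast
qed

lemma countable_lattice:
  fixes L :: "(complex^'g::finite) set"
  assumes "torus_lattice L" shows "countable L"
proof -
  obtain b :: "'g + 'g \<Rightarrow> complex^'g" where L: "L = range (\<lambda>c. \<Sum>i\<in>UNIV. real_of_int (c i) *\<^sub>R b i)"
    by (rule lattice_generators[OF assms])
  have "countable (UNIV :: ('g + 'g \<Rightarrow> int) set)"
    using countable_PiE[of "UNIV :: ('g + 'g) set" "\<lambda>_. UNIV :: int set"]
    by (simp add: PiE_UNIV_domain)
  then show ?thesis unfolding L by (rule countable_image)
qed

text \<open>
  The lattice spans \<open>\<complex>\<^sup>g\<close> over \<open>\<real>\<close>, so multilinearity allows lattice vectors to be replaced by
  arbitrary ones, one slot at a time.
\<close>

lemma form_eq_0_on_lattice: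
  fixes \<alpha> :: "(complex^'g::finite) form"
  assumes L: "torus_lattice L" and \<alpha>: "\<alpha> \<in> H_complex k"
    and 0: "\<And>v. (\<And>i. i < k \<Longrightarrow> v i \<in> L) \<Longrightarrow> \<alpha> v = 0"
  shows "\<alpha> = 0"
proof -
  have "\<alpha> v = 0" if "m \<le> k" "\<And>i. m \<le> i \<Longrightarrow> i < k \<Longrightarrow> v i \<in> L" for m v
    using that
  proof (induction m arbitrary: v)
    case 0
    then show ?case using assms(3) by blast
  next
    case (Suc m)
    have lin: "linear (\<lambda>u. \<alpha> (v(m := u)))" using Suc.prems by (intro H_complex_linear[OF \<alpha>]) simp
    have "\<alpha> (v(m := u)) = 0" if "u \<in> L" for u
      using that Suc.prems by (intro Suc.IH) auto
    then have "\<alpha> (v(m := u)) = 0" for u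
      using linear_eq_on_span[OF lin linear_zero, of L u] span_lattice[OF L] by auto
    from this[of "v m"] show ?case by simp
  qed
  from this[of k] show ?thesis by (auto simp: zero_fun_def)
qed

text \<open>
  The elements of \<open>Hom(A, A') \<otimes> \<rat>\<close>: homomorphisms up to a denominator.
\<close>

definition quasi_hom ::
    "(complex^'g::finite) set \<Rightarrow> (complex^'h::finite) set \<Rightarrow> complex^'g^'h \<Rightarrow> bool" where
  "quasi_hom L L' X \<longleftrightarrow> (\<exists>k::nat. k > 0 \<and> torus_hom L L' (real k *\<^sub>R X))"

lemma carrier_endo_alg: "carrier (endo_alg L) = {X. quasi_hom L L X}"
  by (simp add: endo_alg_def quasi_hom_def)

lemma endo_alg_simps [simp]:
  "mult (endo_alg L) = (**)" "one (endo_alg L) = mat 1" "zero (endo_alg L) = 0"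
  "add (endo_alg L) = (+)"
  by (simp_all add: endo_alg_def)

lemma scaleR_mult_vec: "(r *\<^sub>R X) *v v = r *\<^sub>R (X *v v)"
  for X :: "complex^'g::finite^'h::finite"
  by (simp add: matrix_vector_mult_def vec_eq_iff scaleR_sum_right)

lemma mult_vec_scaleR: "X *v (r *\<^sub>R v) = r *\<^sub>R (X *v v)"
  for X :: "complex^'g::finite^'h::finite"
  by (simp add: matrix_vector_mult_def vec_eq_iff scaleR_sum_right)

lemma linear_mult_vec: "linear ((*v) X)"
  for X :: "complex^'g::finite^'h::finite"
  by (simp add: linear_iff matrix_vector_right_distrib mult_vec_scaleR)

lemma mult_vec_smult: "X *v (c *s v) = c *s (X *v v)"
  for X :: "complex^'g::finite^'h::finite"
  by (simp add: matrix_vector_mult_def vec_eq_iff sum_distrib_left mult.left_commute)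

lemma rat_mat_mult_vec: "rat_mat q *v v = real_of_rat q *\<^sub>R v"
  for v :: "complex^'g::finite"
proof -
  have "(of_rat q :: complex) = of_real (real_of_rat q)"
    by (cases q) (simp add: of_rat_rat)
  then show ?thesis
    by (simp add: rat_mat_def matrix_vector_mult_def mat_def vec_eq_iff if_distrib[where f = "\<lambda>c. c * _"]
        scaleR_conv_of_real[where 'a = complex] cong: if_cong)
qed

lemma smult_decomposition: "c *s u = Re c *\<^sub>R u + Im c *\<^sub>R (\<i> *s u)"
  for u :: "complex^'g::finite"
  by (simp add: vec_eq_iff complex_eq_iff)

lemma quasi_homE:
  assumes "quasi_hom L L' X"
  obtains k :: nat where "k > 0" "\<And>v. v \<in> L \<Longrightarrow> real k *\<^sub>R (X *v v) \<in> L'"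
  using assms by (auto simp: quasi_hom_def torus_hom_def scaleR_mult_vec)

text \<open>
  It suffices to bound the denominator for each lattice vector separately, because the lattice is
  finitely generated.
\<close>

lemma quasi_homI:
  fixes L :: "(complex^'g::finite) set" and L' :: "(complex^'h::finite) set"
  assumes L: "torus_lattice L" and L': "torus_lattice L'"
    and X: "\<And>v. v \<in> L \<Longrightarrow> \<exists>k::nat. k > 0 \<and> real k *\<^sub>R (X *v v) \<in> L'"
  shows "quasi_hom L L' X"
proof -
  obtain b :: "'g + 'g \<Rightarrow> complex^'g" where b: "L = range (\<lambda>c. \<Sum>i\<in>UNIV. real_of_int (c i) *\<^sub>R b i)"
    by (rule lattice_generators[OF L])
  have "\<forall>i. \<exists>k::nat. k > 0 \<and> real k *\<^sub>R (X *v b i) \<in> L'"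
    using X lattice_basis_in[OF b] by blast
  then obtain k :: "'g + 'g \<Rightarrow> nat" where k: "\<And>i. k i > 0" "\<And>i. real (k i) *\<^sub>R (X *v b i) \<in> L'"
    by metis
  define K where "K = prod k UNIV"
  have K: "K > 0" using k(1) by (simp add: K_def prod_pos)
  have Kb: "real K *\<^sub>R (X *v b i) \<in> L'" for i
  proof -
    have "K = prod k (UNIV - {i}) * k i"
      unfolding K_def by (subst prod.remove[of _ i]) (auto simp: mult.commute)
    then have "real K *\<^sub>R (X *v b i) = real (prod k (UNIV - {i})) *\<^sub>R (real (k i) *\<^sub>R (X *v b i))"
      by simp
    then show ?thesis by (simp only: lattice_scale_nat[OF L' k(2)])
  qed
  have "real K *\<^sub>R (X *v v) \<in> L'" if "v \<in> L" for v
  proof -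
    obtain c where "v = (\<Sum>i\<in>UNIV. real_of_int (c i) *\<^sub>R b i)" using \<open>v \<in> L\<close> unfolding b by blast
    then have "real K *\<^sub>R (X *v v) = (\<Sum>i\<in>UNIV. real_of_int (c i) *\<^sub>R (real K *\<^sub>R (X *v b i)))"
      by (simp add: linear_sum[OF linear_mult_vec] mult_vec_scaleR scaleR_sum_right mult.commute)
    then show ?thesis by (simp only:) (intro lattice_sum[OF L'] lattice_scale_int[OF L'] Kb)
  qed
  with K show ?thesis by (auto simp: quasi_hom_def torus_hom_def scaleR_mult_vec)
qed

lemma quasi_hom_compose:
  assumes L: "torus_lattice L" and L'': "torus_lattice L''"
    and X: "quasi_hom L L' X" and Y: "quasi_hom L' L'' Y"
  shows "quasi_hom L L'' (Y ** X)"
proof -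
  obtain k :: nat where k: "k > 0" "\<And>v. v \<in> L \<Longrightarrow> real k *\<^sub>R (X *v v) \<in> L'"
    by (rule quasi_homE[OF X]) blast
  obtain l :: nat where l: "l > 0" "\<And>v. v \<in> L' \<Longrightarrow> real l *\<^sub>R (Y *v v) \<in> L''"
    by (rule quasi_homE[OF Y]) blast
  have "real (l * k) *\<^sub>R ((Y ** X) *v v) \<in> L''" if "v \<in> L" for v
    using l(2)[OF k(2)[OF that]] by (simp add: mult_vec_scaleR matrix_vector_mul_assoc)
  then show ?thesis
    using k l by (intro quasi_homI L L'') (auto intro!: exI[of _ "l * k"])
qed

lemma quasi_hom_add:
  assumes L: "torus_lattice L" and L': "torus_lattice L'"
    and X: "quasi_hom L L' X" and Y: "quasi_hom L L' Y"
  shows "quasi_hom L L' (X + Y)"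
proof -
  obtain k :: nat where k: "k > 0" "\<And>v. v \<in> L \<Longrightarrow> real k *\<^sub>R (X *v v) \<in> L'"
    by (rule quasi_homE[OF X]) blast
  obtain l :: nat where l: "l > 0" "\<And>v. v \<in> L \<Longrightarrow> real l *\<^sub>R (Y *v v) \<in> L'"
    by (rule quasi_homE[OF Y]) blast
  have "real (l * k) *\<^sub>R ((X + Y) *v v) \<in> L'" if "v \<in> L" for v
  proof -
    have "real (l * k) *\<^sub>R ((X + Y) *v v) =
        real l *\<^sub>R (real k *\<^sub>R (X *v v)) + real k *\<^sub>R (real l *\<^sub>R (Y *v v))"
      by (simp add: matrix_vector_mult_add_rdistrib scaleR_add_right mult.commute)
    then show ?thesis
      by (simp only: lattice_add[OF L'] lattice_scale_nat[OF L'] k(2)[OF that] l(2)[OF that])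
  qed
  then show ?thesis
    using k l by (intro quasi_homI L L') (auto intro!: exI[of _ "l * k"])
qed

lemma quasi_hom_scale_int:
  assumes L: "torus_lattice L" and L': "torus_lattice L'" and X: "quasi_hom L L' X"
  shows "quasi_hom L L' (real_of_int z *\<^sub>R X)"
proof -
  obtain k :: nat where k: "k > 0" "\<And>v. v \<in> L \<Longrightarrow> real k *\<^sub>R (X *v v) \<in> L'"
    by (rule quasi_homE[OF X]) blast
  have "real k *\<^sub>R ((real_of_int z *\<^sub>R X) *v v) \<in> L'" if "v \<in> L" for v
    using lattice_scale_int[OF L' k(2)[OF that], of z] by (simp add: scaleR_mult_vec mult.commute)
  then show ?thesis using k by (intro quasi_homI L L') auto
qed

lemma quasi_hom_1: "torus_lattice L \<Longrightarrow> quasi_hom L L (mat 1)"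
  by (rule quasi_homI) (auto intro!: exI[of _ 1])

lemma matrix_mult_add_rdistrib: "(X + Y) ** Z = X ** Z + Y ** Z"
  for X Y :: "complex^'g::finite^'h::finite" and Z :: "complex^'k::finite^'g"
  by (simp add: matrix_matrix_mult_def vec_eq_iff sum.distrib algebra_simps)

lemma ring_endo_alg:
  fixes L :: "(complex^'g::finite) set"
  assumes L: "torus_lattice L"
  shows "ring (endo_alg L)"
proof -
  have neg: "quasi_hom L L (- X)" if "quasi_hom L L X" for X
    using quasi_hom_scale_int[OF L L that, of "-1"] by simp
  have zero: "quasi_hom L L 0"
    using quasi_hom_scale_int[OF L L quasi_hom_1[OF L], of 0] by simp
  show ?thesis
    by (rule ringI; (rule abelian_groupI monoidI)?)
       (auto simp: carrier_endo_alg matrix_mul_assoc algebra_simps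
          matrix_add_ldistrib matrix_mult_add_rdistrib
          quasi_hom_1[OF L] zero quasi_hom_add[OF L L] quasi_hom_compose[OF L L]
          intro!: exI[of _ "- _"] neg)
qed

lemma subring_endo_algD:
  fixes L :: "(complex^'g::finite) set"
  assumes L: "torus_lattice L" and S: "subring S (endo_alg L)"
  shows "S \<subseteq> {X. quasi_hom L L X}" "mat 1 \<in> S" "0 \<in> S"
    and "\<And>x y. x \<in> S \<Longrightarrow> y \<in> S \<Longrightarrow> x + y \<in> S"
    and "\<And>x y. x \<in> S \<Longrightarrow> y \<in> S \<Longrightarrow> x ** y \<in> S"
    and "\<And>x. x \<in> S \<Longrightarrow> - x \<in> S"
proof -
  interpret R: ring "endo_alg L" by (rule ring_endo_alg[OF L])
  show 1: "S \<subseteq> {X. quasi_hom L L X}" "mat 1 \<in> S" "0 \<in> S"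
    "\<And>x y. x \<in> S \<Longrightarrow> y \<in> S \<Longrightarrow> x + y \<in> S" "\<And>x y. x \<in> S \<Longrightarrow> y \<in> S \<Longrightarrow> x ** y \<in> S"
    using subringE[OF S] by (auto simp: carrier_endo_alg)
  show "- x \<in> S" if "x \<in> S" for x
  proof -
    have x: "x \<in> carrier (endo_alg L)" using that 1 by (auto simp: carrier_endo_alg)
    then have nx: "- x \<in> carrier (endo_alg L)"
      using quasi_hom_scale_int[OF L L, of x "-1"] by (auto simp: carrier_endo_alg)
    have "\<ominus>\<^bsub>endo_alg L\<^esub> x = - x" by (rule R.minus_equality) (use x nx in auto)
    then show ?thesis using subringE(5)[OF S that] by simp
  qed
qed


lemma subring_scale_int:
  fixes L :: "(complex^'g::finite) set"
  assumes L: "torus_lattice L" and K: "subring K (endo_alg L)" and y: "y \<in> K"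
  shows "real_of_int z *\<^sub>R y \<in> K"
proof (induction z rule: int_induct[of _ 0])
  case base
  then show ?case using subring_endo_algD(3)[OF L K] by simp
next
  case (step1 i)
  then show ?case using subring_endo_algD(4)[OF L K _ y] by (simp add: scaleR_add_left)
next
  case (step2 i)
  then show ?case
    using subring_endo_algD(4)[OF L K _ subring_endo_algD(6)[OF L K y]] by (simp add: scaleR_diff_left)
qed


section \<open>Polarizations and rational forms\<close>

lemma i_i_vec: "\<i> *s (\<i> *s v) = - v" for v :: "complex^'g::finite"
  by (simp add: vec_eq_iff)

context
  fixes L :: "(complex^'g::finite) set" and E :: "complex^'g \<Rightarrow> complex^'g \<Rightarrow> real"
  assumes pol: "polarization L E"
begin

lemma polarization_linear_left: "linear (\<lambda>u. E u v)"
  and polarization_linear_right: "linear (\<lambda>v. E u v)"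
  using pol by (auto simp: polarization_def bilinear_def)

lemma polarization_integral: "u \<in> L \<Longrightarrow> v \<in> L \<Longrightarrow> E u v \<in> \<int>"
  and polarization_self: "E v v = 0"
  and polarization_i_i: "E (\<i> *s u) (\<i> *s v) = E u v"
  and polarization_positive: "v \<noteq> 0 \<Longrightarrow> E (\<i> *s v) v > 0"
  using pol by (auto simp: polarization_def)

lemma polarization_antisym: "E u v = - E v u"
proof -
  have "0 = E (u + v) (u + v)" by (simp only: polarization_self)
  also have "\<dots> = E u v + E v u"
    unfolding linear_add[OF polarization_linear_left] linear_add[OF polarization_linear_right]
    by (simp add: polarization_self)
  finally show ?thesis by simp
qed

lemma polarization_i_left: "E (\<i> *s u) v = - E u (\<i> *s v)"
  using polarization_i_i[of u "\<i> *s v"] linear_neg[OF polarization_linear_right]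
  by (simp add: i_i_vec)

lemma polarization_nondegenerate:
  assumes "\<And>v. E u v = 0" shows "u = 0"
  using polarization_positive[of u] assms polarization_antisym[of "\<i> *s u" u] by fastforce

end

lemma common_denominator:
  assumes "finite S" "\<And>i. i \<in> S \<Longrightarrow> f i \<in> \<rat>"
  shows "\<exists>k::nat. k > 0 \<and> (\<forall>i\<in>S. real k * f i \<in> \<int>)"
  using assms
proof (induction S)
  case empty
  then show ?case by auto
next
  case (insert x S)
  then obtain k :: nat where k: "k > 0" "\<And>i. i \<in> S \<Longrightarrow> real k * f i \<in> \<int>" by auto
  obtain a and m :: nat where m: "m \<noteq> 0" "f x = real_of_int a / real m"
    using insert.prems[of x] unfolding Rats_eq_int_div_nat by blast
  have "real (m * k) * f i \<in> \<int>" if "i \<in> insert x S" for i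
  proof (cases "i = x")
    case True
    then have "real (m * k) * f i = real_of_int (int k * a)" using m by simp
    then show ?thesis by (simp only: Ints_of_int)
  next
    case False
    then have "real k * f i \<in> \<int>" using k that by blast
    then have "real m * (real k * f i) \<in> \<int>" by simp
    then show ?thesis by (simp add: mult.assoc)
  qed
  then show ?case using m k by (intro exI[of _ "m * k"]) auto
qed

text \<open>
  A polarization identifies \<open>L \<otimes> \<rat>\<close> with its dual: its Gram matrix has rational entries, and it is
  invertible over \<open>\<rat>\<close> because the form is nondegenerate over \<open>\<real>\<close>.
\<close>

lemma rational_functional_representation:
  fixes L :: "(complex^'g::finite) set"
  assumes L: "torus_lattice L" and pol: "polarization L E"
    and f: "linear f" "\<And>v. v \<in> L \<Longrightarrow> f v \<in> \<rat>"
  shows "\<exists>k::nat. \<exists>w\<in>L. k > 0 \<and> (\<forall>v. real k * f v = E w v)"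
proof -
  obtain b :: "'g + 'g \<Rightarrow> complex^'g" where b: "inj b" "independent (range b)" "span (range b) = UNIV"
    and Lb: "L = range (\<lambda>c. \<Sum>i\<in>UNIV. real_of_int (c i) *\<^sub>R b i)"
    by (rule lattice_basis[OF L])
  have bL: "b i \<in> L" for i by (rule lattice_basis_in[OF Lb])
  have "E (b j) (b i) \<in> \<rat>" for i j
    using polarization_integral[OF pol bL bL] Ints_subset_Rats by blast
  then have "\<forall>i j. \<exists>r. E (b j) (b i) = real_of_rat r" by (metis Rats_cases)
  then obtain r where r: "\<And>i j. E (b j) (b i) = real_of_rat (r i j)" by metis
  have "\<forall>i. \<exists>r. f (b i) = real_of_rat r" using f(2)[OF bL] by (metis Rats_cases)
  then obtain t where t: "\<And>i. f (b i) = real_of_rat (t i)" by metis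
  define M :: "rat^('g + 'g)^('g + 'g)" where "M = (\<chi> i j. r i j)"
  define comb :: "rat^('g + 'g) \<Rightarrow> complex^'g" where "comb q = (\<Sum>j\<in>UNIV. real_of_rat (q $ j) *\<^sub>R b j)" for q
  have E_comb: "E (comb q) (b i) = real_of_rat ((M *v q) $ i)" for q i
    by (simp add: comb_def linear_sum[OF polarization_linear_left[OF pol]]
        linear_scale[OF polarization_linear_left[OF pol]] M_def matrix_vector_mult_def r
        of_rat_sum of_rat_mult mult.commute)
  have on_basis: "E u = g" if "linear g" "\<And>i. E u (b i) = g (b i)" for u g
  proof
    fix v
    show "E u v = g v"
      by (rule linear_eq_on_span[OF polarization_linear_right[OF pol] that(1), of "range b"])
         (use that b in auto)
  qed
  have "q = 0" if "M *v q = 0" for q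
  proof -
    have "E (comb q) = (\<lambda>v. 0)"
      by (rule on_basis) (use that in \<open>auto simp: linear_zero E_comb\<close>)
    then have "comb q = 0" using polarization_nondegenerate[OF pol, of "comb q"] by (simp add: fun_eq_iff)
    then have "(\<Sum>x\<in>range b. real_of_rat (q $ the_inv b x) *\<^sub>R x) = 0"
      by (simp add: comb_def sum.reindex[OF b(1)] the_inv_f_f[OF b(1)])
    then have coeff: "real_of_rat (q $ the_inv b x) = 0" if "x \<in> range b" for x
      using independentD[OF b(2) _ subset_refl _ that, of "\<lambda>x. real_of_rat (q $ the_inv b x)"]
      by simp
    from coeff[OF rangeI] show "q = 0" by (simp add: the_inv_f_f[OF b(1)] vec_eq_iff)
  qed
  then have "\<exists>N. N ** M = mat 1" by (simp add: matrix_left_invertible_ker)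
  then obtain N where "N ** M = mat 1" ..
  then have N: "M ** N = mat 1" by (rule matrix_left_right_inverse[THEN iffD1])
  define q where "q = N *v (\<chi> i. t i)"
  have "M *v q = (\<chi> i. t i)" by (simp add: q_def matrix_vector_mul_assoc N)
  then have Ef: "E (comb q) = f"
    by (intro on_basis f) (simp add: E_comb t)
  obtain k :: nat where k: "k > 0" "\<And>i. real k * real_of_rat (q $ i) \<in> \<int>"
    using common_denominator[of UNIV "\<lambda>i. real_of_rat (q $ i)"] by auto
  then have "\<forall>i. \<exists>z. real k * real_of_rat (q $ i) = real_of_int z" by (metis Ints_cases)
  then obtain z where z: "\<And>i. real k * real_of_rat (q $ i) = real_of_int (z i)" by metis
  have "real k *\<^sub>R comb q = (\<Sum>i\<in>UNIV. real_of_int (z i) *\<^sub>R b i)"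
    by (simp add: comb_def scaleR_sum_right z)
  then have "real k *\<^sub>R comb q \<in> L"
    unfolding Lb by (rule range_eqI[where x = z])
  moreover have "real k * f v = E (real k *\<^sub>R comb q) v" for v
    by (simp add: linear_scale[OF polarization_linear_left[OF pol]] Ef)
  ultimately show ?thesis using k by blast
qed

text \<open>
  The construction by which a polarization embeds \<open>NS(A) \<otimes> \<rat>\<close> into \<open>End(A) \<otimes> \<rat>\<close>. On a lattice basis, \<open>X\<close>
  comes from the representation of the functionals \<open>G u\<close>; invariance of both forms under \<open>\<i>\<close> and
  nondegeneracy make it complex linear.
\<close>

lemma rational_form_representation:
  fixes L :: "(complex^'g::finite) set"
  assumes L: "torus_lattice L" and pol: "polarization L E"
    and G: "bilinear G" "\<And>u v. u \<in> L \<Longrightarrow> v \<in> L \<Longrightarrow> G u v \<in> \<rat>"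
      "\<And>u v. G (\<i> *s u) (\<i> *s v) = G u v"
  obtains X where "quasi_hom L L X" "\<And>u v. G u v = E (X *v u) v"
proof -
  have lin_l: "linear (\<lambda>u. G u v)" and lin_r: "linear (\<lambda>v. G u v)" for u v
    using G(1) by (auto simp: bilinear_def)
  obtain b :: "'g + 'g \<Rightarrow> complex^'g" where b: "inj b" "independent (range b)" "span (range b) = UNIV"
    and Lb: "L = range (\<lambda>c. \<Sum>i\<in>UNIV. real_of_int (c i) *\<^sub>R b i)"
    by (rule lattice_basis[OF L])
  have "\<forall>u\<in>L. \<exists>k::nat. \<exists>w\<in>L. k > 0 \<and> (\<forall>v. real k * G u v = E w v)"
    using rational_functional_representation[OF L pol lin_r] G(2) by blast
  then obtain k :: "complex^'g \<Rightarrow> nat" and w where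
    k: "\<And>u. u \<in> L \<Longrightarrow> k u > 0" and w: "\<And>u. u \<in> L \<Longrightarrow> w u \<in> L"
    and kw: "\<And>u v. u \<in> L \<Longrightarrow> real (k u) * G u v = E (w u) v" by metis
  obtain Y where Y: "linear Y" "\<And>u. u \<in> range b \<Longrightarrow> Y u = inverse (real (k u)) *\<^sub>R w u"
    using linear_independent_extend[OF b(2), of "\<lambda>u. inverse (real (k u)) *\<^sub>R w u"] by blast
  have GE: "G u v = E (Y u) v" for u v
  proof -
    have "linear (\<lambda>u. E (Y u) v)"
      using linear_compose[OF Y(1) polarization_linear_left[OF pol]] by (simp add: comp_def)
    moreover have "G u v = E (Y u) v" if "u \<in> range b" for u
    proof -
      have u: "u \<in> L" using that lattice_basis_in[OF Lb] by blast
      then have "real (k u) * G u v = real (k u) * E (Y u) v"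
        using kw[OF u] k[OF u] by (simp add: Y(2)[OF that] linear_scale[OF polarization_linear_left[OF pol]])
      then show ?thesis using k[OF u] by simp
    qed
    ultimately show ?thesis
      using linear_eq_on_span[OF lin_l, of "\<lambda>u. E (Y u) v" "range b" v u] b(3) by auto
  qed
  have Yi: "Y (\<i> *s u) = \<i> *s Y u" for u
  proof -
    have "E (Y (\<i> *s u) - \<i> *s Y u) v = 0" for v
    proof -
      have "E (Y (\<i> *s u)) v = - E (Y (\<i> *s u)) (\<i> *s (\<i> *s v))"
        by (simp add: i_i_vec linear_neg[OF polarization_linear_right[OF pol]])
      also have "\<dots> = - E (Y u) (\<i> *s v)" using G(3)[of u "\<i> *s v"] by (simp add: GE)
      also have "\<dots> = E (\<i> *s Y u) v" by (simp add: polarization_i_left[OF pol])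
      finally show ?thesis by (simp add: linear_diff[OF polarization_linear_left[OF pol]])
    qed
    then have "Y (\<i> *s u) - \<i> *s Y u = 0" by (rule polarization_nondegenerate[OF pol])
    then show ?thesis by simp
  qed
  have Yc: "Y (c *s u) = c *s Y u" for c u
    unfolding smult_decomposition[of c] by (simp add: linear_add[OF Y(1)] linear_scale[OF Y(1)] Yi)
  have "Vector_Spaces.linear (*s) (*s) Y"
    by unfold_locales (simp_all add: linear_add[OF Y(1)] Yc)
  then have X: "matrix Y *v u = Y u" for u by (rule matrix_works)
  have "\<exists>K::nat. K > 0 \<and> real K *\<^sub>R (matrix Y *v v) \<in> L" if v: "v \<in> L" for v
  proof -
    have "real (k v) *\<^sub>R Y v - w v = 0"
      by (rule polarization_nondegenerate[OF pol])
         (simp add: linear_diff[OF polarization_linear_left[OF pol]]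
           linear_scale[OF polarization_linear_left[OF pol]] kw[OF v, symmetric] GE)
    then have "real (k v) *\<^sub>R (matrix Y *v v) = w v" by (simp add: X)
    then show ?thesis using k[OF v] w[OF v] by auto
  qed
  then have "quasi_hom L L (matrix Y)" by (rule quasi_homI[OF L L])
  then show thesis using that GE X by metis
qed


section \<open>Isogenies to a square\<close>

text \<open>
  The differential of an isogeny is invertible: a real line in its kernel would lie in
  finitely many classes modulo the countable lattice \<open>A\<close>, and a line that meets its image only in \<open>0\<close> would be mapped
  injectively to the countable group \<open>C\<close>. The inverse is a homomorphism up to a denominator since, by the
  pigeonhole principle, every element of the finite kernel has finite order.
\<close>

lemma isogeny_inverse:
  fixes A :: "(complex^'g::finite) set" and C :: "(complex^'h::finite) set"
  assumes A: "torus_lattice A" and M: "isogeny A C M" and C: "countable C"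
    and C_scale: "\<And>k v. v \<in> C \<Longrightarrow> real k *\<^sub>R v \<in> C"
  obtains N where "N ** M = mat 1" "M ** N = mat 1"
    "\<And>w. w \<in> C \<Longrightarrow> \<exists>k::nat. k > 0 \<and> real k *\<^sub>R (N *v w) \<in> A"
proof -
  define cls where "cls v = {y. v - y \<in> A}" for v
  define Q where "Q = cls ` {v. M *v v \<in> C}"
  have onto: "\<exists>v. M *v v - w \<in> C" for w using M by (auto simp: isogeny_def)
  have "Q = {v. M *v v \<in> C} // {(u, v). u - v \<in> A}"
    by (auto simp: Q_def cls_def quotient_def)
  then have fin: "finite Q" using M by (simp add: isogeny_def)
  have cls_refl: "v \<in> cls v" for v using lattice_zero[OF A] by (simp add: cls_def)
  have cls_countable: "countable (cls v)" for v
  proof -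
    have "cls v \<subseteq> (\<lambda>l. v - l) ` A"
    proof
      fix y assume "y \<in> cls v"
      then show "y \<in> (\<lambda>l. v - l) ` A" by (intro image_eqI[of _ _ "v - y"]) (auto simp: cls_def)
    qed
    then show ?thesis by (rule countable_subset) (rule countable_image[OF countable_lattice[OF A]])
  qed
  have uncountable: "uncountable (range (\<lambda>t::real. t *\<^sub>R v))" if "v \<noteq> 0" for v :: "complex^'a::finite"
  proof
    assume "countable (range (\<lambda>t::real. t *\<^sub>R v))"
    moreover have "inj (\<lambda>t::real. t *\<^sub>R v)" using that by (auto simp: inj_on_def)
    ultimately have "countable (UNIV :: real set)" by (rule countable_image_inj_on)
    then show False using uncountable_UNIV_real by blast
  qed
  have zero: "0 \<in> C" using onto[of 0] C_scale[of _ 0] by fastforce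
  have ker: "v = 0" if "M *v v = 0" for v
  proof (rule ccontr)
    assume "v \<noteq> 0"
    have "range (\<lambda>t::real. t *\<^sub>R v) \<subseteq> \<Union> Q"
    proof
      fix y assume "y \<in> range (\<lambda>t::real. t *\<^sub>R v)"
      then have "M *v y = 0" using that by (auto simp: mult_vec_scaleR)
      then have "cls y \<in> Q" using zero by (auto simp: Q_def)
      then show "y \<in> \<Union> Q" using cls_refl by blast
    qed
    moreover have "countable (\<Union> Q)"
    proof -
      have "countable X" if "X \<in> Q" for X using that cls_countable by (auto simp: Q_def)
      then show ?thesis using countable_UN[OF countable_finite[OF fin], of "\<lambda>X. X"] by simp
    qed
    ultimately show False using uncountable[OF \<open>v \<noteq> 0\<close>] countable_subset by blast
  qed
  then have "\<exists>N. N ** M = mat 1" by (simp add: matrix_left_invertible_ker)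
  then obtain N where N: "N ** M = mat 1" ..
  have onto_M: "\<exists>v. w = M *v v" for w
  proof (rule ccontr)
    assume w: "\<nexists>v. w = M *v v"
    have "\<forall>t::real. \<exists>v. M *v v - t *\<^sub>R w \<in> C" using onto by blast
    then obtain v where v: "\<And>t::real. M *v v t - t *\<^sub>R w \<in> C" by metis
    have inj: "inj (\<lambda>t. M *v v t - t *\<^sub>R w)"
    proof (rule injI, rule ccontr)
      fix t u assume e: "M *v v t - t *\<^sub>R w = M *v v u - u *\<^sub>R w" and "t \<noteq> u"
      from e have "M *v (v t - v u) = (t - u) *\<^sub>R w"
        by (simp add: matrix_vector_mult_diff_distrib algebra_simps)
      then have "w = M *v (inverse (t - u) *\<^sub>R (v t - v u))"
        using \<open>t \<noteq> u\<close> by (simp add: mult_vec_scaleR)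
      then show False using w by blast
    qed
    have "countable (range (\<lambda>t. M *v v t - t *\<^sub>R w))"
      by (rule countable_subset[OF _ C]) (use v in auto)
    then have "countable (UNIV :: real set)" by (rule countable_image_inj_on[OF _ inj])
    then show False using uncountable_UNIV_real by blast
  qed
  have "surj ((*v) M)" unfolding surj_def by (intro allI onto_M)
  then have "\<exists>N'. M ** N' = mat 1" by (simp only: matrix_right_invertible_surjective)
  then obtain N' where N': "M ** N' = mat 1" ..
  have "N = N'" using N N' by (metis matrix_mul_assoc matrix_mul_lid matrix_mul_rid)
  have "\<exists>k::nat. k > 0 \<and> real k *\<^sub>R (N *v w) \<in> A" if w: "w \<in> C" for w
  proof -
    define v where "v = N *v w"
    have "M *v v = w" using N' \<open>N = N'\<close> by (simp add: v_def matrix_vector_mul_assoc)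
    then have "range (\<lambda>j::nat. cls (real j *\<^sub>R v)) \<subseteq> Q"
      using C_scale[OF w] by (auto simp: Q_def mult_vec_scaleR)
    then have "finite (range (\<lambda>j::nat. cls (real j *\<^sub>R v)))" by (rule finite_subset[OF _ fin])
    then have "\<not> inj (\<lambda>j::nat. cls (real j *\<^sub>R v))"
      by (auto dest: finite_imageD)
    then obtain i j :: nat where ij: "i \<noteq> j" "cls (real i *\<^sub>R v) = cls (real j *\<^sub>R v)"
      unfolding inj_def by blast
    then obtain i j :: nat where "i < j" "cls (real i *\<^sub>R v) = cls (real j *\<^sub>R v)"
      by (cases "i < j") (auto simp: not_less le_less)
    then have "real j *\<^sub>R v - real i *\<^sub>R v \<in> A" using cls_refl[of "real i *\<^sub>R v"] by (auto simp: cls_def)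
    then have "real (j - i) *\<^sub>R v \<in> A" using \<open>i < j\<close> by (simp add: scaleR_diff_left of_nat_diff)
    then show ?thesis using \<open>i < j\<close> unfolding v_def by (intro exI[of _ "j - i"]) auto
  qed
  then show thesis using that[of N] N N' \<open>N = N'\<close> by blast
qed

text \<open>
  The projections and inclusions that identify \<open>End(A) \<otimes> \<rat>\<close> with the algebra of \<open>2 \<times> 2\<close> matrices over
  \<open>End(B) \<otimes> \<rat>\<close>.
\<close>

lemma isogenous_square_splitting:
  fixes A :: "(complex^'g::finite) set" and B :: "(complex^'h::finite) set"
  assumes A: "torus_lattice A" and B: "torus_lattice B" and "isogenous A (square_torus B)"
  obtains p1 p2 :: "complex^'g^'h" and s1 s2 :: "complex^'h^'g" where
    "quasi_hom A B p1" "quasi_hom A B p2" "quasi_hom B A s1" "quasi_hom B A s2"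
    "p1 ** s1 = mat 1" "p1 ** s2 = 0" "p2 ** s1 = 0" "p2 ** s2 = mat 1"
    "s1 ** p1 + s2 ** p2 = mat 1"
proof -
  let ?C = "square_torus B"
  obtain M where M: "isogeny A ?C M" using assms by (auto simp: isogenous_def)
  have "countable ?C"
  proof -
    have "inj_on (\<lambda>v. (\<chi> i. v $ Inl i, \<chi> i. v $ Inr i)) ?C"
    proof (rule inj_onI)
      fix v w :: "complex^('h + 'h)"
      assume "(\<chi> i. v $ Inl i, \<chi> i. v $ Inr i) = (\<chi> i. w $ Inl i, \<chi> i. w $ Inr i)"
      then have "v $ Inl i = w $ Inl i" "v $ Inr i = w $ Inr i" for i by (auto simp: vec_eq_iff)
      then show "v = w" by (auto simp: vec_eq_iff) (metis sum.exhaust)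
    qed
    moreover have "(\<lambda>v. (\<chi> i. v $ Inl i, \<chi> i. v $ Inr i)) ` ?C \<subseteq> B \<times> B"
      by (auto simp: square_torus_def)
    ultimately show ?thesis
      using countable_image_inj_on countable_subset[OF _ countable_SIGMA[OF countable_lattice[OF B] countable_lattice[OF B]]]
      by blast
  qed
  moreover have "real k *\<^sub>R v \<in> ?C" if "v \<in> ?C" for k v
  proof -
    have "(\<chi> i. (real k *\<^sub>R v) $ Inl i) = real k *\<^sub>R (\<chi> i. v $ Inl i)"
      "(\<chi> i. (real k *\<^sub>R v) $ Inr i) = real k *\<^sub>R (\<chi> i. v $ Inr i)" by (simp_all add: vec_eq_iff)
    then show ?thesis using that lattice_scale_nat[OF B] by (simp add: square_torus_def)
  qed
  ultimately obtain N where N: "N ** M = mat 1" "M ** N = mat 1"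
    and NA: "\<And>w. w \<in> ?C \<Longrightarrow> \<exists>k::nat. k > 0 \<and> real k *\<^sub>R (N *v w) \<in> A"
    using isogeny_inverse[OF A M] by metis
  define P1 :: "complex^('h + 'h)^'h" where "P1 = (\<chi> i j. if j = Inl i then 1 else 0)"
  define P2 :: "complex^('h + 'h)^'h" where "P2 = (\<chi> i j. if j = Inr i then 1 else 0)"
  define I1 :: "complex^'h^('h + 'h)" where "I1 = (\<chi> i j. if i = Inl j then 1 else 0)"
  define I2 :: "complex^'h^('h + 'h)" where "I2 = (\<chi> i j. if i = Inr j then 1 else 0)"
  have P: "P1 *v w = (\<chi> i. w $ Inl i)" "P2 *v w = (\<chi> i. w $ Inr i)" for w
    by (simp_all add: P1_def P2_def matrix_vector_mult_def if_distrib[where f = "\<lambda>c. c * _"] cong: if_cong)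
  have I: "(I1 *v u) $ Inl i = u $ i" "(I1 *v u) $ Inr i = 0" "(I2 *v u) $ Inl i = 0" "(I2 *v u) $ Inr i = u $ i"
    for u i
    by (simp_all add: I1_def I2_def matrix_vector_mult_def if_distrib[where f = "\<lambda>c. c * _"] cong: if_cong)
  have PI: "P1 ** I1 = mat 1" "P1 ** I2 = 0" "P2 ** I1 = 0" "P2 ** I2 = mat 1"
    by (simp_all add: matrix_eq flip: matrix_vector_mul_assoc) (simp_all add: P I vec_eq_iff)
  have IP: "I1 ** P1 + I2 ** P2 = mat 1"
  proof -
    have "(I1 ** P1 + I2 ** P2) *v w = w" for w
    proof -
      have "((I1 ** P1 + I2 ** P2) *v w) $ i = w $ i" for i
        by (cases i) (simp_all add: matrix_vector_mult_add_rdistrib P I flip: matrix_vector_mul_assoc)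
      then show ?thesis by (simp add: vec_eq_iff)
    qed
    then show ?thesis by (simp add: matrix_eq)
  qed
  have "quasi_hom A B (P1 ** M)" "quasi_hom A B (P2 ** M)"
    using M by (auto intro!: quasi_homI[OF A B] exI[of _ 1]
        simp: isogeny_def torus_hom_def square_torus_def P simp flip: matrix_vector_mul_assoc)
  moreover have "I1 *v u \<in> ?C" "I2 *v u \<in> ?C" if "u \<in> B" for u
  proof -
    have "(\<chi> i. 0) \<in> B" using lattice_zero[OF B] by (simp add: zero_vec_def)
    then show "I1 *v u \<in> ?C" "I2 *v u \<in> ?C" using that by (simp_all add: square_torus_def I)
  qed
  then have "quasi_hom B A (N ** I1)" "quasi_hom B A (N ** I2)"
    using NA by (auto intro!: quasi_homI[OF B A] simp flip: matrix_vector_mul_assoc)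
  moreover have "(P ** M) ** (N ** I) = P ** I" for P :: "complex^('h + 'h)^'h" and I :: "complex^'h^('h + 'h)"
    using N(2) by (metis matrix_mul_assoc matrix_mul_rid)
  moreover have "(N ** I1) ** (P1 ** M) + (N ** I2) ** (P2 ** M) = N ** (I1 ** P1 + I2 ** P2) ** M"
    by (simp add: matrix_add_ldistrib matrix_mult_add_rdistrib matrix_mul_assoc)
  ultimately show thesis
    using that[of "P1 ** M" "P2 ** M" "N ** I1" "N ** I2"] PI IP N(1) by simp
qed


section \<open>Skew endomorphisms\<close>

definition skew :: "(complex^'g::finite \<Rightarrow> complex^'g \<Rightarrow> real) \<Rightarrow> complex^'g^'g \<Rightarrow> bool" where
  "skew E x \<longleftrightarrow> (\<forall>u v. E (x *v u) v = - E u (x *v v))"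

text \<open>
  Comparing the multipliers of \<open>x\<close> and \<open>x + 1\<close> shows that the adjoint of \<open>x\<close> is \<open>t - x\<close> for a rational
  number \<open>t\<close>, the trace of \<open>x\<close>.
\<close>

lemma norm_compatible_trace:
  assumes pol: "polarization L E" and F: "norm_compatible F E" "x \<in> F" "x + mat 1 \<in> F"
  obtains t where "\<And>u v. E (x *v u) v + E u (x *v v) = real_of_rat t * E u v"
proof -
  note lin = linear_add[OF polarization_linear_left[OF pol]] linear_add[OF polarization_linear_right[OF pol]]
  obtain q where q: "\<And>u v. E (x *v u) (x *v v) = real_of_rat q * E u v"
    using F unfolding norm_compatible_def by blast
  obtain r where r: "\<And>u v. E ((x + mat 1) *v u) ((x + mat 1) *v v) = real_of_rat r * E u v"
    using F unfolding norm_compatible_def by blast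
  have "E (x *v u) v + E u (x *v v) = real_of_rat (r - q - 1) * E u v" for u v
    using r[of u v] q[of u v]
    by (simp add: matrix_vector_mult_add_rdistrib lin of_rat_diff of_rat_add algebra_simps)
  then show thesis by (rule that)
qed

text \<open>
  The adjoint \<open>t - x\<close> of \<open>x\<close> has the same rational square \<open>r\<close> as \<open>x\<close>. Hence \<open>t * (t - 2 x) = 0\<close>, and
  \<open>t = 0\<close> because \<open>x\<close> is not rational.
\<close>

lemma skew_if_square_rational:
  assumes pol: "polarization L E" and F: "norm_compatible F E" "x \<in> F" "x + mat 1 \<in> F"
    and x: "x ** x = rat_mat r" "x \<notin> range rat_mat"
  shows "skew E x"
proof -
  note left = polarization_linear_left[OF pol] and right = polarization_linear_right[OF pol]
  obtain t where t: "\<And>u v. E (x *v u) v + E u (x *v v) = real_of_rat t * E u v"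
    by (rule norm_compatible_trace[OF pol F]) blast
  have xx: "x *v (x *v u) = real_of_rat r *\<^sub>R u" for u
    using x(1) by (simp add: matrix_vector_mul_assoc rat_mat_mult_vec)
  have eq: "real_of_rat t * (E (x *v u) v - E u (x *v v)) = 0" for u v
    using t[of "x *v u" v] t[of u "x *v v"]
    by (simp add: xx linear_scale[OF left] linear_scale[OF right] algebra_simps)
  have "t = 0"
  proof (rule ccontr)
    assume "t \<noteq> 0"
    then have half: "E (x *v u) v = real_of_rat (t / 2) * E u v" for u v
      using eq[of u v] t[of u v] by (simp add: of_rat_divide)
    have "x *v u - real_of_rat (t / 2) *\<^sub>R u = 0" for u
      by (rule polarization_nondegenerate[OF pol])
         (simp add: linear_diff[OF left] linear_scale[OF left] half)
    then have "x *v u = rat_mat (t / 2) *v u" for u by (simp add: rat_mat_mult_vec)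
    then have "x = rat_mat (t / 2)" by (simp add: matrix_eq)
    then show False using x(2) by blast
  qed
  then show ?thesis using t unfolding skew_def by (metis add_eq_0_iff2 mult_zero_left of_rat_0)
qed

text \<open>
  For \<open>w = x u \<noteq> 0\<close> positivity gives \<open>0 < E (\<i> w) w = - N * E (\<i> u) u\<close>.
\<close>

lemma skew_square_negative:
  assumes pol: "polarization L E" and x: "skew E x" "x ** x = rat_mat (of_int N)" "x \<noteq> 0"
  shows "N < 0"
proof -
  obtain u where u: "x *v u \<noteq> 0" using x(3) by (metis matrix_eq matrix_vector_mult_0)
  then have "u \<noteq> 0" by auto
  have "0 < E (\<i> *s (x *v u)) (x *v u)" by (rule polarization_positive[OF pol u])
  also have "\<dots> = E (x *v (\<i> *s u)) (x *v u)" by (simp add: mult_vec_smult)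
  also have "\<dots> = - E (\<i> *s u) (x *v (x *v u))" using x(1) by (simp add: skew_def)
  also have "\<dots> = - real_of_int N * E (\<i> *s u) u"
    by (simp add: matrix_vector_mul_assoc x(2) rat_mat_mult_vec linear_scale[OF polarization_linear_right[OF pol]])
  finally show ?thesis
    using polarization_positive[OF pol \<open>u \<noteq> 0\<close>] by (simp add: zero_less_mult_iff mult_less_0_iff)
qed

text \<open>
  Completing the square in the quadratic equation of any irrational element gives \<open>\<kappa>\<close>. Denominators are
  cleared throughout: with integral coefficients, the values of an embedding of \<open>K\<close> follow from
  additivity alone.
\<close>

lemma quadratic_field_generator:
  fixes L :: "(complex^'g::finite) set"
  assumes L: "torus_lattice L" and K: "quadratic_field L K"
  obtains \<kappa> and N :: int where "\<kappa> \<in> K" "\<kappa> ** \<kappa> = rat_mat (of_int N)" "\<kappa> \<notin> range rat_mat"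
    "\<And>x. x \<in> K \<Longrightarrow> \<exists>k a b :: int. k \<noteq> 0 \<and>
        real_of_int k *\<^sub>R x = real_of_int a *\<^sub>R mat 1 + real_of_int b *\<^sub>R \<kappa>"
proof -
  have sub: "subfield K (endo_alg L)" and dim: "qmat.dim K = 2"
    using K by (auto simp: quadratic_field_def)
  note K_closed = subring_endo_algD[OF L subfieldE(1)[OF sub]]
  have rat: "rat_mat q = qscaleR q (mat 1)" for q
    by (simp add: matrix_eq rat_mat_mult_vec qscaleR_def scaleR_mult_vec)
  have ne: "(mat 1 :: complex^'g^'g) \<noteq> 0" using subfieldE(6)[OF sub] by simp
  have ind1: "qmat.independent {mat 1 :: complex^'g^'g}" using ne by simp
  have "\<not> K \<subseteq> range rat_mat"
  proof
    assume "K \<subseteq> range rat_mat"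
    then have "K \<subseteq> qmat.span {mat 1}"
      by (simp add: qmat.span_singleton rat)
    then have "qmat.span K = qmat.span {mat 1}"
      using K_closed(2) by (intro equalityI qmat.span_minimal qmat.span_mono) (auto simp: qmat.subspace_span)
    then have "qmat.dim K = card {mat 1 :: complex^'g^'g}"
      by (rule qmat.dim_eq_card[OF _ ind1, OF sym])
    then show False using dim by simp
  qed
  then obtain x where x: "x \<in> K" "x \<notin> range rat_mat" by blast
  have "x \<notin> qmat.span {mat 1}"
    using x(2) by (auto simp: qmat.span_singleton rat)
  then have ind: "qmat.independent {x, mat 1}" and ne': "x \<noteq> mat 1"
    using ind1 by (auto simp: qmat.independent_insert qmat.span_base)
  obtain B where B: "{x, mat 1} \<subseteq> B" "B \<subseteq> K" "qmat.independent B" "K \<subseteq> qmat.span B"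
    using qmat.maximal_independent_subset_extend[of "{x, mat 1}" K] ind x(1) K_closed(2) by auto
  have "card B = 2" using qmat.basis_card_eq_dim[OF B(2,4,3)] dim by simp
  then have "finite B" by (metis card.infinite zero_neq_numeral)
  then have "B = {x, mat 1}"
    using B(1) \<open>card B = 2\<close> ne' by (metis card_2_iff card_subset_eq card_2_iff')
  then have Kspan: "\<exists>a b. y = qscaleR a (mat 1) + qscaleR b x" if "y \<in> K" for y
    using B(4) that by (fastforce simp: qmat.span_insert qmat.span_singleton diff_eq_eq add.commute)
  note Kint = subring_scale_int[OF L subfieldE(1)[OF sub]]
  have denom: "\<exists>k a' b' :: int. k \<noteq> 0 \<and> real_of_int k * real_of_rat a = real_of_int a' \<and>
      real_of_int k * real_of_rat b = real_of_int b'" for a b :: rat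
  proof -
    have "\<exists>k::nat. k > 0 \<and> (\<forall>i\<in>{real_of_rat a, real_of_rat b}. real k * i \<in> \<int>)"
      by (rule common_denominator) auto
    then obtain k :: nat where "k > 0" "real k * real_of_rat a \<in> \<int>" "real k * real_of_rat b \<in> \<int>"
      by auto
    moreover from this obtain a' b' where "real k * real_of_rat a = real_of_int a'"
        "real k * real_of_rat b = real_of_int b'" by (metis Ints_cases)
    ultimately show ?thesis by (intro exI[of _ "int k"] exI[of _ a'] exI[of _ b']) simp
  qed
  obtain a b where ab: "x ** x = qscaleR a (mat 1) + qscaleR b x"
    using Kspan K_closed(5)[OF x(1) x(1)] by blast
  obtain k a' b' :: int where k: "k \<noteq> 0" "real_of_int k * real_of_rat a = real_of_int a'"
      "real_of_int k * real_of_rat b = real_of_int b'" using denom by blast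
  define \<kappa> where "\<kappa> = real_of_int (2 * k) *\<^sub>R x - real_of_int b' *\<^sub>R mat 1"
  have \<kappa>K: "\<kappa> \<in> K"
    using K_closed(4)[OF Kint[OF x(1), of "2 * k"] K_closed(6)[OF Kint[OF K_closed(2), of b']]]
    by (simp add: \<kappa>_def)
  have xx: "x *v (x *v u) = real_of_rat a *\<^sub>R u + real_of_rat b *\<^sub>R (x *v u)" for u
    using arg_cong[OF ab, of "\<lambda>m. m *v u"]
    by (simp add: matrix_vector_mul_assoc matrix_vector_mult_add_rdistrib qscaleR_def scaleR_mult_vec)
  have \<kappa>v: "\<kappa> *v u = real_of_int (2 * k) *\<^sub>R (x *v u) - real_of_int b' *\<^sub>R u" for u
    by (simp add: \<kappa>_def matrix_vector_mult_diff_rdistrib scaleR_mult_vec)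
  have "\<kappa> *v (\<kappa> *v u) = real_of_int (4 * k * a' + b' * b') *\<^sub>R u" for u
  proof -
    have "\<kappa> *v (\<kappa> *v u) = (4 * real_of_int k * (real_of_int k * real_of_rat a)) *\<^sub>R u
        + (4 * real_of_int k * (real_of_int k * real_of_rat b)) *\<^sub>R (x *v u)
        - (4 * real_of_int k * real_of_int b') *\<^sub>R (x *v u) + real_of_int (b' * b') *\<^sub>R u"
      unfolding \<kappa>v matrix_vector_mult_diff_distrib mult_vec_scaleR xx
      by (simp add: vec_eq_iff scaleR_conv_of_real algebra_simps)
    then show ?thesis unfolding k(2,3) by (simp add: vec_eq_iff scaleR_conv_of_real algebra_simps)
  qed
  then have \<kappa>\<kappa>: "\<kappa> ** \<kappa> = rat_mat (of_int (4 * k * a' + b' * b'))"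
    by (simp add: matrix_eq rat_mat_mult_vec of_rat_add of_rat_mult flip: matrix_vector_mul_assoc)
  have x\<kappa>: "real_of_int (2 * k) *\<^sub>R x = real_of_int b' *\<^sub>R mat 1 + \<kappa>" by (simp add: \<kappa>_def)
  have "\<kappa> \<notin> range rat_mat"
  proof
    assume "\<kappa> \<in> range rat_mat"
    then obtain q where q: "\<kappa> = rat_mat q" by blast
    have "x = rat_mat ((q + of_int b') / of_int (2 * k))"
    proof -
      have "x *v u = real_of_rat ((q + of_int b') / of_int (2 * k)) *\<^sub>R u" for u
      proof -
        have "real_of_int (2 * k) *\<^sub>R (x *v u) = (real_of_rat q + real_of_int b') *\<^sub>R u"
          using \<kappa>v[of u] by (simp add: q rat_mat_mult_vec scaleR_add_left)
        then have "((real_of_rat q + real_of_int b') / real_of_int (2 * k)) *\<^sub>R u = x *v u"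
          unfolding vector_fraction_eq_iff using k(1) by simp
        then show ?thesis by (simp add: of_rat_divide of_rat_add of_rat_mult)
      qed
      then show ?thesis by (simp add: matrix_eq rat_mat_mult_vec)
    qed
    then show False using x(2) by blast
  qed
  moreover have "\<exists>k a b :: int. k \<noteq> 0 \<and>
        real_of_int k *\<^sub>R y = real_of_int a *\<^sub>R mat 1 + real_of_int b *\<^sub>R \<kappa>" if y: "y \<in> K" for y
  proof -
    obtain c d where cd: "y = qscaleR c (mat 1) + qscaleR d x" using Kspan[OF y] by blast
    obtain l c' d' :: int where l: "l \<noteq> 0" "real_of_int l * real_of_rat c = real_of_int c'"
      "real_of_int l * real_of_rat d = real_of_int d'" using denom by blast
    have "real_of_int (2 * k * l) *\<^sub>R y = real_of_int (2 * k) *\<^sub>R (real_of_int l *\<^sub>R y)" by simp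
    also have "real_of_int l *\<^sub>R y = real_of_int c' *\<^sub>R mat 1 + real_of_int d' *\<^sub>R x"
      by (simp add: cd qscaleR_def scaleR_add_right l)
    also have "real_of_int (2 * k) *\<^sub>R \<dots> = real_of_int (2 * k * c') *\<^sub>R mat 1 +
        real_of_int d' *\<^sub>R (real_of_int (2 * k) *\<^sub>R x)"
      by (simp add: scaleR_add_right mult.commute)
    also have "\<dots> = real_of_int (2 * k * c' + d' * b') *\<^sub>R mat 1 + real_of_int d' *\<^sub>R \<kappa>"
      unfolding x\<kappa> by (simp add: scaleR_add_right scaleR_add_left)
    finally show ?thesis using k(1) l(1)
      by (intro exI[of _ "2 * k * l"] exI[of _ "2 * k * c' + d' * b'"] exI[of _ d']) simp
  qed
  ultimately show thesis using that \<kappa>K \<kappa>\<kappa> by blast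
qed

text \<open>
  The form \<open>E (s1 u) (s2 v)\<close> on \<open>B\<close> is rational and invariant under \<open>\<i>\<close>, so it is \<open>E\<^sub>B (X u) v\<close> for some
  \<open>X \<in> End(B) \<otimes> \<rat>\<close>. As \<open>X\<close> commutes with \<open>c\<close>, skewness of \<open>c\<close> passes from \<open>E\<^sub>B\<close> to this form.
\<close>

lemma skew_pullback:
  fixes A :: "(complex^'g::finite) set" and B :: "(complex^'h::finite) set"
    and s1 s2 :: "complex^'h^'g" and c :: "complex^'h^'h"
  assumes A: "torus_lattice A" "polarization A E" and B: "torus_lattice B" "polarization B E\<^sub>B"
    and s: "quasi_hom B A s1" "quasi_hom B A s2"
    and c: "skew E\<^sub>B c" and comm: "\<And>x. quasi_hom B B x \<Longrightarrow> x ** c = c ** x"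
  shows "E (s1 *v (c *v u)) (s2 *v v) = - E (s1 *v u) (s2 *v (c *v v))"
proof -
  note left = polarization_linear_left[OF A(2)] and right = polarization_linear_right[OF A(2)]
  define G where "G u v = E (s1 *v u) (s2 *v v)" for u v
  have "bilinear G"
    unfolding bilinear_def G_def
    using linear_compose[OF linear_mult_vec[of s1] left] linear_compose[OF linear_mult_vec[of s2] right]
    by (simp add: comp_def)
  moreover have "G u v \<in> \<rat>" if "u \<in> B" "v \<in> B" for u v
  proof -
    obtain k :: nat where k: "k > 0" "\<And>v. v \<in> B \<Longrightarrow> real k *\<^sub>R (s1 *v v) \<in> A"
      by (rule quasi_homE[OF s(1)]) blast
    obtain l :: nat where l: "l > 0" "\<And>v. v \<in> B \<Longrightarrow> real l *\<^sub>R (s2 *v v) \<in> A"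
      by (rule quasi_homE[OF s(2)]) blast
    have "E (real k *\<^sub>R (s1 *v u)) (real l *\<^sub>R (s2 *v v)) \<in> \<int>"
      by (intro polarization_integral[OF A(2)] k l that)
    then have "E (real k *\<^sub>R (s1 *v u)) (real l *\<^sub>R (s2 *v v)) \<in> \<rat>"
      using Ints_subset_Rats by blast
    then have "real k * (real l * G u v) \<in> \<rat>"
      by (simp add: G_def linear_scale[OF left] linear_scale[OF right] mult.left_commute)
    then have "inverse (real k) * (inverse (real l) * (real k * (real l * G u v))) \<in> \<rat>"
      by (intro Rats_mult[OF Rats_inverse[OF Rats_of_nat]])
    also have "inverse (real k) * (inverse (real l) * (real k * (real l * G u v))) = G u v"
      using k(1) l(1) by (simp add: field_simps)
    finally show ?thesis .
  qed
  moreover have "G (\<i> *s u) (\<i> *s v) = G u v" for u v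
    by (simp add: G_def mult_vec_smult polarization_i_i[OF A(2)])
  ultimately obtain X where X: "quasi_hom B B X" "\<And>u v. G u v = E\<^sub>B (X *v u) v"
    using rational_form_representation[OF B] by blast
  have "G (c *v u) v = E\<^sub>B (c *v (X *v u)) v"
    using comm[OF X(1)] by (simp add: X(2) matrix_vector_mul_assoc)
  also have "\<dots> = - G u (c *v v)" using c by (simp add: X(2) skew_def)
  finally show ?thesis by (simp add: G_def)
qed

text \<open>
  The element \<open>d\<close> is the scalar matrix \<open>c\<close> in the algebra of \<open>2 \<times> 2\<close> matrices over \<open>End(B) \<otimes> \<rat>\<close>, which is
  central because \<open>End(B) \<otimes> \<rat>\<close> is commutative. It is skew for every polarization of \<open>A\<close>, since each of the
  four blocks of the polarization is a form to which \<open>skew_pullback\<close> applies.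
\<close>

lemma central_skew_endomorphism:
  fixes A :: "(complex^'g::finite) set" and B :: "(complex^'h::finite) set"
  assumes A: "torus_lattice A" "polarization A E" and B: "torus_lattice B" "polarization B E\<^sub>B"
    and isog: "isogenous A (square_torus B)"
    and comm: "\<And>x y. quasi_hom B B x \<Longrightarrow> quasi_hom B B y \<Longrightarrow> x ** y = y ** x"
    and c: "quasi_hom B B c" "skew E\<^sub>B c" "c ** c = rat_mat r"
  obtains d where "quasi_hom A A d" "skew E d" "d ** d = rat_mat r"
    "\<forall>x. quasi_hom A A x \<longrightarrow> x ** d = d ** x"
proof -
  obtain p1 p2 :: "complex^'g^'h" and s1 s2 :: "complex^'h^'g" where
    p: "quasi_hom A B p1" "quasi_hom A B p2" and s: "quasi_hom B A s1" "quasi_hom B A s2"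
    and ps: "p1 ** s1 = mat 1" "p1 ** s2 = 0" "p2 ** s1 = 0" "p2 ** s2 = mat 1"
    and sp: "s1 ** p1 + s2 ** p2 = mat 1"
    by (rule isogenous_square_splitting[OF A(1) B(1) isog])
  note left = polarization_linear_left[OF A(2)] and right = polarization_linear_right[OF A(2)]
  have psv: "p1 *v (s1 *v y) = y" "p1 *v (s2 *v y) = 0" "p2 *v (s1 *v y) = 0" "p2 *v (s2 *v y) = y" for y
    by (simp_all add: matrix_vector_mul_assoc ps)
  have spv: "s1 *v (p1 *v u) + s2 *v (p2 *v u) = u" for u
    using arg_cong[OF sp, of "\<lambda>m. m *v u"] by (simp add: matrix_vector_mult_add_rdistrib matrix_vector_mul_assoc)
  define d where "d = s1 ** c ** p1 + s2 ** c ** p2"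
  have dv: "d *v u = s1 *v (c *v (p1 *v u)) + s2 *v (c *v (p2 *v u))" for u
    by (simp add: d_def matrix_vector_mult_add_rdistrib flip: matrix_vector_mul_assoc)
  have "quasi_hom A A d"
    unfolding d_def
    by (rule quasi_hom_add[OF A(1) A(1)]
        quasi_hom_compose[OF A(1) A(1) p(1) quasi_hom_compose[OF B(1) A(1) c(1) s(1)]]
        quasi_hom_compose[OF A(1) A(1) p(2) quasi_hom_compose[OF B(1) A(1) c(1) s(2)]])+
  moreover have "skew E d"
    unfolding skew_def
  proof (intro allI)
    fix u v
    have sk: "E (si *v (c *v x)) (sj *v y) = - E (si *v x) (sj *v (c *v y))"
      if "si \<in> {s1, s2}" "sj \<in> {s1, s2}" for si sj x y
      by (rule skew_pullback[OF A B _ _ c(2)]) (use s that comm[OF _ c(1)] in auto)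
    have "E (d *v u) v = E (d *v u) (s1 *v (p1 *v v) + s2 *v (p2 *v v))" by (simp add: spv)
    also have "\<dots> = - E (s1 *v (p1 *v u) + s2 *v (p2 *v u)) (d *v v)"
      by (simp add: dv linear_add[OF left] linear_add[OF right] sk)
    finally show "E (d *v u) v = - E u (d *v v)" by (simp add: spv)
  qed
  moreover have "d ** d = rat_mat r"
  proof -
    have cc: "c *v (c *v y) = real_of_rat r *\<^sub>R y" for y
      using c(3) by (simp add: matrix_vector_mul_assoc rat_mat_mult_vec)
    have "d *v (d *v u) = real_of_rat r *\<^sub>R (s1 *v (p1 *v u) + s2 *v (p2 *v u))" for u
      by (simp add: dv matrix_vector_right_distrib psv cc mult_vec_scaleR scaleR_add_right)
    then show ?thesis
      by (simp add: matrix_eq rat_mat_mult_vec spv flip: matrix_vector_mul_assoc)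
  qed
  moreover have "\<forall>x. quasi_hom A A x \<longrightarrow> x ** d = d ** x"
  proof (intro allI impI)
    fix x assume x: "quasi_hom A A x"
    have cx: "p *v (x *v (t *v (c *v y))) = c *v (p *v (x *v (t *v y)))"
      if "p \<in> {p1, p2}" "t \<in> {s1, s2}" for p t y
    proof -
      have pt: "quasi_hom A B p" "quasi_hom B A t" using that p s by auto
      have "quasi_hom B B (p ** x ** t)"
        by (rule quasi_hom_compose[OF B(1) B(1) pt(2) quasi_hom_compose[OF A(1) B(1) x pt(1)]])
      then have "(p ** x ** t) ** c = c ** (p ** x ** t)" by (rule comm[OF _ c(1)])
      then have "((p ** x ** t) ** c) *v y = (c ** (p ** x ** t)) *v y" by simp
      then show ?thesis by (simp flip: matrix_vector_mul_assoc)
    qed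
    have "x *v (d *v u) = d *v (x *v u)" for u
    proof -
      have xu: "x *v u = x *v (s1 *v (p1 *v u)) + x *v (s2 *v (p2 *v u))"
        using arg_cong[OF spv[of u], of "\<lambda>w. x *v w"] by (simp add: matrix_vector_right_distrib)
      have "d *v (x *v u) = s1 *v (p1 *v (x *v (d *v u))) + s2 *v (p2 *v (x *v (d *v u)))"
        unfolding dv[of "x *v u"] unfolding xu
        by (simp add: dv[of u] matrix_vector_right_distrib cx add.assoc)
      then show ?thesis by (simp add: spv)
    qed
    then show "x ** d = d ** x" by (simp add: matrix_eq flip: matrix_vector_mul_assoc)
  qed
  ultimately show thesis by (rule that)
qed

text \<open>
  With adjoints \<open>- \<kappa>\<close> and \<open>t - x\<close>, the adjoint of the commutator is
  \<open>(t - x) (- \<kappa>) - (- \<kappa>) (t - x) = x \<kappa> - \<kappa> x\<close>.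
\<close>

lemma skew_commutator:
  assumes pol: "polarization L E" and \<kappa>: "skew E \<kappa>"
    and x: "\<And>u v. E (x *v u) v + E u (x *v v) = real_of_rat t * E u v"
  shows "skew E (\<kappa> ** x - x ** \<kappa>)"
  unfolding skew_def
proof (intro allI)
  fix u v
  note left = polarization_linear_left[OF pol] and right = polarization_linear_right[OF pol]
  have \<kappa>': "E (\<kappa> *v a) b = - E a (\<kappa> *v b)" for a b using \<kappa> by (simp add: skew_def)
  have x': "E (x *v a) b = real_of_rat t * E a b - E a (x *v b)" for a b using x[of a b] by simp
  show "E ((\<kappa> ** x - x ** \<kappa>) *v u) v = - E u ((\<kappa> ** x - x ** \<kappa>) *v v)"
    by (simp add: matrix_vector_mult_diff_rdistrib linear_diff[OF left] linear_diff[OF right] \<kappa>' x'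
        right_diff_distrib flip: matrix_vector_mul_assoc)
qed


section \<open>Divisor classes\<close>

lemma cup_1_2:
  "cup 1 2 \<phi> v = \<phi> 0 (\<lambda>j. v j) * \<phi> 1 (\<lambda>j. v (1 + j)) -
     \<phi> 0 (\<lambda>j. v (Transposition.transpose 0 1 j)) * \<phi> 1 (\<lambda>j. v (Transposition.transpose 0 1 (1 + j)))"
proof -
  have "{..<1 * 2} = {0, 1::nat}" by auto
  then have S: "{\<pi>. \<pi> permutes {..<1 * 2::nat}} = {id, Transposition.transpose 0 1}"
    by (simp only: permutes_doubleton_iff) auto
  have "id \<noteq> Transposition.transpose 0 (1::nat)"
    by (metis id_apply transpose_apply_first zero_neq_one)
  moreover have "{..<2} = {0, 1::nat}" by auto
  ultimately show ?thesis
    unfolding cup_def S by (simp add: sign_swap_id)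
qed

lemma sum_form_apply: "(\<Sum>i\<in>S. f i) v = (\<Sum>i\<in>S. f i v)" for f :: "'i \<Rightarrow> 'v form"
  by (induction S rule: infinite_finite_induct) auto


text \<open>
  Invariance under \<open>\<i>\<close> means that \<open>G\<close> is the imaginary part of the Hermitian form
  \<open>h u v = G (\<i> u) v + \<i> G u v\<close>. Expanding \<open>h\<close> in coordinates and antisymmetrizing writes \<open>G\<close> as a
  combination of the products \<open>dz\<^sub>a \<and> dz\<bar>\<^sub>b\<close>.
\<close>

lemma invariant_form_in_H_11:
  fixes G :: "complex^'g::finite \<Rightarrow> complex^'g \<Rightarrow> real"
  assumes G: "bilinear G" "\<And>u. G u u = 0" "\<And>u v. G (\<i> *s u) (\<i> *s v) = G u v"
  shows "(\<lambda>v. of_real (G (v 0) (v 1))) \<in> H_11"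
proof -
  have left: "linear (\<lambda>u. G u v)" and right: "linear (\<lambda>v. G u v)" for u v
    using G(1) by (auto simp: bilinear_def)
  have anti: "G u v = - G v u" for u v
  proof -
    have "G (u + v) (u + v) = G v u + G u v"
      unfolding linear_add[OF left] linear_add[OF right] by (simp add: G(2))
    with G(2)[of "u + v"] have "G v u + G u v = 0" by metis
    then show ?thesis by simp
  qed
  have i: "G u (\<i> *s v) = - G (\<i> *s u) v" for u v
    using G(3)[of u "\<i> *s v"] linear_neg[OF right] by (simp add: i_i_vec)
  define h where "h u v = Complex (G (\<i> *s u) v) (G u v)" for u v
  have h_swap: "h v u = cnj (h u v)" for u v
    using anti[of v u] anti[of "\<i> *s v" u] i[of u v] by (simp add: h_def complex_eq_iff)
  have h_add: "h (u + u') v = h u v + h u' v" for u u' v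
    by (simp add: h_def complex_eq_iff linear_add[OF left] vector_add_ldistrib)
  have h_scale: "h (c *s u) v = c * h u v" for c u v
  proof -
    have comm: "\<i> *s (c *s u) = c *s (\<i> *s u)" by (simp add: vec_eq_iff)
    show ?thesis
      unfolding h_def comm unfolding smult_decomposition[of c]
      by (simp add: complex_eq_iff linear_add[OF left] linear_scale[OF left] i_i_vec linear_neg[OF left] linear_diff[OF left])
  qed
  have h_sum: "h (\<Sum>a\<in>S. f a) v = (\<Sum>a\<in>S. h (f a) v)" for S :: "'g set" and f v
  proof (induction S rule: infinite_finite_induct)
    case empty
    show ?case using h_scale[of 0 0 v] by simp
  next
    case (infinite S)
    then show ?case using h_scale[of 0 0 v] by simp
  qed (simp_all add: h_add)
  define e :: "'g \<Rightarrow> complex^'g" where "e a = axis a 1" for a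
  have left_expand: "h u v = (\<Sum>a\<in>UNIV. u $ a * h (e a) v)" for u v
    using h_sum[of "\<lambda>a. u $ a *s e a" UNIV v] basis_expansion[of u] by (simp add: h_scale e_def)
  have expand: "h u v = (\<Sum>a\<in>UNIV. \<Sum>b\<in>UNIV. h (e a) (e b) * (u $ a * cnj (v $ b)))" for u v
  proof -
    have "h (e a) v = (\<Sum>b\<in>UNIV. h (e a) (e b) * cnj (v $ b))" for a
      using arg_cong[OF left_expand[of v "e a"], of cnj]
      by (simp add: h_swap[of _ "e a", symmetric] mult.commute cnj_sum)
         (simp add: h_swap[of "e a"])
    then show ?thesis
      by (subst left_expand) (simp add: sum_distrib_left mult.left_commute mult.assoc)
  qed
  define dz :: "'g \<Rightarrow> (complex^'g) form" where "dz a = (\<lambda>v. v 0 $ a)" for a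
  define dzb :: "'g \<Rightarrow> (complex^'g) form" where "dzb a = (\<lambda>v. cnj (v 0 $ a))" for a
  have dz: "dz a \<in> H_10" for a
    by (auto simp: H_10_def dz_def linear_iff scaleR_conv_of_real[where 'a = complex] intro!: H_complexI)
  have dzb: "dzb a \<in> H_01" for a
    by (auto simp: H_01_def dzb_def linear_iff scaleR_conv_of_real[where 'a = complex] intro!: H_complexI)
  define \<psi> where "\<psi> a b = (\<lambda>i::nat. if i = 0 then dz a else dzb b)" for a b
  have \<psi>: "cup 1 2 (\<psi> a b) v = v 0 $ a * cnj (v 1 $ b) - v 1 $ a * cnj (v 0 $ b)" for a b v
    unfolding cup_1_2 by (simp add: \<psi>_def dz_def dzb_def)
  have "(\<lambda>v. of_real (G (v 0) (v 1))) =
      (\<Sum>a\<in>UNIV. \<Sum>b\<in>UNIV. cscale (h (e a) (e b) / (2 * \<i>)) (cup 1 2 (\<psi> a b)))"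
  proof
    fix v :: "nat \<Rightarrow> complex^'g"
    have "of_real (G (v 0) (v 1)) = (h (v 0) (v 1) - h (v 1) (v 0)) / (2 * \<i>)"
      unfolding h_swap[of "v 1"] by (simp add: h_def complex_eq_iff)
    also have "\<dots> = (\<Sum>a\<in>UNIV. \<Sum>b\<in>UNIV. h (e a) (e b) / (2 * \<i>) * cup 1 2 (\<psi> a b) v)"
      unfolding expand[of "v 0" "v 1"] expand[of "v 1" "v 0"] \<psi>
      by (simp add: sum_subtractf right_diff_distrib diff_divide_distrib sum_divide_distrib
          sum_distrib_left mult.assoc)
    finally show "of_real (G (v 0) (v 1)) =
        (\<Sum>a\<in>UNIV. \<Sum>b\<in>UNIV. cscale (h (e a) (e b) / (2 * \<i>)) (cup 1 2 (\<psi> a b))) v"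
      by (simp add: sum_form_apply cscale_def)
  qed
  also have "\<dots> \<in> H_11"
    unfolding H_11_def
  proof (intro cform.span_sum cform.span_scale cform.span_base)
    fix a b
    have "\<psi> a b 0 \<in> H_10" "\<psi> a b 1 \<in> H_01" using dz dzb by (auto simp: \<psi>_def)
    then show "cup 1 2 (\<psi> a b) \<in> {cup 1 2 \<phi> | \<phi>. \<phi> 0 \<in> H_10 \<and> \<phi> 1 \<in> H_01}" by blast
  qed
  finally show ?thesis .
qed

lemma self_adjoint_divisor_class:
  fixes L :: "(complex^'g::finite) set"
  assumes pol: "polarization L E" and x: "quasi_hom L L x"
    and sym: "\<And>u v. E (x *v u) v = E u (x *v v)"
  shows "(\<lambda>v. of_real (E (x *v v 0) (v 1))) \<in> divisor_classes L"
proof -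
  note left = polarization_linear_left[OF pol] and right = polarization_linear_right[OF pol]
  define G where "G u v = E (x *v u) v" for u v
  have lin: "linear (\<lambda>u. G u v)" "linear (\<lambda>v. G u v)" for u v
    unfolding G_def using linear_compose[OF linear_mult_vec[of x] left] right by (simp_all add: comp_def)
  have alt: "G u u = 0" for u
    using sym[of u u] polarization_antisym[OF pol, of u "x *v u"] by (simp add: G_def)
  let ?D = "\<lambda>v. of_real (G (v 0) (v 1)) :: complex"
  have "?D \<in> H_complex 2"
  proof (rule H_complexI)
    fix i and v :: "nat \<Rightarrow> complex^'g" assume "i < (2::nat)"
    then have "i = 0 \<or> i = 1" by auto
    then show "linear (\<lambda>u. ?D (v(i := u)))"
      by (auto simp: linear_iff linear_add[OF lin(1)] linear_add[OF lin(2)]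
          linear_scale[OF lin(1)] linear_scale[OF lin(2)] scaleR_conv_of_real[where 'a = complex])
  next
    fix v :: "nat \<Rightarrow> complex^'g" and i j :: nat assume "i < j" "j < 2" "v i = v j"
    then have "i = 0" "j = 1" by auto
    then show "?D v = 0" using \<open>v i = v j\<close> alt by simp
  qed auto
  moreover have "?D v \<in> \<rat>" if "\<And>i. i < (2::nat) \<Longrightarrow> v i \<in> L" for v
  proof -
    obtain k :: nat where k: "k > 0" "\<And>v. v \<in> L \<Longrightarrow> real k *\<^sub>R (x *v v) \<in> L"
      by (rule quasi_homE[OF x]) blast
    have "E (real k *\<^sub>R (x *v v 0)) (v 1) \<in> \<int>"
      using that by (intro polarization_integral[OF pol] k) auto
    then obtain z where "real k * G (v 0) (v 1) = real_of_int z"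
      by (auto simp: G_def linear_scale[OF left] elim: Ints_cases)
    then have "G (v 0) (v 1) = real_of_int z / real k" using k(1) by (simp add: field_simps)
    then have "?D v = of_int z / of_nat k" by simp
    then show ?thesis by (simp only: Rats_divide Rats_of_int Rats_of_nat)
  qed
  moreover have "?D \<in> H_11"
  proof (rule invariant_form_in_H_11)
    show "bilinear G" using lin by (simp add: bilinear_def)
    show "G (\<i> *s u) (\<i> *s v) = G u v" for u v
      by (simp add: G_def mult_vec_smult polarization_i_i[OF pol])
  qed (rule alt)
  ultimately show ?thesis by (simp add: divisor_classes_def H_rat_def G_def)
qed

lemma pullback_H_complex: "\<alpha> \<in> H_complex k \<Longrightarrow> pullback x \<alpha> \<in> H_complex k"
  for \<alpha> :: "(complex^'g::finite) form"
proof (rule H_complexI)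
  assume \<alpha>: "\<alpha> \<in> H_complex k"
  show "pullback x \<alpha> v = pullback x \<alpha> w" if "\<And>i. i < k \<Longrightarrow> v i = w i" for v w
    unfolding pullback_def by (rule H_complex_cong[OF \<alpha>]) (simp add: that)
  show "linear (\<lambda>u. pullback x \<alpha> (v(i := u)))" if "i < k" for i v
  proof -
    have "(\<lambda>j. x *v (v(i := u)) j) = (\<lambda>j. x *v v j)(i := x *v u)" for u by auto
    then show ?thesis
      using linear_compose[OF linear_mult_vec[of x] H_complex_linear[OF \<alpha> that, of "\<lambda>j. x *v v j"]]
      by (simp add: pullback_def comp_def del: fun_upd_apply)
  qed
  show "pullback x \<alpha> v = 0" if "i < j" "j < k" "v i = v j" for v i j
    unfolding pullback_def by (rule H_complex_alternating[OF \<alpha>, of i j]) (use that in auto)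
qed

lemma H_complex_scaled:
  assumes \<alpha>: "\<alpha> \<in> H_complex k"
  shows "\<alpha> (\<lambda>i. r *\<^sub>R v i) = of_real r ^ k * \<alpha> v"
proof -
  have "\<alpha> (\<lambda>i. if i < m then r *\<^sub>R v i else v i) = of_real r ^ m * \<alpha> v" if "m \<le> k" for m
    using that
  proof (induction m)
    case 0
    show ?case by simp
  next
    case (Suc m)
    let ?w = "\<lambda>i. if i < m then r *\<^sub>R v i else v i"
    have lin: "linear (\<lambda>u. \<alpha> (?w(m := u)))" using Suc.prems by (intro H_complex_linear[OF \<alpha>]) simp
    have "(\<lambda>i. if i < Suc m then r *\<^sub>R v i else v i) = ?w(m := r *\<^sub>R v m)" by auto
    then have "\<alpha> (\<lambda>i. if i < Suc m then r *\<^sub>R v i else v i) = r *\<^sub>R \<alpha> (?w(m := v m))"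
      using linear_scale[OF lin] by simp
    also have "?w(m := v m) = ?w" by auto
    finally show ?case using Suc by (simp add: scaleR_conv_of_real)
  qed
  from this[of k] have "\<alpha> (\<lambda>i. if i < k then r *\<^sub>R v i else v i) = of_real r ^ k * \<alpha> v" by simp
  moreover have "\<alpha> (\<lambda>i. r *\<^sub>R v i) = \<alpha> (\<lambda>i. if i < k then r *\<^sub>R v i else v i)"
    by (rule H_complex_cong[OF \<alpha>]) auto
  ultimately show ?thesis by simp
qed

lemma pullback_H_rat:
  assumes x: "quasi_hom L L x" and \<alpha>: "\<alpha> \<in> H_rat L k"
  shows "pullback x \<alpha> \<in> H_rat L k"
proof -
  obtain m :: nat where m: "m > 0" "\<And>v. v \<in> L \<Longrightarrow> real m *\<^sub>R (x *v v) \<in> L"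
    by (rule quasi_homE[OF x]) blast
  have "pullback x \<alpha> v \<in> \<rat>" if "\<And>i. i < k \<Longrightarrow> v i \<in> L" for v
  proof -
    have "\<alpha> (\<lambda>i. real m *\<^sub>R (x *v v i)) \<in> \<rat>"
      using that by (intro H_rat_values[OF \<alpha>] m)
    then have "of_nat (m ^ k) * pullback x \<alpha> v \<in> \<rat>"
      by (simp add: H_complex_scaled[OF H_ratD[OF \<alpha>]] pullback_def)
    then have "of_nat (m ^ k) * pullback x \<alpha> v / of_nat (m ^ k) \<in> \<rat>"
      by (rule Rats_divide[OF _ Rats_of_nat])
    also have "of_nat (m ^ k) * pullback x \<alpha> v / of_nat (m ^ k) = pullback x \<alpha> v" using m(1) by simp
    finally show ?thesis .
  qed
  then show ?thesis using pullback_H_complex[OF H_ratD[OF \<alpha>]] by (auto simp: H_rat_def)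
qed

lemma pullback_add: "pullback x (\<alpha> + \<beta>) = pullback x \<alpha> + pullback x \<beta>"
  and pullback_cscale: "pullback x (cscale c \<alpha>) = cscale c (pullback x \<alpha>)"
  and pullback_qscale: "pullback x (qscale q \<alpha>) = qscale q (pullback x \<alpha>)"
  and pullback_0: "pullback x 0 = 0"
  by (auto simp: pullback_def cscale_def qscale_def)

lemma pullback_cup: "pullback x (cup d n \<alpha>) = cup d n (\<lambda>i. pullback x (\<alpha> i))"
  by (simp add: pullback_def cup_def)

lemma pullback_H_11:
  assumes "\<alpha> \<in> H_11" shows "pullback x \<alpha> \<in> H_11"
  using assms unfolding H_11_def
proof (induction rule: cform.span_induct_alt)
  case base
  then show ?case unfolding pullback_0 by (simp only: cform.span_zero)
next
  case (step c \<alpha> \<beta>)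
  then obtain \<phi> where \<phi>: "\<alpha> = cup 1 2 \<phi>" "\<phi> 0 \<in> H_10" "\<phi> 1 \<in> H_01" by blast
  have e: "x *v (\<i> *s u) = \<i> *s (x *v u)" for u by (rule mult_vec_smult)
  have "pullback x (\<phi> 0) \<in> H_10" "pullback x (\<phi> 1) \<in> H_01"
    using \<phi>(2,3) pullback_H_complex[of _ 1 x] unfolding H_10_def H_01_def
    by (auto simp: pullback_def e)
  then have "pullback x \<alpha> \<in> {cup 1 2 \<phi> | \<phi>. \<phi> 0 \<in> H_10 \<and> \<phi> 1 \<in> H_01}"
    unfolding \<phi>(1) pullback_cup by (intro CollectI exI[of _ "\<lambda>i. pullback x (\<phi> i)"]) auto
  then show ?case
    unfolding pullback_add pullback_cscale
    by (rule cform.span_add[OF cform.span_scale[OF cform.span_base] step.IH])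
qed

lemma pullback_divisor_products:
  assumes x: "quasi_hom L L x" and \<alpha>: "\<alpha> \<in> qform.span (divisor_products L n)"
  shows "pullback x \<alpha> \<in> qform.span (divisor_products L n)"
  using \<alpha>
proof (induction rule: qform.span_induct_alt)
  case base
  then show ?case unfolding pullback_0 by (simp only: qform.span_zero)
next
  case (step c \<alpha> \<beta>)
  then obtain D where D: "\<alpha> = cup 2 n D" "\<And>i. i < n \<Longrightarrow> D i \<in> divisor_classes L"
    by (auto simp: divisor_products_def)
  have "pullback x \<alpha> \<in> divisor_products L n"
    unfolding divisor_products_def D(1) pullback_cup
    using D(2) pullback_H_rat[OF x]
    by (intro CollectI exI[of _ "\<lambda>i. pullback x (D i)"]) (auto simp: divisor_classes_def intro: pullback_H_11)
  then show ?case
    unfolding pullback_add pullback_qscale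
    by (rule qform.span_add[OF qform.span_scale[OF qform.span_base] step.IH])
qed

lemma divisor_products_H_rat: "divisor_products L n \<subseteq> H_rat L (2 * n)"
  unfolding divisor_products_def by (auto simp: divisor_classes_def intro!: cup_in_H_rat)


section \<open>Descent from complex to rational coefficients\<close>

lemma rational_projection:
  obtains l :: "complex \<Rightarrow> rat" where "\<And>x y. l (x + y) = l x + l y" "\<And>q x. l (of_rat q * x) = q * l x" "l 1 = 1"
proof -
  interpret vector_space_pair "\<lambda>q z. of_rat q * z :: complex" "(*) :: rat \<Rightarrow> rat \<Rightarrow> rat"
    by unfold_locales (simp_all add: algebra_simps of_rat_add of_rat_mult)
  have "vs1.independent {1}" by simp
  then obtain l where l: "Vector_Spaces.linear (\<lambda>q z. of_rat q * z :: complex) (*) l" "\<forall>x\<in>{1}. l x = 1"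
    using linear_independent_extend[of "{1}" "\<lambda>_. 1"] by blast
  show thesis
    by (rule that[of l]) (use l linear_add[OF l(1)] linear_scale[OF l(1)] in auto)
qed

text \<open>
  A \<open>\<rat>\<close>-linear projection \<open>l\<close> from \<open>\<complex>\<close> to \<open>\<rat>\<close> fixes the values of \<open>\<alpha>\<close> on the lattice. Applied to a
  complex combination of rational forms, it replaces each coefficient \<open>c\<close> by the rational number \<open>l c\<close>
  on lattice vectors, and forms that agree there are equal.
\<close>

lemma rational_descent:
  fixes L :: "(complex^'g::finite) set"
  assumes L: "torus_lattice L" and S: "S \<subseteq> H_rat L k"
    and \<alpha>: "\<alpha> \<in> H_rat L k" "\<alpha> \<in> cform.span S"
  shows "\<alpha> \<in> qform.span S"
proof -
  obtain l :: "complex \<Rightarrow> rat" where l: "\<And>x y. l (x + y) = l x + l y"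
    "\<And>q x. l (of_rat q * x) = q * l x" "l 1 = 1"
    by (rule rational_projection) blast
  have l0: "l 0 = 0" using l(2)[of 0 0] by simp
  have "\<exists>\<gamma>\<in>qform.span S. \<forall>v. (\<forall>i<k. v i \<in> L) \<longrightarrow> of_rat (l (\<alpha> v)) = \<gamma> v"
    using \<alpha>(2)
  proof (induction rule: cform.span_induct_alt)
    case base
    then show ?case by (intro bexI[of _ 0]) (auto simp: l0 qform.span_zero)
  next
    case (step c \<beta> \<alpha>)
    then obtain \<gamma> where \<gamma>: "\<gamma> \<in> qform.span S"
      "\<And>v. (\<forall>i<k. v i \<in> L) \<Longrightarrow> of_rat (l (\<alpha> v)) = \<gamma> v" by blast
    have "of_rat (l ((cscale c \<beta> + \<alpha>) v)) = (qscale (l c) \<beta> + \<gamma>) v" if v: "\<forall>i<k. v i \<in> L" for v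
    proof -
      have "\<beta> v \<in> \<rat>" using S step(1) v by (intro H_rat_values) auto
      then obtain q where q: "\<beta> v = of_rat q" by (rule Rats_cases)
      have "l (c * of_rat q) = q * l c" using l(2)[of q c] by (simp add: mult.commute)
      then show ?thesis
        using \<gamma>(2)[OF v] by (simp add: cscale_def qscale_def q l(1) of_rat_add of_rat_mult mult.commute)
    qed
    moreover have "qscale (l c) \<beta> + \<gamma> \<in> qform.span S"
      by (rule qform.span_add[OF qform.span_scale[OF qform.span_base[OF step(1)]] \<gamma>(1)])
    ultimately show ?case by blast
  qed
  then obtain \<gamma> where \<gamma>: "\<gamma> \<in> qform.span S" "\<And>v. (\<forall>i<k. v i \<in> L) \<Longrightarrow> of_rat (l (\<alpha> v)) = \<gamma> v"
    by blast
  have "\<gamma> \<in> H_rat L k" using \<gamma>(1) qform.span_minimal[OF S subspace_H_rat] by blast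
  have "\<alpha> - \<gamma> = 0"
  proof (rule form_eq_0_on_lattice[OF L])
    show "\<alpha> - \<gamma> \<in> H_complex k"
      using \<alpha>(1) \<open>\<gamma> \<in> H_rat L k\<close> by (intro cform.subspace_diff[OF subspace_H_complex] H_ratD)
    show "(\<alpha> - \<gamma>) v = 0" if "\<And>i. i < k \<Longrightarrow> v i \<in> L" for v
    proof -
      have "\<alpha> v \<in> \<rat>" using that by (intro H_rat_values[OF \<alpha>(1)])
      then obtain q where "\<alpha> v = of_rat q" by (rule Rats_cases)
      moreover have "l (of_rat q) = q" using l(2)[of q 1] l(3) by simp
      ultimately show ?thesis using \<gamma>(2)[of v] that by simp
    qed
  qed
  then show ?thesis using \<gamma>(1) by simp
qed

lemma prod_pencil:
  fixes a b :: "nat \<Rightarrow> complex"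
  shows "(\<Prod>i<n. a i + s * b i) = (\<Sum>X\<in>Pow {..<n}. s ^ card X * (\<Prod>i<n. if i \<in> X then b i else a i))"
proof -
  have "(\<Prod>i<n. a i + s * b i) = (\<Prod>i<n. s * b i + a i)" by (simp add: add.commute)
  also have "\<dots> = (\<Sum>X\<in>Pow {..<n}. (\<Prod>i\<in>X. s * b i) * (\<Prod>i\<in>{..<n} - X. a i))"
    by (rule prod_add) simp
  also have "\<dots> = (\<Sum>X\<in>Pow {..<n}. s ^ card X * (\<Prod>i<n. if i \<in> X then b i else a i))"
  proof (rule sum.cong)
    fix X assume "X \<in> Pow {..<n}"
    then have X: "{..<n} \<inter> {i. i \<in> X} = X" "{..<n} \<inter> - {i. i \<in> X} = {..<n} - X" by auto
    show "(\<Prod>i\<in>X. s * b i) * (\<Prod>i\<in>{..<n} - X. a i) = s ^ card X * (\<Prod>i<n. if i \<in> X then b i else a i)"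
      unfolding prod.If_cases[OF finite_lessThan] X by (simp add: prod.distrib mult.assoc)
  qed simp
  finally show ?thesis .
qed

text \<open>
  The power is expanded over the set \<open>X\<close> of the factors at which \<open>s \<phi>\<^sub>2\<close> is chosen. Even powers of \<open>s\<close> are
  rational and odd powers are rational multiples of \<open>s\<close>; the two groups of summands make up \<open>P\<close> and \<open>Q\<close>,
  which are the same for both square roots of \<open>N\<close>.
\<close>

lemma cup_pencil:
  fixes \<phi>\<^sub>1 \<phi>\<^sub>2 :: "(complex^'g::finite) form"
  assumes "\<phi>\<^sub>1 \<in> divisor_classes L" "\<phi>\<^sub>2 \<in> divisor_classes L"
  obtains P Q where "P \<in> qform.span (divisor_products L n)" "Q \<in> qform.span (divisor_products L n)"
    "\<And>s. s * s = of_int N \<Longrightarrow> cup 2 n (\<lambda>_ v. \<phi>\<^sub>1 v + s * \<phi>\<^sub>2 v) = P + cscale s Q"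
proof -
  define D where "D X = cup 2 n (\<lambda>i. if i \<in> X then \<phi>\<^sub>2 else \<phi>\<^sub>1)" for X
  have D: "D X \<in> divisor_products L n" for X
    unfolding D_def divisor_products_def using assms by auto
  define T where "T b = (\<Sum>X\<in>{X\<in>Pow {..<n}. even (card X) = b}. qscale (of_int N ^ (card X div 2)) (D X))" for b
  have T: "T b \<in> qform.span (divisor_products L n)" for b
    unfolding T_def by (intro qform.span_sum qform.span_scale qform.span_base D)
  have "cup 2 n (\<lambda>_ v. \<phi>\<^sub>1 v + s * \<phi>\<^sub>2 v) = T True + cscale s (T False)" if s: "s * s = of_int N" for s
  proof
    fix v :: "nat \<Rightarrow> complex^'g"
    have pow: "s ^ m = (if even m then of_int N ^ (m div 2) else s * of_int N ^ (m div 2))" for m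
    proof -
      have "s ^ m = s ^ (2 * (m div 2) + m mod 2)" by simp
      also have "\<dots> = (s * s) ^ (m div 2) * s ^ (m mod 2)" unfolding power_add power_mult by (simp add: power2_eq_square)
      finally have e: "s ^ m = of_int N ^ (m div 2) * s ^ (m mod 2)" by (simp only: s)
      show ?thesis
      proof (cases "even m")
        case True
        then have "m mod 2 = 0" by presburger
        then show ?thesis using e True by simp
      next
        case False
        then have "m mod 2 = 1" by presburger
        then show ?thesis using e False by simp
      qed
    qed
    have "cup 2 n (\<lambda>_ v. \<phi>\<^sub>1 v + s * \<phi>\<^sub>2 v) v = (\<Sum>X\<in>Pow {..<n}. s ^ card X * D X v)"
    proof -
      have app: "(if i \<in> X then \<phi>\<^sub>2 else \<phi>\<^sub>1) w = (if i \<in> X then \<phi>\<^sub>2 w else \<phi>\<^sub>1 w)" for i X w by simp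
      show ?thesis
        unfolding cup_def D_def prod_pencil app
        by (simp add: sum_distrib_left sum_divide_distrib mult.left_commute)
           (rule sum.swap)
    qed
    also have "\<dots> = (\<Sum>X\<in>{X\<in>Pow {..<n}. even (card X) = True}. s ^ card X * D X v) +
        (\<Sum>X\<in>{X\<in>Pow {..<n}. even (card X) = False}. s ^ card X * D X v)"
      by (subst sum.union_disjoint[symmetric]) (auto intro!: sum.cong)
    also have "\<dots> = (T True + cscale s (T False)) v"
      by (simp add: T_def cscale_def qscale_def sum_form_apply pow sum_distrib_left of_rat_power mult.assoc)
    finally show "cup 2 n (\<lambda>_ v. \<phi>\<^sub>1 v + s * \<phi>\<^sub>2 v) v = (T True + cscale s (T False)) v" .
  qed
  then show thesis using that T by blast
qed


section \<open>Eigenspaces and Weil classes\<close>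

lemma complex_embeddingD:
  assumes "complex_embedding L K \<rho>"
  shows "\<And>x y. x \<in> K \<Longrightarrow> y \<in> K \<Longrightarrow> \<rho> (x + y) = \<rho> x + \<rho> y"
    "\<And>x y. x \<in> K \<Longrightarrow> y \<in> K \<Longrightarrow> \<rho> (x ** y) = \<rho> x * \<rho> y" "\<rho> (mat 1) = 1"
  using assms by (auto simp: complex_embedding_def ring_hom_def complex_ring_def endo_alg_def)

lemma complex_embedding_cnj:
  assumes "complex_embedding L K \<rho>"
  shows "complex_embedding L K (\<lambda>x. cnj (\<rho> x))"
  using assms by (auto simp: complex_embedding_def ring_hom_def complex_ring_def endo_alg_def)

lemma complex_embedding_scale_int:
  fixes L :: "(complex^'g::finite) set"
  assumes L: "torus_lattice L" and K: "subring K (endo_alg L)" and \<rho>: "complex_embedding L K \<rho>"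
    and y: "y \<in> K"
  shows "\<rho> (real_of_int z *\<^sub>R y) = of_int z * \<rho> y"
proof -
  note add = complex_embeddingD(1)[OF \<rho>]
  have step: "\<rho> (real_of_int (i + 1) *\<^sub>R y) = \<rho> (real_of_int i *\<^sub>R y) + \<rho> y" for i
    using add[OF subring_scale_int[OF L K y, of i] y] by (simp add: scaleR_add_left)
  have "\<rho> 0 = 0" using add[OF subring_endo_algD(3)[OF L K] subring_endo_algD(3)[OF L K]] by simp
  show ?thesis
  proof (induction z rule: int_induct[of _ 0])
    case base
    then show ?case using \<open>\<rho> 0 = 0\<close> by simp
  next
    case (step1 i)
    then show ?case using step[of i] by (simp add: algebra_simps)
  next
    case (step2 i)
    then show ?case using step[of "i - 1"] by (simp add: algebra_simps)
  qed
qed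

text \<open>
  An integral multiple of any \<open>x \<in> K\<close> is an integral combination of \<open>1\<close> and \<open>\<kappa>\<close>, so an eigenvector of \<open>\<kappa>\<close>
  for \<open>\<rho> \<kappa>\<close> is one of \<open>x\<close> for \<open>\<rho> x\<close>.
\<close>

lemma eigenspace_generator:
  fixes L :: "(complex^'g::finite) set"
  assumes L: "torus_lattice L" and K: "subring K (endo_alg L)" and \<rho>: "complex_embedding L K \<rho>"
    and \<kappa>: "\<kappa> \<in> K" and gen: "\<And>x. x \<in> K \<Longrightarrow> \<exists>k a b :: int. k \<noteq> 0 \<and>
        real_of_int k *\<^sub>R x = real_of_int a *\<^sub>R mat 1 + real_of_int b *\<^sub>R \<kappa>"
  shows "eigenspace K \<rho> = eigenforms \<kappa> (\<rho> \<kappa>) 1"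
proof (intro equalityI subsetI)
  fix \<phi> assume "\<phi> \<in> eigenspace K \<rho>"
  then show "\<phi> \<in> eigenforms \<kappa> (\<rho> \<kappa>) 1" using \<kappa> unfolding eigenforms_1_iff by (auto simp: eigenspace_def)
next
  fix \<phi> assume \<phi>: "\<phi> \<in> eigenforms \<kappa> (\<rho> \<kappa>) 1"
  then have H: "\<phi> \<in> H_complex 1" by (rule eigenforms_H_complex)
  have "pullback x \<phi> v = cscale (\<rho> x) \<phi> v" if x: "x \<in> K" for x v
  proof -
    obtain k a b :: int where k: "k \<noteq> 0"
      "real_of_int k *\<^sub>R x = real_of_int a *\<^sub>R mat 1 + real_of_int b *\<^sub>R \<kappa>" using gen[OF x] by blast
    have lin: "linear (\<lambda>u. \<phi> (v(0 := u)))" by (rule H_complex_linear[OF H]) simp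
    have slot: "\<phi> (\<lambda>i. y *v v i) = \<phi> (v(0 := y *v v 0))" for y
      by (rule H_complex_cong[OF H]) simp
    have eig: "\<phi> (v(0 := \<kappa> *v v 0)) = \<rho> \<kappa> * \<phi> v"
      using \<phi> by (simp add: eigenforms_def)
    note one = subring_endo_algD(2)[OF L K]
    have "of_int k * \<rho> x = \<rho> (real_of_int a *\<^sub>R mat 1 + real_of_int b *\<^sub>R \<kappa>)"
      using complex_embedding_scale_int[OF L K \<rho> x, of k] k(2) by simp
    also have "\<dots> = of_int a + of_int b * \<rho> \<kappa>"
      using complex_embeddingD(1)[OF \<rho> subring_scale_int[OF L K one] subring_scale_int[OF L K \<kappa>]]
        complex_embedding_scale_int[OF L K \<rho> one] complex_embedding_scale_int[OF L K \<rho> \<kappa>]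
        complex_embeddingD(3)[OF \<rho>] by simp
    finally have r: "of_int k * \<rho> x = of_int a + of_int b * \<rho> \<kappa>" .
    have "real_of_int k *\<^sub>R (x *v v 0) = real_of_int a *\<^sub>R v 0 + real_of_int b *\<^sub>R (\<kappa> *v v 0)"
      using arg_cong[OF k(2), of "\<lambda>m. m *v v 0"]
      by (simp add: scaleR_mult_vec matrix_vector_mult_add_rdistrib)
    then have "real_of_int k *\<^sub>R \<phi> (v(0 := x *v v 0)) =
        real_of_int a *\<^sub>R \<phi> (v(0 := v 0)) + real_of_int b *\<^sub>R \<phi> (v(0 := \<kappa> *v v 0))"
      using linear_scale[OF lin, of "real_of_int k" "x *v v 0"]
        linear_add[OF lin, of "real_of_int a *\<^sub>R v 0" "real_of_int b *\<^sub>R (\<kappa> *v v 0)"]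
        linear_scale[OF lin, of "real_of_int a" "v 0"] linear_scale[OF lin, of "real_of_int b" "\<kappa> *v v 0"]
      by metis
    then have "of_int k * \<phi> (v(0 := x *v v 0)) = (of_int a + of_int b * \<rho> \<kappa>) * \<phi> v"
      using eig by (simp add: scaleR_conv_of_real algebra_simps)
    then have "of_int k * \<phi> (v(0 := x *v v 0)) = of_int k * (\<rho> x * \<phi> v)"
      by (simp flip: r)
    then show ?thesis using k(1) by (simp add: pullback_def slot cscale_def)
  qed
  then show "\<phi> \<in> eigenspace K \<rho>" using H by (auto simp: eigenspace_def)
qed

lemma eigenforms_disjoint:
  assumes "\<alpha> \<in> eigenforms x s k" "\<alpha> \<in> eigenforms x t k" "s \<noteq> t" "k > 0"
  shows "\<alpha> = 0"
proof -
  have "\<alpha> v = 0" for v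
  proof -
    have "\<alpha> (v(0 := x *v v 0)) = s * \<alpha> (v(0 := v 0))" "\<alpha> (v(0 := x *v v 0)) = t * \<alpha> (v(0 := v 0))"
      using assms(1,2,4) unfolding eigenforms_def by blast+
    then show ?thesis using assms(3) by auto
  qed
  then show ?thesis by (auto simp: zero_fun_def)
qed

lemma cform_span_pair:
  "cform.span {P, Q} = {cscale a P + cscale b Q | a b. True}"
  unfolding cform.span_insert cform.span_singleton by (auto simp: diff_eq_eq add.commute)

text \<open>
  The forms \<open>P \<plusminus> s Q\<close> are nonzero and belong to different eigenvalues of \<open>x\<close>, so they span the same complex plane as
  \<open>P\<close> and \<open>Q\<close>. By \<open>rational_descent\<close>, a rational subspace is determined by its complex span, whence
  the uniqueness that the definite description in \<open>weil_classes_def\<close> requires.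
\<close>

lemma weil_classes_eq:
  fixes L :: "(complex^'g::finite) set"
  assumes L: "torus_lattice L" and n: "n > 0"
    and PQ: "P \<in> H_rat L (2 * n)" "Q \<in> H_rat L (2 * n)" and s: "s \<noteq> 0"
    and \<Omega>: "P + cscale s Q \<in> eigenforms x s (2 * n)" "P + cscale s Q \<noteq> 0"
      "P + cscale (- s) Q \<in> eigenforms x (- s) (2 * n)" "P + cscale (- s) Q \<noteq> 0"
    and ext: "exterior_power (2 * n) (eigenspace K \<sigma>) = range (\<lambda>c. cscale c (P + cscale s Q))"
      "exterior_power (2 * n) (eigenspace K (\<lambda>x. cnj (\<sigma> x))) = range (\<lambda>c. cscale c (P + cscale (- s) Q))"
  shows "weil_classes L K \<sigma> n = qform.span {P, Q}"
proof -
  let ?R = "{\<alpha> + \<beta> | \<alpha> \<beta>. \<alpha> \<in> exterior_power (2 * n) (eigenspace K \<sigma>) \<and>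
      \<beta> \<in> exterior_power (2 * n) (eigenspace K (\<lambda>x. cnj (\<sigma> x)))}"
  have conv: "cscale a (P + cscale s Q) + cscale b (P + cscale (- s) Q)
      = cscale (a + b) P + cscale (s * (a - b)) Q" for a b
    by (auto simp: cscale_def algebra_simps)
  have R: "?R = cform.span {P, Q}"
  proof (intro equalityI subsetI)
    fix \<alpha> assume "\<alpha> \<in> ?R"
    then show "\<alpha> \<in> cform.span {P, Q}" unfolding ext cform_span_pair using conv by auto
  next
    fix \<alpha> assume "\<alpha> \<in> cform.span {P, Q}"
    then obtain y z where "\<alpha> = cscale y P + cscale z Q" unfolding cform_span_pair by blast
    then have "\<alpha> = cscale ((y + z / s) / 2) (P + cscale s Q) + cscale ((y - z / s) / 2) (P + cscale (- s) Q)"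
      unfolding conv using s by (simp add: field_simps)
    then show "\<alpha> \<in> ?R" unfolding ext by blast
  qed
  have zero: "y = 0 \<and> z = 0" if "cscale y P + cscale z Q = 0" for y z
  proof -
    define a b where "a = (y + z / s) / 2" and "b = (y - z / s) / 2"
    have "cscale a (P + cscale s Q) + cscale b (P + cscale (- s) Q) = 0"
      unfolding conv a_def b_def using s that by (simp add: field_simps)
    then have e: "cscale a (P + cscale s Q) = cscale (- b) (P + cscale (- s) Q)"
      by (auto simp: cscale_def fun_eq_iff eq_neg_iff_add_eq_0)
    have "cscale a (P + cscale s Q) \<in> eigenforms x s (2 * n)"
      "cscale (- b) (P + cscale (- s) Q) \<in> eigenforms x (- s) (2 * n)"
      by (rule cform.subspace_scale[OF subspace_eigenforms \<Omega>(1)]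
          cform.subspace_scale[OF subspace_eigenforms \<Omega>(3)])+
    then have "cscale a (P + cscale s Q) = 0"
      using eigenforms_disjoint[of "cscale a (P + cscale s Q)" x s "2 * n" "- s"] e s n by simp
    moreover from this e have "cscale (- b) (P + cscale (- s) Q) = 0" by simp
    ultimately have "a = 0" "b = 0" using \<Omega> by auto
    then show ?thesis using s by (auto simp: a_def b_def field_simps)
  qed
  have "Q \<noteq> 0"
  proof
    assume "Q = 0"
    then have "cscale 0 P + cscale 1 Q = 0" by (auto simp: cscale_def)
    then show False using zero by fastforce
  qed
  moreover have P: "P \<notin> qform.span {Q}"
  proof
    assume "P \<in> qform.span {Q}"
    then obtain q where "P = cscale (of_rat q) Q" by (auto simp: qform.span_singleton qscale_eq_cscale)
    then have "cscale 1 P + cscale (- of_rat q) Q = 0" by (auto simp: cscale_def)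
    then show False using zero by fastforce
  qed
  ultimately have ind: "qform.independent {P, Q}" and "P \<noteq> Q"
    by (auto simp: qform.independent_insert qform.span_base)
  let ?W = "qform.span {P, Q}"
  have q_sub_c: "qform.span S \<subseteq> cform.span S" for S :: "(complex^'g) form set"
    by (rule qform.span_minimal[OF cform.span_superset qform.subspaceI])
       (auto intro: cform.span_add cform.span_scale cform.span_zero simp: qscale_eq_cscale)
  have span_W: "cform.span ?W = cform.span {P, Q}"
    using q_sub_c[of "{P, Q}"]
    by (intro equalityI cform.span_minimal cform.span_mono) (auto simp: qform.span_base cform.subspace_span)
  have W_rat: "?W \<subseteq> H_rat L (2 * n)"
    by (rule qform.span_minimal[OF _ subspace_H_rat]) (use PQ in auto)
  show ?thesis
    unfolding weil_classes_def R
  proof (rule the_equality)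
    show "qform.subspace ?W \<and> ?W \<subseteq> H_rat L (2 * n) \<and> qform.dim ?W = 2 \<and> cform.span ?W = cform.span {P, Q}"
      using W_rat span_W qform.dim_span_eq_card_independent[OF ind] \<open>P \<noteq> Q\<close>
      by (simp add: qform.subspace_span)
  next
    fix W assume W: "qform.subspace W \<and> W \<subseteq> H_rat L (2 * n) \<and> qform.dim W = 2 \<and>
        cform.span W = cform.span {P, Q}"
    have "W \<subseteq> ?W"
    proof
      fix \<alpha> assume "\<alpha> \<in> W"
      then have "\<alpha> \<in> H_rat L (2 * n)" "\<alpha> \<in> cform.span {P, Q}" using W cform.span_base by blast+
      then show "\<alpha> \<in> ?W" using PQ by (intro rational_descent[OF L]) auto
    qed
    moreover have "\<alpha> \<in> W" if "\<alpha> \<in> {P, Q}" for \<alpha>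
    proof -
      have "\<alpha> \<in> cform.span W" using W that cform.span_base[of \<alpha> "{P, Q}"] by auto
      then have "\<alpha> \<in> qform.span W" using W that PQ by (intro rational_descent[OF L]) auto
      then show ?thesis using W by (simp add: qform.span_eq_iff[THEN iffD2])
    qed
    then have "?W \<subseteq> W" using W by (intro qform.span_minimal) auto
    ultimately show "W = ?W" by blast
  qed
qed

lemma negative_square_root:
  fixes s :: complex
  assumes "s * s = of_int N" "N < 0"
  shows "Re s = 0" "Im s \<noteq> 0"
proof -
  have re: "Re s * Re s - Im s * Im s = real_of_int N" and im: "Re s * Im s = 0"
    using assms(1) by (auto simp: complex_eq_iff)
  show "Im s \<noteq> 0"
  proof
    assume "Im s = 0"
    then have "real_of_int N = Re s * Re s" using re by simp
    then have "0 \<le> real_of_int N" by (simp only: zero_le_square)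
    then show False using assms(2) by simp
  qed
  then show "Re s = 0" using im by simp
qed

text \<open>
  The relation \<open>\<phi> (\<kappa> u) v = s * \<phi> u v\<close> holds since \<open>\<kappa>\<^sup>2 = s\<^sup>2 = N\<close>. As \<open>s\<close> is purely imaginary and the two
  forms are real, \<open>\<phi> u = 0\<close> implies \<open>E (y u) v = 0\<close> for all \<open>v\<close>, which gives nondegeneracy.
\<close>

lemma eigen_symplectic_form:
  fixes L :: "(complex^'g::finite) set"
  assumes g: "CARD('g) = 2 * n" and pol: "polarization L E"
    and \<kappa>: "\<kappa> ** \<kappa> = rat_mat (of_int N)" and s: "s * s = of_int N" "N < 0"
    and sym: "\<And>u v. E (y *v u) v = E u (y *v v)"
      "\<And>u v. E ((y ** \<kappa>) *v u) v = E u ((y ** \<kappa>) *v v)"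
    and inj: "\<And>u. y *v u = 0 \<Longrightarrow> u = 0"
  shows "eigen_symplectic \<kappa> s n (\<lambda>u v. of_real (E ((y ** \<kappa>) *v u) v) + s * of_real (E (y *v u) v))"
proof (rule eigen_symplectic.intro)
  note left = polarization_linear_left[OF pol] and right = polarization_linear_right[OF pol]
  note Re_Im = negative_square_root[OF s]
  show "CARD('g) = 2 * n" "Re s = 0" "Im s \<noteq> 0" by fact+
  have anti: "E (x *v u) v = - E (x *v v) u" if "\<And>u v. E (x *v u) v = E u (x *v v)" for x u v
    using that polarization_antisym[OF pol] by metis
  show "linear (\<lambda>u. complex_of_real (E ((y ** \<kappa>) *v u) v) + s * of_real (E (y *v u) v))" for v
    by (simp add: linear_iff matrix_vector_right_distrib mult_vec_scaleR linear_add[OF left]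
        linear_scale[OF left] scaleR_conv_of_real[where 'a = complex] algebra_simps)
  show "complex_of_real (E ((y ** \<kappa>) *v u) u) + s * of_real (E (y *v u) u) = 0" for u
    using anti[OF sym(1), of u u] anti[OF sym(2), of u u] by simp
  show "complex_of_real (E ((y ** \<kappa>) *v u) v) + s * of_real (E (y *v u) v) =
      - (of_real (E ((y ** \<kappa>) *v v) u) + s * of_real (E (y *v v) u))" for u v
    using anti[OF sym(1), of u v] anti[OF sym(2), of u v] by simp
  show "complex_of_real (E ((y ** \<kappa>) *v (\<kappa> *v u)) v) + s * of_real (E (y *v (\<kappa> *v u)) v) =
      s * (of_real (E ((y ** \<kappa>) *v u) v) + s * of_real (E (y *v u) v))" for u v
  proof -
    have "(y ** \<kappa>) *v (\<kappa> *v u) = y *v ((\<kappa> ** \<kappa>) *v u)" by (simp flip: matrix_vector_mul_assoc)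
    also have "\<dots> = real_of_int N *\<^sub>R (y *v u)" by (simp add: \<kappa> rat_mat_mult_vec mult_vec_scaleR)
    finally have "E ((y ** \<kappa>) *v (\<kappa> *v u)) v = real_of_int N * E (y *v u) v"
      by (simp add: linear_scale[OF left])
    then have "complex_of_real (E ((y ** \<kappa>) *v (\<kappa> *v u)) v) = s * s * of_real (E (y *v u) v)"
      using s(1) by simp
    then show ?thesis by (simp add: matrix_vector_mul_assoc algebra_simps)
  qed
  show "u = 0" if "\<And>v. complex_of_real (E ((y ** \<kappa>) *v u) v) + s * of_real (E (y *v u) v) = 0" for u
  proof -
    have "E (y *v u) v = 0" for v
      using arg_cong[OF that[of v], of Im] Re_Im by simp
    then show ?thesis using inj polarization_nondegenerate[OF pol] by blast
  qed
qed

lemma ring_iso_commutative: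
  assumes "endo_alg B \<simeq> subalg A K" and K: "\<And>x y. x \<in> K \<Longrightarrow> y \<in> K \<Longrightarrow> x ** y = y ** x"
    and xy: "quasi_hom B B x" "quasi_hom B B y" and B: "torus_lattice B"
  shows "x ** y = y ** x"
proof -
  obtain h where h: "h \<in> ring_iso (endo_alg B) (subalg A K)"
    using assms(1) by (auto simp: is_ring_iso_def)
  have xy': "x \<in> carrier (endo_alg B)" "y \<in> carrier (endo_alg B)"
    using xy by (auto simp: carrier_endo_alg)
  have mult: "h (a ** b) = h a ** h b" and hK: "h a \<in> K"
    if "a \<in> carrier (endo_alg B)" "b \<in> carrier (endo_alg B)" for a b
    using ring_iso_memE(1)[OF h that(1)] ring_iso_memE(2)[OF h that] by simp_all
  have inj: "inj_on h (carrier (endo_alg B))" using ring_iso_memE(5)[OF h] by (simp add: bij_betw_def)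
  have "h (x ** y) = h (y ** x)"
    using mult[OF xy'] mult[OF xy'(2,1)] K hK[OF xy'] hK[OF xy'(2,1)] by simp
  moreover have "x ** y \<in> carrier (endo_alg B)" "y ** x \<in> carrier (endo_alg B)"
    using quasi_hom_compose[OF B B] xy by (auto simp: carrier_endo_alg)
  ultimately show ?thesis using inj by (auto dest: inj_onD)
qed


section \<open>Quaternionic Weil classes\<close>

theorem proposition5p3:
  fixes A :: "(complex^'g::finite) set"
    and E :: "complex^'g \<Rightarrow> complex^'g \<Rightarrow> real"
    and F K :: "(complex^'g^'g) set"
    and \<sigma> :: "complex^'g^'g \<Rightarrow> complex"
    and n :: nat
    and B :: "(complex^'h::finite) set"
    and E\<^sub>B :: "complex^'h \<Rightarrow> complex^'h \<Rightarrow> real"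
    and K\<^sub>B :: "(complex^'h^'h) set"
  assumes "CARD('g) = 2 * n"
    and "quaternion_type A E F"
    and "quadratic_field A K" and "K \<subseteq> F"
    and "complex_embedding A K \<sigma>"
    and "isogenous A (square_torus B)"
    and "weil_type B E\<^sub>B K\<^sub>B"
    and "subalg B K\<^sub>B \<simeq> subalg A K"
    and "endo_alg B \<simeq> subalg A K"
  shows "quaternion_weil_classes A F K \<sigma> n \<subseteq> qform.span (divisor_products A n)"
proof -
  have A: "torus_lattice A" "polarization A E" and F: "definite_quaternion_algebra A F" "norm_compatible F E"
    using assms(2) by (auto simp: quaternion_type_def polarized_abelian_variety_def)
  have B: "torus_lattice B" "polarization B E\<^sub>B" and K\<^sub>B: "quadratic_field B K\<^sub>B" "norm_compatible K\<^sub>B E\<^sub>B"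
    using assms(7)
    by (auto simp: weil_type_def polarized_abelian_variety_def imaginary_quadratic_field_def)
  have Fsub: "subring F (endo_alg A)" and Fdiv: "\<And>x. x \<in> F \<Longrightarrow> x \<noteq> 0 \<Longrightarrow> \<exists>y\<in>F. x ** y = mat 1 \<and> y ** x = mat 1"
    and Fcenter: "{z\<in>F. \<forall>x\<in>F. z ** x = x ** z} = range rat_mat"
    using F(1) unfolding definite_quaternion_algebra_def by blast+
  note F_closed = subring_endo_algD[OF A(1) Fsub]
  have Kfield: "subfield K (endo_alg A)" using assms(3) by (simp add: quadratic_field_def)
  note Ksub = subfieldE(1)[OF Kfield]
  have n: "n > 0" using assms(1) zero_less_card_finite[where 'a = 'g] by linarith
  have rat0: "rat_mat 0 = (0 :: complex^'i::finite^'i)" by (simp add: rat_mat_def mat_def vec_eq_iff)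

  obtain \<kappa> and N :: int where \<kappa>: "\<kappa> \<in> K" "\<kappa> ** \<kappa> = rat_mat (of_int N)" "\<kappa> \<notin> range rat_mat"
    and gen: "\<And>x. x \<in> K \<Longrightarrow> \<exists>k a b :: int. k \<noteq> 0 \<and>
        real_of_int k *\<^sub>R x = real_of_int a *\<^sub>R mat 1 + real_of_int b *\<^sub>R \<kappa>"
    by (rule quadratic_field_generator[OF A(1) assms(3)]) blast
  have \<kappa>F: "\<kappa> \<in> F" using \<kappa>(1) assms(4) by blast
  have \<kappa>_skew: "skew E \<kappa>"
    by (rule skew_if_square_rational[OF A(2) F(2) \<kappa>F F_closed(4)[OF \<kappa>F F_closed(2)] \<kappa>(2,3)])
  have "\<kappa> \<noteq> 0" using \<kappa>(3) rat0 by (metis rangeI)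
  have N: "N < 0" by (rule skew_square_negative[OF A(2) \<kappa>_skew \<kappa>(2) \<open>\<kappa> \<noteq> 0\<close>])

  \<comment> \<open>The centre of \<open>F\<close> is \<open>\<rat>\<close>, so some \<open>x\<close> does not commute with \<open>\<kappa>\<close>; the commutator \<open>z\<close> is skew,
    anticommutes with \<open>\<kappa>\<close>, and is invertible because \<open>F\<close> is a division algebra.\<close>
  obtain x where x: "x \<in> F" "\<kappa> ** x \<noteq> x ** \<kappa>" using Fcenter \<kappa>F \<kappa>(3) by blast
  define z where "z = \<kappa> ** x - x ** \<kappa>"
  have zF: "z \<in> F"
    using F_closed(4)[OF F_closed(5)[OF \<kappa>F x(1)] F_closed(6)[OF F_closed(5)[OF x(1) \<kappa>F]]] by (simp add: z_def)
  have "z \<noteq> 0" using x(2) by (simp add: z_def)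
  then obtain z' where z': "z' ** z = mat 1" using Fdiv[OF zF] by blast
  obtain t where "\<And>u v. E (x *v u) v + E u (x *v v) = real_of_rat t * E u v"
    by (rule norm_compatible_trace[OF A(2) F(2) x(1) F_closed(4)[OF x(1) F_closed(2)]]) blast
  then have z_skew: "skew E z" unfolding z_def by (rule skew_commutator[OF A(2) \<kappa>_skew])
  have \<kappa>\<kappa>: "\<kappa> *v (\<kappa> *v u) = real_of_int N *\<^sub>R u" for u
    by (simp add: matrix_vector_mul_assoc \<kappa>(2) rat_mat_mult_vec)
  have z\<kappa>: "z *v (\<kappa> *v u) = - (\<kappa> *v (z *v u))" for u
    by (simp add: z_def matrix_vector_mult_diff_rdistrib matrix_vector_mult_diff_distrib \<kappa>\<kappa> mult_vec_scaleR
        flip: matrix_vector_mul_assoc)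

  \<comment> \<open>The same argument on \<open>B\<close> gives a skew \<open>c\<close>, which is then moved to the centre of \<open>End(A) \<otimes> \<rat>\<close>.\<close>
  obtain c and M :: int where c: "c \<in> K\<^sub>B" "c ** c = rat_mat (of_int M)" "c \<notin> range rat_mat"
    by (rule quadratic_field_generator[OF B(1) K\<^sub>B(1)]) blast
  have K\<^sub>Bsub: "subring K\<^sub>B (endo_alg B)" using K\<^sub>B(1) subfieldE(1) by (auto simp: quadratic_field_def)
  note K\<^sub>B_closed = subring_endo_algD[OF B(1) K\<^sub>Bsub]
  have c_skew: "skew E\<^sub>B c"
    by (rule skew_if_square_rational[OF B(2) K\<^sub>B(2) c(1) K\<^sub>B_closed(4)[OF c(1) K\<^sub>B_closed(2)] c(2,3)])
  have "c \<noteq> 0" using c(3) rat0 by (metis rangeI)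
  have M: "M < 0" by (rule skew_square_negative[OF B(2) c_skew c(2) \<open>c \<noteq> 0\<close>])
  have c_hom: "quasi_hom B B c" using c(1) K\<^sub>B_closed(1) by blast
  have B_comm: "x ** y = y ** x" if "quasi_hom B B x" "quasi_hom B B y" for x y
    by (rule ring_iso_commutative[OF assms(9) _ that B(1)]) (use subfieldE(4)[OF Kfield] in simp)
  obtain d where d: "quasi_hom A A d" "skew E d" "d ** d = rat_mat (of_int M)"
    and d_comm: "\<forall>x. quasi_hom A A x \<longrightarrow> x ** d = d ** x"
    by (rule central_skew_endomorphism[OF A B assms(6) B_comm c_hom c_skew c(2)]) blast

  \<comment> \<open>Adjoints: \<open>(d z)\<^sup>* = z d = d z\<close> and \<open>(d z \<kappa>)\<^sup>* = - \<kappa> z d = d z \<kappa>\<close>.\<close>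
  have hom: "quasi_hom A A z" "quasi_hom A A \<kappa>" using zF \<kappa>F F_closed(1) by auto
  define y where "y = d ** z"
  have y_hom: "quasi_hom A A y" "quasi_hom A A (y ** \<kappa>)"
    unfolding y_def
    by (rule quasi_hom_compose[OF A(1) A(1) hom(1) d(1)]
        quasi_hom_compose[OF A(1) A(1) hom(2) quasi_hom_compose[OF A(1) A(1) hom(1) d(1)]])+
  have dz: "z *v (d *v u) = d *v (z *v u)" and d\<kappa>: "\<kappa> *v (d *v u) = d *v (\<kappa> *v u)" for u
    using d_comm hom by (simp_all add: matrix_vector_mul_assoc)
  have sk: "E (z *v u) v = - E u (z *v v)" "E (\<kappa> *v u) v = - E u (\<kappa> *v v)" "E (d *v u) v = - E u (d *v v)" for u v
    using z_skew \<kappa>_skew d(2) by (auto simp: skew_def)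
  have y_sym: "E (y *v u) v = E u (y *v v)" for u v
    by (simp add: y_def sk dz flip: matrix_vector_mul_assoc)
  have y\<kappa>_sym: "E ((y ** \<kappa>) *v u) v = E u ((y ** \<kappa>) *v v)" for u v
    by (simp add: y_def sk dz d\<kappa> z\<kappa> linear_neg[OF linear_mult_vec]
        linear_neg[OF polarization_linear_left[OF A(2)]] linear_neg[OF polarization_linear_right[OF A(2)]]
        flip: matrix_vector_mul_assoc)
  have y_inj: "u = 0" if "y *v u = 0" for u
  proof -
    have dd: "d *v (d *v w) = real_of_int M *\<^sub>R w" for w
      by (simp add: matrix_vector_mul_assoc d(3) rat_mat_mult_vec)
    have "y *v u = d *v (z *v u)" by (simp add: y_def matrix_vector_mul_assoc)
    then have "real_of_int M *\<^sub>R (z *v u) = d *v (y *v u)" by (simp add: dd)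
    then have "z *v u = 0" using that M by simp
    then have "z' *v (z *v u) = 0" by simp
    then show ?thesis by (simp add: matrix_vector_mul_assoc z')
  qed

  define \<phi>\<^sub>1 \<phi>\<^sub>2 :: "(complex^'g) form" where
    "\<phi>\<^sub>1 = (\<lambda>v. of_real (E ((y ** \<kappa>) *v v 0) (v 1)))" and "\<phi>\<^sub>2 = (\<lambda>v. of_real (E (y *v v 0) (v 1)))"
  have \<phi>: "\<phi>\<^sub>1 \<in> divisor_classes A" "\<phi>\<^sub>2 \<in> divisor_classes A"
    unfolding \<phi>\<^sub>1_def \<phi>\<^sub>2_def
    by (rule self_adjoint_divisor_class[OF A(2) y_hom(2) y\<kappa>_sym] self_adjoint_divisor_class[OF A(2) y_hom(1) y_sym])+
  obtain P Q where PQ: "P \<in> qform.span (divisor_products A n)" "Q \<in> qform.span (divisor_products A n)"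
    and pencil: "\<And>s. s * s = of_int N \<Longrightarrow> cup 2 n (\<lambda>_ v. \<phi>\<^sub>1 v + s * \<phi>\<^sub>2 v) = P + cscale s Q"
    by (rule cup_pencil[OF \<phi>]) blast

  \<comment> \<open>Both \<open>\<sigma>\<close> and its conjugate embedding are needed, with the same \<open>P\<close> and \<open>Q\<close>.\<close>
  have embed: "\<rho> \<kappa> * \<rho> \<kappa> = of_int N"
    "P + cscale (\<rho> \<kappa>) Q \<in> eigenforms \<kappa> (\<rho> \<kappa>) (2 * n)" "P + cscale (\<rho> \<kappa>) Q \<noteq> 0"
    "exterior_power (2 * n) (eigenspace K \<rho>) = range (\<lambda>c. cscale c (P + cscale (\<rho> \<kappa>) Q))"
    if \<rho>: "complex_embedding A K \<rho>" for \<rho>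
  proof -
    have "rat_mat (of_int N) = real_of_int N *\<^sub>R (mat 1 :: complex^'g^'g)"
      by (simp add: matrix_eq rat_mat_mult_vec scaleR_mult_vec)
    then have "\<rho> (\<kappa> ** \<kappa>) = of_int N"
      using complex_embedding_scale_int[OF A(1) Ksub \<rho> subring_endo_algD(2)[OF A(1) Ksub], of N]
        complex_embeddingD(3)[OF \<rho>] \<kappa>(2) by simp
    then show square: "\<rho> \<kappa> * \<rho> \<kappa> = of_int N" using complex_embeddingD(2)[OF \<rho> \<kappa>(1,1)] by simp
    interpret eigen_symplectic \<kappa> "\<rho> \<kappa>" n "\<lambda>u v. of_real (E ((y ** \<kappa>) *v u) v) + \<rho> \<kappa> * of_real (E (y *v u) v)"
      by (rule eigen_symplectic_form[OF assms(1) A(2) \<kappa>(2) square N y_sym y\<kappa>_sym y_inj])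
    have \<Omega>: "cup 2 n (\<lambda>_. phi_form) = P + cscale (\<rho> \<kappa>) Q"
      using pencil[OF square] by (simp add: \<phi>\<^sub>1_def \<phi>\<^sub>2_def)
    show "P + cscale (\<rho> \<kappa>) Q \<in> eigenforms \<kappa> (\<rho> \<kappa>) (2 * n)" "P + cscale (\<rho> \<kappa>) Q \<noteq> 0"
      using phi_form_power_eigenform phi_form_power_nonzero unfolding \<Omega> by auto
    have "eigenspace K \<rho> = eigenforms \<kappa> (\<rho> \<kappa>) 1"
      by (rule eigenspace_generator[OF A(1) Ksub \<rho> \<kappa>(1) gen])
    then show "exterior_power (2 * n) (eigenspace K \<rho>) = range (\<lambda>c. cscale c (P + cscale (\<rho> \<kappa>) Q))"
      using exterior_power_eigenforms by (simp only: \<Omega>)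
  qed
  note e1 = embed[OF assms(5)] and e2 = embed[OF complex_embedding_cnj[OF assms(5)]]
  have Re_Im: "Re (\<sigma> \<kappa>) = 0" "Im (\<sigma> \<kappa>) \<noteq> 0" by (rule negative_square_root[OF e1(1) N])+
  have cnj: "cnj (\<sigma> \<kappa>) = - \<sigma> \<kappa>" using Re_Im by (simp add: complex_eq_iff)
  have rat: "qform.span (divisor_products A n) \<subseteq> H_rat A (2 * n)"
    by (rule qform.span_minimal[OF divisor_products_H_rat subspace_H_rat])
  have W: "weil_classes A K \<sigma> n = qform.span {P, Q}"
  proof (rule weil_classes_eq[OF A(1) n])
    show "P \<in> H_rat A (2 * n)" "Q \<in> H_rat A (2 * n)" using PQ rat by auto
    show "\<sigma> \<kappa> \<noteq> 0" using Re_Im by auto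
  qed (use e1 e2 in \<open>auto simp: cnj\<close>)
  have "weil_classes A K \<sigma> n \<subseteq> qform.span (divisor_products A n)"
    unfolding W by (rule qform.span_minimal) (use PQ in \<open>auto simp: qform.subspace_span\<close>)
  then have "(\<Union>x\<in>F. pullback x ` weil_classes A K \<sigma> n) \<subseteq> qform.span (divisor_products A n)"
    using pullback_divisor_products F_closed(1) by blast
  then show ?thesis
    unfolding quaternion_weil_classes_def by (rule qform.span_minimal) (rule qform.subspace_span)
qed

end
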